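(* Let $D\subset\mathbb{R}^2$ be a closed disk with smooth boundary and symplectic area $S(D)=\int_D dp\wedge dq>0$, and let $h:D\to D$ be a symplectic mapping (a diffeomorphism of $D$ preserving $dp\wedge dq$) which sends the boundary $\partial D$ to itself (not necessarily by the identity). Let $H_1,H_2$ be two Hamiltonians, $2\pi$-periodic in $t$, whose Hamiltonian flows $g^t_{H_1}$, $g^t_{H_2}$ leave $D$ invariant and satisfy $g^{2\pi}_{H_1}=g^{2\pi}_{H_2}=h$. Then there exists $n\in\mathbb{Z}$ such that $$\mathcal{H}(H_1)-\mathcal{H}(H_2)=\frac{n\,S(D)^2}{2},$$ where $\mathcal{H}$ denotes the helicity.
   Context: Coordinates on $\mathbb{R}^2$ are $(p,q)$, with symplectic form $dp\wedge dq$. A Hamiltonian is a real function $H(p,q,t)$ on $D\times\mathbb{R}$, $2\pi$-periodic in $t$, smooth in $(p,q)$ up to the boundary of $D$ and smooth in $t$ except possibly for finitely many jump discontinuities in $t$ per period. It defines the system $\dot p=-H_q$, $\dot q=H_p$. We write $g^t_H$ for the map sending an initial condition at time $0$ to the solution at time $t$. The disk $D$ is assumed invariant: $g^t_H(D)=D$ for all $t$. Consequently, for each $t$, $H(\cdot,\cdot,t)$ is constant on $\partial D$. Let $c(t)$ be this boundary value and put $\tilde H(p,q,t)=H(p,q,t)-c(t)$, so that $\tilde H=0$ on $\partial D$ for every $t$. The helicity of $H$ is $$\mathcal{H}(H)=\int_0^{2\pi}\int_D \tilde H(p,q,t)\,dp\wedge dq\wedge dt .$$ The gradient of $H$ is not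 required to vanish on $\partial D$. *)

theory Defs
  imports "HOL-Analysis.Analysis"
begin

text \<open>
  Points of the plane are pairs \<open>(p, q) :: real \<times> real\<close>, a time-dependent
  function \<open>H(p,q,t)\<close> is written \<open>H (p, q) t\<close>.
\<close>

subsection \<open>Smooth maps\<close>

primrec Ck_on ::
  "nat \<Rightarrow> 'a::euclidean_space set \<Rightarrow> ('a \<Rightarrow> 'b::euclidean_space) \<Rightarrow> bool" where
  "Ck_on 0 U f \<longleftrightarrow> continuous_on U f"
| "Ck_on (Suc k) U f \<longleftrightarrow>
     (\<forall>x\<in>U. f differentiable (at x)) \<and>
     (\<forall>v. Ck_on k U (\<lambda>x. frechet_derivative f (at x) v))"

text \<open>
  \<open>Ck_on\<close> is meant for open sets only.  On an arbitrary set, smooth means: restriction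
  of a \<open>C\<^sup>\<infinity>\<close> map defined on an open neighbourhood.  On a closed disk with smooth
  boundary (or its product with a compact time interval) this is smoothness up to the boundary.
\<close>

definition smooth_on ::
  "'a::euclidean_space set \<Rightarrow> ('a \<Rightarrow> 'b::euclidean_space) \<Rightarrow> bool" where
  "smooth_on S f \<longleftrightarrow>
     (\<exists>U g. open U \<and> S \<subseteq> U \<and> (\<forall>k. Ck_on k U g) \<and> (\<forall>x\<in>S. g x = f x))"

definition diffeo_between ::
  "'a::euclidean_space set \<Rightarrow> 'b::euclidean_space set \<Rightarrow> ('a \<Rightarrow> 'b) \<Rightarrow> bool" where
  "diffeo_between A B f \<longleftrightarrow>
     bij_betw f A B \<and> smooth_on A f \<and> smooth_on B (inv_into A f)"

definition smooth_closed_disk :: "(real \<times> real) set \<Rightarrow> bool" where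
  "smooth_closed_disk D \<longleftrightarrow> (\<exists>\<phi>. diffeo_between (cball (0 :: real \<times> real) 1) D \<phi>)"


subsection \<open>Symplectic maps of a disk\<close>

definition dp_dq :: "real \<times> real \<Rightarrow> real \<times> real \<Rightarrow> real" where
  "dp_dq u v = fst u * snd v - snd u * fst v"

definition symp_area :: "(real \<times> real) set \<Rightarrow> real" where
  "symp_area D = integral D (\<lambda>z. 1)"

text \<open>
  Derivatives at points of \<open>D\<close> are taken within \<open>D\<close>; on a disk with smooth boundary they
  are unique, also at boundary points.
\<close>

definition symplectic_diffeo :: "(real \<times> real) set \<Rightarrow> (real \<times> real \<Rightarrow> real \<times> real) \<Rightarrow> bool" where
  "symplectic_diffeo D h \<longleftrightarrow>
     diffeo_between D D h \<and>
     (\<forall>z\<in>D. \<forall>u v. dp_dq (frechet_derivative h (at z within D) u)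
                        (frechet_derivative h (at z within D) v) = dp_dq u v)"


subsection \<open>Hamiltonians, their flows and helicity\<close>

text \<open>
  \<open>J\<close> is the set of times at which jumps are allowed, finitely many per period.  Between
  consecutive jump times \<open>H\<close> is jointly smooth and extends smoothly to the closed time interval,
  so that all one-sided limits in \<open>t\<close> exist; the value of \<open>H\<close> at a jump time itself need
  not be one of the two one-sided limits.
\<close>

definition is_hamiltonian ::
  "(real \<times> real) set \<Rightarrow> real set \<Rightarrow> (real \<times> real \<Rightarrow> real \<Rightarrow> real) \<Rightarrow> bool" where
  "is_hamiltonian D J H \<longleftrightarrow>
     (\<forall>z\<in>D. \<forall>t. H z (t + 2 * pi) = H z t) \<and>
     finite (J \<inter> {0..<2 * pi}) \<and> (\<forall>t. t + 2 * pi \<in> J \<longleftrightarrow> t \<in> J) \<and>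
     (\<forall>t. smooth_on D (\<lambda>z. H z t)) \<and>
     (\<forall>a b. a < b \<and> {a<..<b} \<inter> J = {} \<longrightarrow>
        (\<exists>F. smooth_on (D \<times> {a..b}) F \<and> (\<forall>z\<in>D. \<forall>t\<in>{a<..<b}. F (z, t) = H z t)))"

text \<open>The vector field \<open>(- f\<^sub>q, f\<^sub>p)\<close>.\<close>

definition ham_field ::
  "(real \<times> real) set \<Rightarrow> (real \<times> real \<Rightarrow> real) \<Rightarrow> real \<times> real \<Rightarrow> real \<times> real" where
  "ham_field D f z =
     (- frechet_derivative f (at z within D) (0, 1), frechet_derivative f (at z within D) (1, 0))"

text \<open>
  A solution is a continuous curve in \<open>D\<close> that satisfies the equations off the jump times.
  The values of \<open>g t\<close> outside \<open>D\<close> are irrelevant.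
\<close>

definition is_ham_flow ::
  "(real \<times> real) set \<Rightarrow> real set \<Rightarrow> (real \<times> real \<Rightarrow> real \<Rightarrow> real) \<Rightarrow>
   (real \<Rightarrow> real \<times> real \<Rightarrow> real \<times> real) \<Rightarrow> bool" where
  "is_ham_flow D J H g \<longleftrightarrow>
     (\<forall>z\<in>D. g 0 z = z \<and>
        (\<forall>t. g t z \<in> D) \<and>
        continuous_on UNIV (\<lambda>t. g t z) \<and>
        (\<forall>t. t \<notin> J \<longrightarrow>
           ((\<lambda>s. g s z) has_vector_derivative ham_field D (\<lambda>w. H w t) (g t z)) (at t)))"

text \<open>
  If the flow leaves \<open>D\<close> invariant then \<open>H\<close> is constant on the boundary for every \<open>t \<notin> J\<close>, so
  the description below is unspecified at most at the finitely many jump times per period,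
  which do not contribute to the helicity.
\<close>

definition boundary_value ::
  "(real \<times> real) set \<Rightarrow> (real \<times> real \<Rightarrow> real \<Rightarrow> real) \<Rightarrow> real \<Rightarrow> real" where
  "boundary_value D H t = (THE c. \<forall>z\<in>frontier D. H z t = c)"

definition helicity :: "(real \<times> real) set \<Rightarrow> (real \<times> real \<Rightarrow> real \<Rightarrow> real) \<Rightarrow> real" where
  "helicity D H = integral {0..2 * pi} (\<lambda>t. integral D (\<lambda>z. H z t - boundary_value D H t))"

end

theory Submission
  imports Defs
begin

text \<open>
  Put \<open>\<omega> = dp \<and> dq\<close> and \<open>\<lambda> = (p dq - q dp) / 2\<close>, and let
  \<open>A\<^sub>i(z)\<close> be the integral of \<open>\<lambda> - (H\<^sub>i - c\<^sub>i) dt\<close> along the orbit of \<open>z\<close> over one period.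
  Comparing the orbits of two nearby points gives \<open>dA\<^sub>i = h\<^sup>*\<lambda> - \<lambda>\<close> in the integrated form
  \<open>A\<^sub>i(w) - A\<^sub>i(z) = (endpoint terms depending on h only) + O(|w - z|\<^sup>2)\<close>, which needs no
  derivative of the flow; hence \<open>A\<^sub>1 - A\<^sub>2\<close> is a constant \<open>c\<close> on the connected set \<open>D\<close>.
  The flow preserves area and \<open>\<integral>\<^sub>D \<lambda>(X) \<omega> = - \<integral>\<^sub>D (H - c) \<omega>\<close>, so the integral of \<open>A\<^sub>i\<close>
  over \<open>D\<close> is minus twice the helicity and \<open>c S(D) = - 2 (\<H>(H\<^sub>1) - \<H>(H\<^sub>2))\<close>.
  On the boundary \<open>A\<^sub>i\<close> is the integral of \<open>\<lambda>\<close> along a curve in \<open>\<partial>D\<close>; the curves for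
  \<open>i = 1, 2\<close> have the same endpoints, so \<open>c\<close> is an integer multiple of
  \<open>\<integral>\<^bsub>\<partial>D\<^esub> \<lambda> = \<plusminus> S(D)\<close>.
\<close>

section \<open>Smooth maps on compact sets\<close>

text \<open>The flows are given only as families of solution curves: nothing is assumed about their
  dependence on the starting point, the field may jump in time, and estimates must hold up to the
  boundary. So derivatives in \<open>z\<close> are replaced by finite differences. The symmetric
  choice of \<open>\<lambda>\<close> makes this work: \<open>dp_dq z w / 2\<close> is
  \<open>\<lambda>\<close> at \<open>z\<close> applied to \<open>w - z\<close>, and by Hamilton's
  equations its derivative along two orbits matches the difference of the two action integrands up
  to second order. Area preservation is treated likewise: the change of \<open>dp_dq\<close> of two
  orbit differences is of third order, which already forces the flow to be differentiable with
  determinant one in the interior. The same choice makes \<open>\<lambda>(X)\<close> half the radial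
  derivative of the Hamiltonian, hence the factor two between the action integral and the helicity,
  and the \<open>1 / 2\<close> in the step \<open>S(D)\<^sup>2 / 2\<close>. One factor
  \<open>S(D)\<close> comes from integrating the constant over the disk, the other from the boundary
  period.\<close>

abbreviation fd :: "('a::real_normed_vector \<Rightarrow> 'b::real_normed_vector) \<Rightarrow> 'a \<Rightarrow> 'a \<Rightarrow> 'b" where
  "fd f x \<equiv> frechet_derivative f (at x)"

definition smooth_open :: "'a::euclidean_space set \<Rightarrow> ('a \<Rightarrow> 'b::euclidean_space) \<Rightarrow> bool" where
  "smooth_open U f \<longleftrightarrow> open U \<and> (\<forall>k. Ck_on k U f)"

lemma smooth_open_fd:
  assumes "smooth_open U f"
  shows "smooth_open U (\<lambda>x. fd f x v)"
  using assms unfolding smooth_open_def by (metis Ck_on.simps(2))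

lemma smooth_open_derivative:
  assumes "smooth_open U f" "x \<in> U"
  shows "(f has_derivative fd f x) (at x)"
  using assms unfolding smooth_open_def by (metis Ck_on.simps(2) frechet_derivative_works)

lemma smooth_open_continuous:
  assumes "smooth_open U f"
  shows "continuous_on U f"
  using assms unfolding smooth_open_def by (metis Ck_on.simps(1))

lemma smooth_open_linear:
  assumes "smooth_open U f" "x \<in> U"
  shows "bounded_linear (fd f x)"
  using smooth_open_derivative[OF assms] by (rule has_derivative_bounded_linear)

lemma Ck_on_cong:
  assumes "open U" "\<And>x. x \<in> U \<Longrightarrow> f x = g x" "Ck_on k U f"
  shows "Ck_on k U g"
  using assms
proof (induction k arbitrary: f g)
  case 0
  then show ?case by (simp cong: continuous_on_cong)
next
  case (Suc k)
  have der: "(g has_derivative fd f x) (at x)" if "x \<in> U" for x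
  proof -
    have "(f has_derivative fd f x) (at x)"
      using Suc.prems that frechet_derivative_works by auto
    then show ?thesis
      by (rule has_derivative_transform_within_open[OF _ \<open>open U\<close> that]) (use Suc.prems in auto)
  qed
  then have eq: "fd f x = fd g x" if "x \<in> U" for x
    using frechet_derivative_at that by blast
  have "Ck_on k U (\<lambda>x. fd g x v)" for v
    by (rule Suc.IH[of "\<lambda>x. fd f x v"]) (use Suc.prems eq in auto)
  then show ?case
    using der by (auto simp: differentiable_def)
qed

lemma Ck_on_inner:
  assumes "open U" "Ck_on k U f"
  shows "Ck_on k U (\<lambda>x. f x \<bullet> b)"
  using assms(2)
proof (induction k arbitrary: f)
  case 0
  then show ?case by (auto intro: continuous_intros)
next
  case (Suc k)
  have der: "((\<lambda>x. f x \<bullet> b) has_derivative (\<lambda>v. fd f x v \<bullet> b)) (at x)" if "x \<in> U" for x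
    using Suc.prems that frechet_derivative_works
    by (auto intro!: derivative_intros)
  then have eq: "fd (\<lambda>x. f x \<bullet> b) x = (\<lambda>v. fd f x v \<bullet> b)" if "x \<in> U" for x
    using frechet_derivative_at that by fastforce
  have "Ck_on k U (\<lambda>x. fd (\<lambda>x. f x \<bullet> b) x v)" for v
    by (rule Ck_on_cong[OF assms(1), of "\<lambda>x. fd f x v \<bullet> b"])
       (use Suc eq in auto)
  then show ?case
    using der by (auto simp: differentiable_def)
qed

lemma smooth_open_inner: "smooth_open U f \<Longrightarrow> smooth_open U (\<lambda>x. f x \<bullet> b)"
  unfolding smooth_open_def using Ck_on_inner by blast

lemma fd_inner:
  assumes "smooth_open U f" "x \<in> U"
  shows "fd (\<lambda>x. f x \<bullet> b) x v = fd f x v \<bullet> b"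
proof -
  have "((\<lambda>x. f x \<bullet> b) has_derivative (\<lambda>v. fd f x v \<bullet> b)) (at x)"
    using smooth_open_derivative[OF assms] by (auto intro!: derivative_intros)
  from frechet_derivative_at[OF this] show ?thesis by metis
qed

section \<open>Uniform estimates on compact sets\<close>

lemma compact_norm_bound:
  fixes f :: "'a::metric_space \<Rightarrow> 'b::real_normed_vector"
  assumes "compact K" "continuous_on K f"
  obtains B where "B \<ge> 0" "\<And>x. x \<in> K \<Longrightarrow> norm (f x) \<le> B"
proof -
  have "bounded (f ` K)"
    using assms compact_continuous_image compact_imp_bounded by blast
  then obtain B where "B > 0" "\<forall>y\<in>f ` K. norm y \<le> B"
    using bounded_pos by blast
  then show ?thesis using that[of B] by force
qed

text \<open>The compact sets in question need not be convex. The thickened set contains a ball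
  around each point, on which mean value inequalities apply, and is still compact, so derivatives
  stay bounded on it.\<close>

lemma compact_thicken:
  fixes K :: "'a::euclidean_space set"
  assumes "compact K" "open U" "K \<subseteq> U"
  obtains r where "r > 0" "compact (\<Union>x\<in>K. cball x r)" "(\<Union>x\<in>K. cball x r) \<subseteq> U"
proof -
  obtain r where r: "r > 0" "(\<Union>x\<in>K. cball x r) \<subseteq> U"
    using compact_subset_open_imp_cball_epsilon_subset[OF assms] .
  have "y \<in> (\<lambda>v. x + v) ` cball 0 r" if "y \<in> cball x r" for x y :: 'a
    using that by (auto simp: dist_norm norm_minus_commute intro!: image_eqI[of _ _ "y - x"])
  then have "(\<Union>x\<in>K. cball x r) = {x + y |x y. x \<in> K \<and> y \<in> cball 0 r}"
    by (fastforce simp: dist_norm)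
  then have "compact (\<Union>x\<in>K. cball x r)"
    using compact_sums[OF assms(1), of "cball 0 r"] by simp
  with r show ?thesis using that by blast
qed

lemma smooth_open_onorm_bound:
  fixes f :: "'a::euclidean_space \<Rightarrow> 'b::euclidean_space"
  assumes f: "smooth_open U f" and K: "compact K" "K \<subseteq> U"
  obtains B where "B \<ge> 0" "\<And>x. x \<in> K \<Longrightarrow> onorm (fd f x) \<le> B"
    "\<And>x v. x \<in> K \<Longrightarrow> norm (fd f x v) \<le> B * norm v"
proof -
  \<comment> \<open>The operator norm is dominated by this sum over the basis, whose continuity is
    immediate.\<close>
  have cont: "continuous_on K (\<lambda>x. \<Sum>i\<in>Basis. norm (fd f x i))"
    by (intro continuous_intros continuous_on_subset[OF smooth_open_continuous K(2)]
        smooth_open_fd f)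
  obtain B where B: "B \<ge> 0" "\<And>x. x \<in> K \<Longrightarrow> norm (\<Sum>i\<in>Basis. norm (fd f x i)) \<le> B"
    using compact_norm_bound[OF K(1) cont] by blast
  have lin: "bounded_linear (fd f x)" if "x \<in> K" for x
    using smooth_open_linear f K that by blast
  have 1: "onorm (fd f x) \<le> B" if "x \<in> K" for x
    using onorm_componentwise[OF lin[OF that]] B(2)[OF that] by auto
  have "norm (fd f x v) \<le> B * norm v" if "x \<in> K" for x v
    using onorm[OF lin[OF that], of v] 1[OF that] mult_right_mono[OF 1[OF that], of "norm v"]
    by simp
  with 1 B(1) show ?thesis using that by blast
qed

text \<open>Without convexity two cases are needed: close points lie in a ball inside the thickened
  set, where the mean value inequality applies; for distant points the bound on \<open>f\<close>
  suffices, since \<open>norm (y - x)\<close> exceeds \<open>r\<close>.\<close>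

lemma smooth_open_lipschitz_compact:
  fixes f :: "'a::euclidean_space \<Rightarrow> 'b::euclidean_space"
  assumes f: "smooth_open U f" and K: "compact K" "K \<subseteq> U"
  obtains C where "C \<ge> 0" "\<And>x y. x \<in> K \<Longrightarrow> y \<in> K \<Longrightarrow> norm (f y - f x) \<le> C * norm (y - x)"
proof -
  have U: "open U" using f by (simp add: smooth_open_def)
  obtain r where r: "r > 0" "compact (\<Union>x\<in>K. cball x r)" "(\<Union>x\<in>K. cball x r) \<subseteq> U"
    using compact_thicken[OF K(1) U K(2)] .
  obtain M where M: "M \<ge> 0" "\<And>x. x \<in> (\<Union>x\<in>K. cball x r) \<Longrightarrow> onorm (fd f x) \<le> M"
    using smooth_open_onorm_bound[OF f r(2,3)] by metis
  obtain B where B: "B \<ge> 0" "\<And>x. x \<in> K \<Longrightarrow> norm (f x) \<le> B"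
    using compact_norm_bound[OF K(1) continuous_on_subset[OF smooth_open_continuous[OF f] K(2)]] by blast
  define C where "C = max M (2 * B / r)"
  have "norm (f y - f x) \<le> C * norm (y - x)" if xy: "x \<in> K" "y \<in> K" for x y
  proof (cases "norm (y - x) \<le> r")
    case True
    have "norm (f y - f x) \<le> M * norm (y - x)"
    proof (rule differentiable_bound[where S = "cball x r" and f' = "fd f"])
      fix z assume z: "z \<in> cball x r"
      then show "(f has_derivative fd f z) (at z within cball x r)"
        using smooth_open_derivative[OF f, of z] xy r(3) has_derivative_at_withinI by blast
      show "onorm (fd f z) \<le> M" using M(2) z xy by blast
    qed (use True r in \<open>auto simp: dist_norm norm_minus_commute\<close>)
    also have "\<dots> \<le> C * norm (y - x)"
      by (intro mult_right_mono) (auto simp: C_def)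
    finally show ?thesis .
  next
    case False
    have "norm (f y - f x) \<le> 2 * B"
      using B(2)[OF xy(1)] B(2)[OF xy(2)] norm_triangle_ineq4[of "f y" "f x"] by linarith
    also have "\<dots> = 2 * B / r * r" using r by simp
    also have "\<dots> \<le> 2 * B / r * norm (y - x)"
      using False r B by (intro mult_left_mono) auto
    also have "\<dots> \<le> C * norm (y - x)"
      by (intro mult_right_mono) (auto simp: C_def)
    finally show ?thesis .
  qed
  moreover have "C \<ge> 0" using M by (simp add: C_def)
  ultimately show ?thesis using that by blast
qed

text \<open>Again \<open>r\<close> separates two cases: for close points the derivative is Lipschitz
  on the thickened set; for distant ones the linear bounds with \<open>B\<close> and
  \<open>M\<close> become quadratic because \<open>norm (y - x)\<close> exceeds
  \<open>r\<close>.\<close>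

lemma smooth_open_taylor_compact:
  fixes f :: "'a::euclidean_space \<Rightarrow> 'b::euclidean_space"
  assumes f: "smooth_open U f" and K: "compact K" "K \<subseteq> U"
  obtains C where "C \<ge> 0"
    "\<And>x y. x \<in> K \<Longrightarrow> y \<in> K \<Longrightarrow> norm (f y - f x - fd f x (y - x)) \<le> C * (norm (y - x))\<^sup>2"
proof -
  have "open U" using f by (simp add: smooth_open_def)
  from compact_thicken[OF K(1) this K(2)]
  obtain r where r: "r > 0" "compact (\<Union>x\<in>K. cball x r)" "(\<Union>x\<in>K. cball x r) \<subseteq> U" .
  define L where "L = (\<Union>x\<in>K. cball x r)"
  obtain M where M: "M \<ge> 0" "\<And>x v. x \<in> K \<Longrightarrow> norm (fd f x v) \<le> M * norm v"
    using smooth_open_onorm_bound[OF f K] by metis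
  obtain B where B: "B \<ge> 0" "\<And>x y. x \<in> K \<Longrightarrow> y \<in> K \<Longrightarrow> norm (f y - f x) \<le> B * norm (y - x)"
    using smooth_open_lipschitz_compact[OF f K] by blast
  have "\<exists>C. \<forall>b\<in>Basis. C b \<ge> 0 \<and>
      (\<forall>x\<in>L. \<forall>y\<in>L. norm (fd f y b - fd f x b) \<le> C b * norm (y - x))"
  proof (rule bchoice, rule ballI)
    fix b :: 'a
    show "\<exists>C. 0 \<le> C \<and> (\<forall>x\<in>L. \<forall>y\<in>L. norm (fd f y b - fd f x b) \<le> C * norm (y - x))"
      using smooth_open_lipschitz_compact[OF smooth_open_fd[OF f] r(2,3), of b]
      unfolding L_def by metis
  qed
  then obtain Cb where Cb: "\<And>b. b \<in> Basis \<Longrightarrow> Cb b \<ge> 0"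
    "\<And>b x y. b \<in> Basis \<Longrightarrow> x \<in> L \<Longrightarrow> y \<in> L \<Longrightarrow> norm (fd f y b - fd f x b) \<le> Cb b * norm (y - x)"
    by blast
  define Q where "Q = (\<Sum>b\<in>Basis. Cb b)"
  have Q: "Q \<ge> 0" unfolding Q_def using Cb(1) by (intro sum_nonneg) auto
  define C where "C = max Q ((B + M) / r)"
  have "norm (f y - f x - fd f x (y - x)) \<le> C * (norm (y - x))\<^sup>2" if xy: "x \<in> K" "y \<in> K" for x y
  proof (cases "norm (y - x) \<le> r")
    case True
    let ?S = "cball x (norm (y - x))"
    have SL: "?S \<subseteq> L" using True xy(1) unfolding L_def by force
    have xL: "x \<in> L" using SL by auto
    have lin: "bounded_linear (fd f z)" if "z \<in> L" for z
      using smooth_open_linear[OF f] r(3) that unfolding L_def by blast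
    \<comment> \<open>Mean value inequality for \<open>f\<close> minus its linear part at
      \<open>x\<close>: on the ball of radius \<open>norm (y - x)\<close> the derivative of this
      difference is at most \<open>Q * norm (y - x)\<close>.\<close>
    have "norm ((f y - fd f x y) - (f x - fd f x x)) \<le> (Q * norm (y - x)) * norm (y - x)"
    proof (rule differentiable_bound[where S = ?S and f' = "\<lambda>z v. fd f z v - fd f x v"])
      fix z assume z: "z \<in> ?S"
      have zL: "z \<in> L" using z SL by blast
      have "(f has_derivative fd f z) (at z within ?S)"
        using smooth_open_derivative[OF f, of z] zL r(3) has_derivative_at_withinI
        unfolding L_def by blast
      then show "((\<lambda>y. f y - fd f x y) has_derivative (\<lambda>v. fd f z v - fd f x v)) (at z within ?S)"
        using bounded_linear_imp_has_derivative[OF lin[OF xL]] by (intro has_derivative_diff) auto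
      have "onorm (\<lambda>v. fd f z v - fd f x v) \<le> (\<Sum>b\<in>Basis. norm (fd f z b - fd f x b))"
        by (rule onorm_componentwise) (intro bounded_linear_sub lin zL xL)
      also have "\<dots> \<le> (\<Sum>b\<in>Basis. Cb b * norm (z - x))"
        using Cb(2) zL xL by (intro sum_mono) auto
      also have "\<dots> = Q * norm (z - x)" by (simp add: Q_def sum_distrib_right)
      also have "\<dots> \<le> Q * norm (y - x)"
        using z Q by (intro mult_left_mono) (auto simp: dist_norm norm_minus_commute)
      finally show "onorm (\<lambda>v. fd f z v - fd f x v) \<le> Q * norm (y - x)" .
    qed (auto simp: dist_norm norm_minus_commute)
    also have "\<dots> \<le> C * (norm (y - x))\<^sup>2"
      unfolding power2_eq_square mult.assoc by (intro mult_right_mono) (auto simp: C_def)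
    finally show ?thesis
      by (simp add: linear_diff[OF bounded_linear.linear[OF lin[OF xL]]] algebra_simps)
  next
    case False
    have "norm (f y - f x - fd f x (y - x)) \<le> B * norm (y - x) + M * norm (y - x)"
      using B(2)[OF xy] M(2)[OF xy(1), of "y - x"]
        norm_triangle_ineq4[of "f y - f x" "fd f x (y - x)"] by linarith
    also have "\<dots> = ((B + M) / r) * (r * norm (y - x))"
      using r by (simp add: field_simps)
    also have "\<dots> \<le> ((B + M) / r) * (norm (y - x) * norm (y - x))"
      using False r B M by (intro mult_left_mono mult_right_mono) auto
    also have "\<dots> \<le> C * (norm (y - x))\<^sup>2"
      unfolding power2_eq_square by (intro mult_right_mono) (auto simp: C_def)
    finally show ?thesis .
  qed
  moreover have "C \<ge> 0" using Q by (simp add: C_def)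
  ultimately show ?thesis using that by blast
qed

section \<open>Symmetry of second derivatives\<close>

lemma second_difference_mvt:
  fixes f :: "'a::euclidean_space \<Rightarrow> real"
  assumes f: "smooth_open U f" and S: "convex S" "S \<subseteq> U" and h: "h > 0"
    and x: "x \<in> S" "x + h *\<^sub>R v \<in> S" "x + h *\<^sub>R w \<in> S" "x + h *\<^sub>R v + h *\<^sub>R w \<in> S"
  obtains z where "z \<in> S"
    "f (x + h *\<^sub>R v + h *\<^sub>R w) - f (x + h *\<^sub>R v) - f (x + h *\<^sub>R w) + f x = h\<^sup>2 * fd (\<lambda>y. fd f y v) z w"
proof -
  have seg: "p + s *\<^sub>R q \<in> S" if "p \<in> S" "p + h *\<^sub>R q \<in> S" "0 \<le> s" "s \<le> h" for p q s
  proof -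
    have "(1 - s / h) *\<^sub>R p + (s / h) *\<^sub>R (p + h *\<^sub>R q) \<in> S"
      using that h S(1) by (intro convexD) auto
    moreover have "(1 - s / h) *\<^sub>R p + (s / h) *\<^sub>R (p + h *\<^sub>R q) = p + s *\<^sub>R q"
      using h by (simp add: algebra_simps)
    ultimately show ?thesis by simp
  qed
  have der: "((\<lambda>s. g (p + s *\<^sub>R q)) has_real_derivative fd g (p + s *\<^sub>R q) q) (at s)"
    if "smooth_open U g" "p + s *\<^sub>R q \<in> S" for g :: "'a \<Rightarrow> real" and p q s
  proof -
    have line: "((\<lambda>s. p + s *\<^sub>R q) has_derivative (\<lambda>ds. ds *\<^sub>R q)) (at s)"
      by (auto intro!: derivative_eq_intros)
    have "((\<lambda>s. g (p + s *\<^sub>R q)) has_derivative (\<lambda>ds. fd g (p + s *\<^sub>R q) (ds *\<^sub>R q))) (at s)"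
      using has_derivative_compose[OF line smooth_open_derivative[OF that(1)]] that(2) S(2)
      by blast
    moreover have "fd g (p + s *\<^sub>R q) (ds *\<^sub>R q) = fd g (p + s *\<^sub>R q) q * ds" for ds
      using smooth_open_linear[OF that(1)] that(2) S(2)
      by (metis bounded_linear.linear linear_scale mult.commute real_scaleR_def subsetD)
    ultimately show ?thesis by (simp add: has_field_derivative_def)
  qed
  \<comment> \<open>One mean value theorem in direction \<open>v\<close> for the increment along
    \<open>w\<close>, then one in direction \<open>w\<close> for the derivative along
    \<open>v\<close>.\<close>
  let ?d = "\<lambda>s. f (x + h *\<^sub>R w + s *\<^sub>R v) - f (x + s *\<^sub>R v)"
  have s1: "x + s *\<^sub>R v \<in> S" "x + h *\<^sub>R w + s *\<^sub>R v \<in> S" if "0 \<le> s" "s \<le> h" for s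
    using seg[of x v s] seg[of "x + h *\<^sub>R w" v s] that x by (auto simp: algebra_simps)
  have "\<exists>s>0. s < h \<and> ?d h - ?d 0 = (h - 0) * (fd f (x + h *\<^sub>R w + s *\<^sub>R v) v - fd f (x + s *\<^sub>R v) v)"
    by (rule MVT2[OF h]) (intro DERIV_diff der f s1)
  then obtain s where s: "0 < s" "s < h"
    "?d h - ?d 0 = h * (fd f (x + h *\<^sub>R w + s *\<^sub>R v) v - fd f (x + s *\<^sub>R v) v)" by auto
  let ?e = "\<lambda>r. fd f (x + s *\<^sub>R v + r *\<^sub>R w) v"
  have s2: "x + s *\<^sub>R v + r *\<^sub>R w \<in> S" if "0 \<le> r" "r \<le> h" for r
    using seg[of "x + s *\<^sub>R v" w r] s1[of s] s that by (auto simp: algebra_simps)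
  have "\<exists>r>0. r < h \<and> ?e h - ?e 0 = (h - 0) * fd (\<lambda>y. fd f y v) (x + s *\<^sub>R v + r *\<^sub>R w) w"
    by (rule MVT2[OF h]) (intro der smooth_open_fd f s2)
  then obtain r where r: "0 < r" "r < h"
    "?e h - ?e 0 = h * fd (\<lambda>y. fd f y v) (x + s *\<^sub>R v + r *\<^sub>R w) w" by auto
  show ?thesis
  proof (rule that[OF s2[of r]])
    show "f (x + h *\<^sub>R v + h *\<^sub>R w) - f (x + h *\<^sub>R v) - f (x + h *\<^sub>R w) + f x =
      h\<^sup>2 * fd (\<lambda>y. fd f y v) (x + s *\<^sub>R v + r *\<^sub>R w) w"
      using s(3) r(3) by (simp add: algebra_simps power2_eq_square)
  qed (use r in auto)
qed

text \<open>The second difference over a parallelogram does not change when \<open>v\<close> and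
  \<open>w\<close> are swapped, so the two iterated derivatives take equal values at points
  arbitrarily close to \<open>x\<close>; continuity finishes.\<close>

lemma fd_symmetric_real:
  fixes f :: "'a::euclidean_space \<Rightarrow> real"
  assumes f: "smooth_open U f" and x: "x \<in> U"
  shows "fd (\<lambda>y. fd f y v) x w = fd (\<lambda>y. fd f y w) x v"
proof (rule ccontr)
  let ?A = "\<lambda>x. fd (\<lambda>y. fd f y v) x w" and ?B = "\<lambda>x. fd (\<lambda>y. fd f y w) x v"
  assume ne: "?A x \<noteq> ?B x"
  define e where "e = \<bar>?A x - ?B x\<bar> / 2"
  have e: "e > 0" using ne by (simp add: e_def)
  have U: "open U" using f by (simp add: smooth_open_def)
  have "continuous_on U ?A" "continuous_on U ?B"
    by (intro smooth_open_continuous smooth_open_fd f)+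
  then have "isCont ?A x" "isCont ?B x" using U x continuous_on_eq_continuous_at by blast+
  then obtain d1 d2 where d: "d1 > 0" "d2 > 0"
    "\<And>y. dist y x < d1 \<Longrightarrow> dist (?A y) (?A x) < e" "\<And>y. dist y x < d2 \<Longrightarrow> dist (?B y) (?B x) < e"
    using e unfolding continuous_at_eps_delta by metis
  obtain d3 where d3: "d3 > 0" "ball x d3 \<subseteq> U" using U x open_contains_ball by blast
  define d where "d = min d3 (min d1 d2)"
  have dpos: "d > 0" using d d3 by (simp add: d_def)
  \<comment> \<open>Small enough to keep the whole parallelogram inside the ball; the
    \<open>+ 1\<close> covers the case that \<open>v\<close> and \<open>w\<close> vanish.\<close>
  define h where "h = d / (2 * (norm v + norm w + 1))"
  have n: "norm v + norm w + 1 > 0" by (intro add_nonneg_pos) auto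
  have h: "h > 0" using dpos n by (simp add: h_def)
  have hd: "h * (norm v + norm w) < d"
  proof -
    have "norm v + norm w < 2 * (norm v + norm w + 1)"
      using norm_ge_zero[of v] norm_ge_zero[of w] by argo
    then have "h * (norm v + norm w) < h * (2 * (norm v + norm w + 1))"
      using h by (rule mult_strict_left_mono)
    also have "\<dots> = d" using n by (simp add: h_def)
    finally show ?thesis .
  qed
  have hv: "norm (h *\<^sub>R v) < d" "norm (h *\<^sub>R w) < d" "norm (h *\<^sub>R v + h *\<^sub>R w) < d"
  proof -
    have "norm (h *\<^sub>R v + h *\<^sub>R w) \<le> norm (h *\<^sub>R v) + norm (h *\<^sub>R w)"
      by (rule norm_triangle_ineq)
    moreover have "norm (h *\<^sub>R v) + norm (h *\<^sub>R w) = h * (norm v + norm w)"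
      using h by (simp add: algebra_simps)
    ultimately show "norm (h *\<^sub>R v) < d" "norm (h *\<^sub>R w) < d" "norm (h *\<^sub>R v + h *\<^sub>R w) < d"
      using hd norm_ge_zero[of "h *\<^sub>R v"] norm_ge_zero[of "h *\<^sub>R w"] by linarith+
  qed
  have in_ball: "x \<in> ball x d" "x + h *\<^sub>R v \<in> ball x d" "x + h *\<^sub>R w \<in> ball x d"
    "x + h *\<^sub>R v + h *\<^sub>R w \<in> ball x d" "x + h *\<^sub>R w + h *\<^sub>R v \<in> ball x d"
    using hv dpos by (simp_all add: dist_norm norm_minus_commute add.assoc add.commute)
  have sub: "ball x d \<subseteq> U" using d3 by (auto simp: d_def)
  obtain z1 where z1: "z1 \<in> ball x d"
    "f (x + h *\<^sub>R v + h *\<^sub>R w) - f (x + h *\<^sub>R v) - f (x + h *\<^sub>R w) + f x = h\<^sup>2 * ?A z1"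
    using second_difference_mvt[OF f convex_ball sub h in_ball(1,2,3,4)] .
  obtain z2 where z2: "z2 \<in> ball x d"
    "f (x + h *\<^sub>R w + h *\<^sub>R v) - f (x + h *\<^sub>R w) - f (x + h *\<^sub>R v) + f x = h\<^sup>2 * ?B z2"
    using second_difference_mvt[OF f convex_ball sub h in_ball(1,3,2,5)] .
  have "h\<^sup>2 * ?A z1 = h\<^sup>2 * ?B z2"
    using z1(2) z2(2) by (simp add: algebra_simps)
  then have "?A z1 = ?B z2" using h by simp
  moreover have "dist (?A z1) (?A x) < e" "dist (?B z2) (?B x) < e"
    using d(3)[of z1] d(4)[of z2] z1(1) z2(1) by (auto simp: d_def dist_commute)
  ultimately show False
    using abs_triangle_ineq4[of "?A z1 - ?B x" "?A z1 - ?A x"] unfolding e_def dist_real_def by simp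
qed

lemma fd_symmetric:
  fixes f :: "'a::euclidean_space \<Rightarrow> 'b::euclidean_space"
  assumes f: "smooth_open U f" and x: "x \<in> U"
  shows "fd (\<lambda>y. fd f y v) x w = fd (\<lambda>y. fd f y w) x v"
proof (rule euclidean_eqI)
  fix b :: 'b assume "b \<in> Basis"
  have U: "open U" using f by (simp add: smooth_open_def)
  have *: "fd (\<lambda>y. fd f y v) x w \<bullet> b = fd (\<lambda>y. fd (\<lambda>y. f y \<bullet> b) y v) x w" for v w
  proof -
    have "((\<lambda>y. fd f y v \<bullet> b) has_derivative (\<lambda>w. fd (\<lambda>y. fd f y v) x w \<bullet> b)) (at x)"
      using smooth_open_derivative[OF smooth_open_fd[OF f] x] by (auto intro!: derivative_intros)
    then have "((\<lambda>y. fd (\<lambda>y. f y \<bullet> b) y v) has_derivative (\<lambda>w. fd (\<lambda>y. fd f y v) x w \<bullet> b)) (at x)"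
      by (rule has_derivative_transform_within_open[OF _ U x]) (simp add: fd_inner[OF f])
    from frechet_derivative_at[OF this] show ?thesis by metis
  qed
  show "fd (\<lambda>y. fd f y v) x w \<bullet> b = fd (\<lambda>y. fd f y w) x v \<bullet> b"
    unfolding * by (rule fd_symmetric_real[OF smooth_open_inner[OF f] x])
qed

section \<open>Integration in the plane\<close>

type_synonym plane = "real \<times> real"

text \<open>The derivative is replaced by \<open>0\<close> at the exceptional points, where
  \<open>f'\<close> is arbitrary; pointwise bounds then hold on the whole interval.\<close>

lemma FTC_off_finite:
  fixes f :: "real \<Rightarrow> 'a::euclidean_space"
  assumes S: "finite S" and ab: "a \<le> b"
    and der: "\<And>x. x \<in> {a<..<b} - S \<Longrightarrow> (f has_vector_derivative f' x) (at x)"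
    and cont: "continuous_on {a..b} f"
  shows "((\<lambda>x. if x \<in> S \<union> {a, b} then 0 else f' x) has_integral (f b - f a)) {a..b}"
proof (rule has_integral_spike_finite)
  show "(f' has_integral (f b - f a)) {a..b}"
    by (rule fundamental_theorem_of_calculus_interior_strong[OF S ab der cont])
  show "finite (S \<union> {a, b})" using S by simp
qed auto

lemma FTC_bound_off_finite:
  fixes f :: "real \<Rightarrow> 'a::euclidean_space"
  assumes S: "finite S" and ab: "a \<le> b" and B: "0 \<le> B"
    and der: "\<And>x. x \<in> {a<..<b} - S \<Longrightarrow> (f has_vector_derivative f' x) (at x)"
    and cont: "continuous_on {a..b} f"
    and bound: "\<And>x. x \<in> {a<..<b} - S \<Longrightarrow> norm (f' x) \<le> B"
  shows "norm (f b - f a) \<le> B * (b - a)"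
proof -
  have "norm (f b - f a) \<le> B * measure lborel {a..b}"
    by (rule has_integral_bound_real[OF B, of "{}", OF _ FTC_off_finite[OF S ab der cont]])
       (use bound ab B in auto)
  then show ?thesis using ab by simp
qed

lemma nonincreasing_off_finite:
  fixes f :: "real \<Rightarrow> real"
  assumes S: "finite S" and ab: "a \<le> b"
    and der: "\<And>x. x \<in> {a<..<b} - S \<Longrightarrow> (f has_real_derivative f' x) (at x)"
    and cont: "continuous_on {a..b} f"
    and nonpos: "\<And>x. x \<in> {a<..<b} - S \<Longrightarrow> f' x \<le> 0"
  shows "f b \<le> f a"
proof -
  have "f b - f a \<le> 0"
    by (rule has_integral_le[OF FTC_off_finite[OF S ab _ cont, of f'] has_integral_0])
       (use der nonpos ab in \<open>auto simp: has_real_derivative_iff_has_vector_derivative\<close>)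
  then show ?thesis by simp
qed

text \<open>\<open>exp (- 2 * L * x) * (d x \<bullet> d x)\<close> does not increase and
  \<open>exp (2 * L * x) * (d x \<bullet> d x)\<close> does not decrease. The second half, which
  bounds the start by the end, yields injectivity of the flow.\<close>

lemma gronwall_off_finite:
  fixes d :: "real \<Rightarrow> 'a::euclidean_space"
  assumes S: "finite S" and ab: "a \<le> b"
    and der: "\<And>x. x \<in> {a<..<b} - S \<Longrightarrow> (d has_vector_derivative d' x) (at x)"
    and cont: "continuous_on {a..b} d"
    and bound: "\<And>x. x \<in> {a<..<b} - S \<Longrightarrow> norm (d' x) \<le> L * norm (d x)"
  shows "norm (d b) \<le> exp (L * (b - a)) * norm (d a)"
    and "norm (d a) \<le> exp (L * (b - a)) * norm (d b)"
proof -
  have ip: "\<bar>d x \<bullet> d' x\<bar> \<le> L * (d x \<bullet> d x)" if "x \<in> {a<..<b} - S" for x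
  proof -
    have "\<bar>d x \<bullet> d' x\<bar> \<le> norm (d x) * norm (d' x)" by (rule Cauchy_Schwarz_ineq2)
    also have "\<dots> \<le> norm (d x) * (L * norm (d x))"
      using bound[OF that] by (intro mult_left_mono) auto
    finally show ?thesis by (simp add: dot_square_norm power2_eq_square mult_ac)
  qed
  have dd: "((\<lambda>x. d x \<bullet> d x) has_real_derivative 2 * (d x \<bullet> d' x)) (at x)" if "x \<in> {a<..<b} - S" for x
  proof -
    have "((\<lambda>x. d x \<bullet> d x) has_vector_derivative d x \<bullet> d' x + d' x \<bullet> d x) (at x)"
      by (rule bounded_bilinear.has_vector_derivative[OF bounded_bilinear_inner]) (use der that in auto)
    then show ?thesis
      by (simp add: has_real_derivative_iff_has_vector_derivative inner_commute)
  qed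
  \<comment> \<open>The monotone quantities contain the squared norm; the doubled exponent
    disappears with the square root.\<close>
  have sq: "norm u \<le> exp (L * (b - a)) * norm v"
    if "u \<bullet> u \<le> exp (2 * L * (b - a)) * (v \<bullet> v)" for u v :: 'a
  proof -
    have "(norm u)\<^sup>2 \<le> (exp (L * (b - a)) * norm v)\<^sup>2"
      using that by (simp add: dot_square_norm power_mult_distrib mult_ac flip: exp_double)
    then show ?thesis by (rule power2_le_imp_le) auto
  qed
  have D: "((\<lambda>x. exp (k * x) * (d x \<bullet> d x)) has_real_derivative
      exp (k * x) * (2 * (d x \<bullet> d' x) + k * (d x \<bullet> d x))) (at x)" if x: "x \<in> {a<..<b} - S" for k x
    by (auto intro!: derivative_eq_intros dd[OF x] simp: algebra_simps)
  have c: "continuous_on {a..b} (\<lambda>x. exp (k * x) * (d x \<bullet> d x))" for k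
    by (intro continuous_intros cont)
  have "exp (- (2 * L) * b) * (d b \<bullet> d b) \<le> exp (- (2 * L) * a) * (d a \<bullet> d a)"
  proof (rule nonincreasing_off_finite[OF S ab D c])
    fix x assume x: "x \<in> {a<..<b} - S"
    show "exp (- (2 * L) * x) * (2 * (d x \<bullet> d' x) + - (2 * L) * (d x \<bullet> d x)) \<le> 0"
      by (rule mult_nonneg_nonpos) (use ip[OF x] in auto)
  qed
  then have "exp (2 * L * b) * (exp (- (2 * L) * b) * (d b \<bullet> d b)) \<le> exp (2 * L * b) * (exp (- (2 * L) * a) * (d a \<bullet> d a))"
    by (intro mult_left_mono) auto
  then have "d b \<bullet> d b \<le> exp (2 * L * (b - a)) * (d a \<bullet> d a)"
    by (simp add: algebra_simps flip: mult.assoc exp_add)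
  from sq[OF this] show "norm (d b) \<le> exp (L * (b - a)) * norm (d a)" .
  have "- (exp ((2 * L) * b) * (d b \<bullet> d b)) \<le> - (exp ((2 * L) * a) * (d a \<bullet> d a))"
  proof (rule nonincreasing_off_finite[OF S ab DERIV_minus[OF D] continuous_on_minus[OF c]])
    fix x assume x: "x \<in> {a<..<b} - S"
    have "0 \<le> exp ((2 * L) * x) * (2 * (d x \<bullet> d' x) + (2 * L) * (d x \<bullet> d x))"
      by (rule mult_nonneg_nonneg) (use ip[OF x] in auto)
    then show "- (exp ((2 * L) * x) * (2 * (d x \<bullet> d' x) + (2 * L) * (d x \<bullet> d x))) \<le> 0" by simp
  qed
  then have "exp (- (2 * L) * a) * (exp (2 * L * a) * (d a \<bullet> d a)) \<le> exp (- (2 * L) * a) * (exp (2 * L * b) * (d b \<bullet> d b))"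
    by (intro mult_left_mono) auto
  then have "d a \<bullet> d a \<le> exp (2 * L * (b - a)) * (d b \<bullet> d b)"
    by (simp add: algebra_simps flip: mult.assoc exp_add)
  from sq[OF this] show "norm (d a) \<le> exp (L * (b - a)) * norm (d b)" .
qed

section \<open>Integrability of bounded continuous functions\<close>

lemma bounded_continuous_absolutely_integrable:
  fixes f :: "'a::euclidean_space \<Rightarrow> 'b::euclidean_space"
  assumes "S \<in> sets borel" "bounded S" "continuous_on S f" "\<And>x. x \<in> S \<Longrightarrow> norm (f x) \<le> B"
  shows "f absolutely_integrable_on S"
proof (rule measurable_bounded_by_integrable_imp_absolutely_integrable)
  show S: "S \<in> sets lebesgue" using assms(1) by auto
  show "f \<in> borel_measurable (lebesgue_on S)"
    by (rule continuous_imp_measurable_on_sets_lebesgue[OF assms(3) S])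
  have "S \<in> lmeasurable"
    using bounded_set_imp_lmeasurable[OF assms(2)] S by blast
  then show "(\<lambda>x. B) integrable_on S" by (rule integrable_on_const)
qed (use assms in auto)

lemma bounded_continuous_set_integrable:
  fixes f :: "'a::euclidean_space \<Rightarrow> 'b::euclidean_space"
  assumes S: "S \<in> sets borel" and "bounded S" and f: "continuous_on S f"
    and B: "\<And>x. x \<in> S \<Longrightarrow> norm (f x) \<le> B"
  shows "set_integrable lborel S f"
proof -
  have "integrable lborel (\<lambda>x. indicator S x *\<^sub>R (indicator S x *\<^sub>R f x))"
  proof (rule integrableI_bounded_set_indicator[where B = B])
    show "S \<in> sets lborel" using S by simp
    show "(\<lambda>x. indicator S x *\<^sub>R f x) \<in> borel_measurable lborel"
      using borel_measurable_continuous_on_indicator[OF S f] by simp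
    show "emeasure lborel S < \<infinity>" by (rule emeasure_bounded_finite[OF assms(2)])
    show "AE x in lborel. x \<in> S \<longrightarrow> norm (indicator S x *\<^sub>R f x) \<le> B"
      by (rule AE_I2) (simp add: B)
  qed
  moreover have "indicator S x *\<^sub>R (indicator S x *\<^sub>R y) = (indicator S x *\<^sub>R y :: 'b)" for x y
    by (simp add: indicator_def)
  ultimately show ?thesis by (simp only: set_integrable_def)
qed

section \<open>The symplectic form and change of variables in the plane\<close>

lemma abs_dp_dq_le: "\<bar>dp_dq a b\<bar> \<le> norm a * norm b"
proof -
  have "dp_dq a b = a \<bullet> (snd b, - fst b)" by (simp add: dp_dq_def inner_prod_def)
  also have "\<bar>\<dots>\<bar> \<le> norm a * norm (snd b, - fst b)" by (rule Cauchy_Schwarz_ineq2)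
  also have "norm (snd b, - fst b) = norm b"
    by (simp add: norm_prod_def add.commute)
  finally show ?thesis .
qed

lemma bounded_bilinear_dp_dq: "bounded_bilinear dp_dq"
proof
  show "\<exists>K. \<forall>a b. norm (dp_dq a b) \<le> norm a * norm b * K"
    by (rule exI[of _ 1]) (simp add: abs_dp_dq_le)
qed (auto simp: dp_dq_def algebra_simps)

text \<open>The change of variables formula is phrased with the determinant of a matrix on
  \<open>real ^ 2\<close>; this identification carries integrals over pairs to that setting and
  back.\<close>

definition vec_of_pair :: "plane \<Rightarrow> real ^ 2" where
  "vec_of_pair z = vector [fst z, snd z]"

definition pair_of_vec :: "real ^ 2 \<Rightarrow> plane" where
  "pair_of_vec x = (x $ 1, x $ 2)"

lemma pair_of_vec_of_pair [simp]: "pair_of_vec (vec_of_pair z) = z"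
  by (simp add: vec_of_pair_def pair_of_vec_def)

lemma vec_of_pair_of_vec [simp]: "vec_of_pair (pair_of_vec x) = x"
  by (simp add: vec_of_pair_def pair_of_vec_def vec_eq_iff forall_2)

lemma bounded_linear_pair_of_vec: "bounded_linear pair_of_vec"
  unfolding pair_of_vec_def by (intro bounded_linear_Pair bounded_linear_vec_nth)

lemma bounded_linear_vec_of_pair: "bounded_linear vec_of_pair"
  by (rule linear_conv_bounded_linear[THEN iffD1], rule linearI)
     (simp_all add: vec_of_pair_def vec_eq_iff forall_2)

lemma mem_vec_of_pair_image: "x \<in> vec_of_pair ` S \<longleftrightarrow> pair_of_vec x \<in> S"
proof
  assume "pair_of_vec x \<in> S"
  then have "vec_of_pair (pair_of_vec x) \<in> vec_of_pair ` S" by blast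
  then show "x \<in> vec_of_pair ` S" by simp
qed auto

lemma vec_of_pair_cbox: "vec_of_pair ` cbox a b = cbox (vec_of_pair a) (vec_of_pair b)"
proof -
  have "vec_of_pair z \<in> cbox (vec_of_pair a) (vec_of_pair b) \<longleftrightarrow> z \<in> cbox a b" for z
    by (cases a, cases b, cases z) (auto simp: mem_box_cart forall_2 vec_of_pair_def cbox_Pair_eq)
  from this[of "pair_of_vec x" for x] show ?thesis
    by (auto simp only: mem_vec_of_pair_image vec_of_pair_of_vec set_eq_iff)
qed

lemma pair_of_vec_cbox: "pair_of_vec ` cbox a b = cbox (pair_of_vec a) (pair_of_vec b)"
proof -
  have "cbox a b = vec_of_pair ` cbox (pair_of_vec a) (pair_of_vec b)"
    by (simp add: vec_of_pair_cbox)
  then show ?thesis by (simp add: image_image)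
qed

lemma content_vec_of_pair: "measure lborel (vec_of_pair ` cbox a b) = measure lborel (cbox a b)"
proof (cases "cbox a b = {}")
  case False
  obtain a1 a2 b1 b2 where ab: "a = (a1, a2)" "b = (b1, b2)" by fastforce
  have "cbox (vec_of_pair a) (vec_of_pair b) \<noteq> {}" using False vec_of_pair_cbox[of a b] by auto
  moreover have "a1 \<le> b1" "a2 \<le> b2" using False by (auto simp: ab cbox_Pair_eq)
  ultimately show ?thesis
    unfolding vec_of_pair_cbox
    by (simp add: content_cbox_cart ab content_Pair UNIV_2 vec_of_pair_def)
qed auto

lemma content_pair_of_vec: "measure lborel (pair_of_vec ` cbox a b) = measure lborel (cbox a b)"
  using content_vec_of_pair[of "pair_of_vec a" "pair_of_vec b"]
  by (simp add: pair_of_vec_cbox vec_of_pair_cbox)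

lemma has_integral_vec_of_pair_iff:
  fixes f :: "plane \<Rightarrow> 'a::euclidean_space"
  assumes "bounded S"
  shows "((\<lambda>x. f (pair_of_vec x)) has_integral i) (vec_of_pair ` S) \<longleftrightarrow> (f has_integral i) S"
proof -
  obtain a b where ab: "S \<subseteq> cbox a b" using bounded_subset_cbox_symmetric[OF assms] by blast
  have sub: "vec_of_pair ` S \<subseteq> vec_of_pair ` cbox a b" using ab by blast
  have mem: "x \<in> vec_of_pair ` S \<longleftrightarrow> pair_of_vec x \<in> S" for x
    by (rule mem_vec_of_pair_image)
  let ?F = "\<lambda>z. if z \<in> S then f z else 0"
  have c1: "isCont vec_of_pair z" "isCont pair_of_vec x" for z x
    by (intro linear_continuous_at bounded_linear_vec_of_pair bounded_linear_pair_of_vec)+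
  have ex: "\<exists>w z. vec_of_pair ` cbox u v = cbox w z" "\<exists>w z. pair_of_vec ` cbox u' v' = cbox w z"
    for u v u' v'
    using vec_of_pair_cbox pair_of_vec_cbox by blast+
  have r1: "(f has_integral i) S \<longleftrightarrow> (?F has_integral i) (cbox a b)"
    using ab by (simp add: has_integral_restrict)
  have r2: "((\<lambda>x. f (pair_of_vec x)) has_integral i) (vec_of_pair ` S) \<longleftrightarrow>
      ((\<lambda>x. ?F (pair_of_vec x)) has_integral i) (vec_of_pair ` cbox a b)"
    using has_integral_restrict[OF sub, of "\<lambda>x. f (pair_of_vec x)" i] by (simp add: mem)
  \<comment> \<open>Boxes correspond to boxes of the same volume, so the scaling factor is
    \<open>1\<close>; this is why both integrals were first extended by zero to boxes.\<close>
  have "((\<lambda>x. ?F (pair_of_vec x)) has_integral (1 / 1) *\<^sub>R i) (vec_of_pair ` cbox a b)"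
    if "(?F has_integral i) (cbox a b)"
    by (rule has_integral_twiddle[OF zero_less_one vec_of_pair_of_vec pair_of_vec_of_pair
          c1(2) ex(2,1) _ that]) (simp only: content_pair_of_vec mult_1)
  moreover have "((\<lambda>z. ?F (pair_of_vec (vec_of_pair z))) has_integral (1 / 1) *\<^sub>R i) (pair_of_vec ` cbox (vec_of_pair a) (vec_of_pair b))"
    if "((\<lambda>x. ?F (pair_of_vec x)) has_integral i) (cbox (vec_of_pair a) (vec_of_pair b))"
    by (rule has_integral_twiddle[OF zero_less_one pair_of_vec_of_pair vec_of_pair_of_vec
          c1(1) ex(1,2) _ that]) (simp only: content_vec_of_pair mult_1)
  ultimately show ?thesis unfolding r1 r2
    by (auto simp: vec_of_pair_cbox pair_of_vec_cbox cong: if_cong)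
qed

lemma absolutely_integrable_vec_of_pair_iff:
  fixes f :: "plane \<Rightarrow> 'a::euclidean_space"
  assumes "bounded S"
  shows "(\<lambda>x. f (pair_of_vec x)) absolutely_integrable_on (vec_of_pair ` S) \<longleftrightarrow>
    f absolutely_integrable_on S"
  unfolding absolutely_integrable_on_def integrable_on_def
  by (simp add: has_integral_vec_of_pair_iff[OF assms] has_integral_vec_of_pair_iff[OF assms, of "\<lambda>z. norm (f z)"])

lemma integral_vec_of_pair:
  fixes f :: "plane \<Rightarrow> 'a::euclidean_space"
  assumes "bounded S"
  shows "integral (vec_of_pair ` S) (\<lambda>x. f (pair_of_vec x)) = integral S f"
  unfolding integral_def integrable_on_def has_integral_vec_of_pair_iff[OF assms] ..

lemma plane_change_of_variables:
  fixes f :: "plane \<Rightarrow> real" and g :: "plane \<Rightarrow> plane"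
  assumes S: "open S" "bounded S" "bounded (g ` S)"
    and der: "\<And>x. x \<in> S \<Longrightarrow> (g has_derivative g' x) (at x)"
    and inj: "inj_on g S"
    and f: "f absolutely_integrable_on g ` S"
  shows "(\<lambda>x. \<bar>dp_dq (g' x (1, 0)) (g' x (0, 1))\<bar> * f (g x)) absolutely_integrable_on S"
    and "integral S (\<lambda>x. \<bar>dp_dq (g' x (1, 0)) (g' x (0, 1))\<bar> * f (g x)) = integral (g ` S) f"
proof -
  let ?S = "vec_of_pair ` S"
  let ?g = "\<lambda>x. vec_of_pair (g (pair_of_vec x))"
  let ?g' = "\<lambda>x v. vec_of_pair (g' (pair_of_vec x) (pair_of_vec v))"
  \<comment> \<open>The formula is for vector-valued functions, hence
    \<open>real ^ 1\<close>.\<close>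
  let ?f = "\<lambda>x. vec (f (pair_of_vec x)) :: real ^ 1"
  have mem: "x \<in> ?S \<longleftrightarrow> pair_of_vec x \<in> S" for x
    by (rule mem_vec_of_pair_image)
  have "?S = pair_of_vec -` S" using mem by auto
  then have "open ?S"
    using continuous_open_vimage[OF S(1) linear_continuous_at[OF bounded_linear_pair_of_vec]] by simp
  then have leb: "?S \<in> sets lebesgue" by auto
  have der': "(?g has_derivative ?g' x) (at x within ?S)" if "x \<in> ?S" for x
  proof -
    have "(g has_derivative g' (pair_of_vec x)) (at (pair_of_vec x))"
      using that mem der by blast
    then have "((\<lambda>x. g (pair_of_vec x)) has_derivative (\<lambda>v. g' (pair_of_vec x) (pair_of_vec v))) (at x within ?S)"
      by (rule has_derivative_compose[OF bounded_linear_imp_has_derivative[OF bounded_linear_pair_of_vec]])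
    then show ?thesis
      by (rule bounded_linear.has_derivative[OF bounded_linear_vec_of_pair])
  qed
  have inj': "inj_on ?g ?S"
  proof (rule inj_onI)
    fix x y assume xy: "x \<in> ?S" "y \<in> ?S" and eq: "?g x = ?g y"
    have "g (pair_of_vec x) = g (pair_of_vec y)" using arg_cong[OF eq, of pair_of_vec] by simp
    then have "pair_of_vec x = pair_of_vec y" using inj xy unfolding mem by (blast dest: inj_onD)
    from arg_cong[OF this, of vec_of_pair] show "x = y" by simp
  qed
  have img: "?g ` ?S = vec_of_pair ` (g ` S)" by (simp add: image_image)
  have det: "det (matrix (?g' x)) = dp_dq (g' (pair_of_vec x) (1, 0)) (g' (pair_of_vec x) (0, 1))" for x
  proof -
    have "pair_of_vec (axis 1 1) = (1, 0)" "pair_of_vec (axis 2 1) = (0, 1)"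
      by (simp_all add: pair_of_vec_def axis_def)
    then show ?thesis
      by (simp add: det_2 matrix_def vec_of_pair_def dp_dq_def)
  qed
  have "?f absolutely_integrable_on ?g ` ?S"
    unfolding img absolutely_integrable_on_1_iff
    using absolutely_integrable_vec_of_pair_iff[OF S(3), of f] f by simp
  then have *: "(\<lambda>x. \<bar>det (matrix (?g' x))\<bar> *\<^sub>R ?f (?g x)) absolutely_integrable_on ?S \<and>
      integral ?S (\<lambda>x. \<bar>det (matrix (?g' x))\<bar> *\<^sub>R ?f (?g x)) = integral (?g ` ?S) ?f"
    using has_absolute_integral_change_of_variables[OF leb der' inj', of ?f "integral (?g ` ?S) ?f"]
    by blast
  let ?F = "\<lambda>x. \<bar>dp_dq (g' x (1, 0)) (g' x (0, 1))\<bar> * f (g x)"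
  have "(\<lambda>x. ?F (pair_of_vec x)) absolutely_integrable_on ?S"
    using conjunct1[OF *] unfolding absolutely_integrable_on_1_iff by (simp add: det)
  then show "?F absolutely_integrable_on S"
    using absolutely_integrable_vec_of_pair_iff[OF S(2), of ?F] by simp
  have "integral ?S (\<lambda>x. ?F (pair_of_vec x)) = integral (?g ` ?S) (\<lambda>x. f (pair_of_vec x))"
    using conjunct2[OF *] unfolding integral_on_1_eq by (simp add: det vec_eq_iff)
  then show "integral S ?F = integral (g ` S) f"
    unfolding img integral_vec_of_pair[OF S(2), of ?F] integral_vec_of_pair[OF S(3), of f] .
qed

section \<open>Disks with smooth boundary\<close>

text \<open>Invariance of domain makes the image of the interior open; the inverse map gives the
  other inclusion.\<close>

lemma homeomorphism_image_interior:
  fixes f :: "'a::euclidean_space \<Rightarrow> 'a"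
  assumes "homeomorphism S T f g"
  shows "f ` interior S = interior T"
proof -
  have *: "f ` interior S \<subseteq> interior T" if h: "homeomorphism S T f g" for S T and f g :: "'a \<Rightarrow> 'a"
  proof (rule interior_maximal)
    have "continuous_on (interior S) f"
      by (rule continuous_on_subset[OF homeomorphism_cont1[OF h] interior_subset])
    moreover have "inj_on f (interior S)"
      by (rule inj_on_inverseI[of _ g]) (use homeomorphism_apply1[OF h] interior_subset in blast)
    ultimately show "open (f ` interior S)"
      by (intro invariance_of_domain open_interior)
    show "f ` interior S \<subseteq> T"
      using homeomorphism_image1[OF h] interior_subset by blast
  qed
  have "g ` interior T \<subseteq> interior S"
    by (rule *) (rule homeomorphism_symD[OF assms])
  then have "f ` g ` interior T \<subseteq> f ` interior S" by blast
  moreover have "f ` g ` interior T = interior T"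
  proof -
    have "f (g x) = x" if "x \<in> interior T" for x
      using homeomorphism_apply2[OF assms] interior_subset[of T] that by blast
    then show ?thesis by (simp add: image_image)
  qed
  ultimately show ?thesis using *[OF assms] by auto
qed

lemma homeomorphism_image_frontier:
  fixes f :: "'a::euclidean_space \<Rightarrow> 'a"
  assumes h: "homeomorphism S T f g" and "closed S" "closed T"
  shows "f ` frontier S = frontier T"
proof -
  have "inj_on f S"
    by (rule inj_on_inverseI[of _ g]) (rule homeomorphism_apply1[OF h])
  then have "f ` (S - interior S) = f ` S - f ` interior S"
    by (rule inj_on_image_set_diff[OF _ Diff_subset interior_subset])
  then show ?thesis
    using homeomorphism_image_interior[OF h] homeomorphism_image1[OF h] assms(2,3)
    by (simp add: frontier_def)
qed

text \<open>Derivatives within a set need not be unique in general. Here \<open>L1\<close> and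
  \<open>L2\<close> agree on \<open>w - u\<close> for each \<open>w\<close> in \<open>S\<close>,
  because the segment from \<open>u\<close> to \<open>w\<close> lies in \<open>S\<close>, and such
  vectors span the space once \<open>S\<close> has interior points.\<close>

lemma has_derivative_within_convex_unique:
  fixes f :: "'a::euclidean_space \<Rightarrow> 'b::real_normed_vector"
  assumes S: "convex S" "interior S \<noteq> {}" "u \<in> S"
    and d1: "(f has_derivative L1) (at u within S)" and d2: "(f has_derivative L2) (at u within S)"
  shows "L1 = L2"
proof -
  interpret l1: bounded_linear L1 by (rule has_derivative_bounded_linear[OF d1])
  interpret l2: bounded_linear L2 by (rule has_derivative_bounded_linear[OF d2])
  have eq: "L1 (w - u) = L2 (w - u)" if w: "w \<in> S" for w
  proof -
    have curve: "((\<lambda>s. f (u + s *\<^sub>R (w - u))) has_vector_derivative L (w - u)) (at 0 within {0..1})"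
      if L: "(f has_derivative L) (at u within S)" for L
    proof -
      have sub: "(\<lambda>s. u + s *\<^sub>R (w - u)) ` {0..1} \<subseteq> S"
      proof clarify
        fix s :: real assume "s \<in> {0..1}"
        then have "(1 - s) *\<^sub>R u + s *\<^sub>R w \<in> S"
          using S(1,3) w by (intro convexD) auto
        then show "u + s *\<^sub>R (w - u) \<in> S" by (simp add: algebra_simps)
      qed
      have "((\<lambda>s. u + s *\<^sub>R (w - u)) has_derivative (\<lambda>s. s *\<^sub>R (w - u))) (at 0 within {0..1})"
        by (auto intro!: derivative_eq_intros)
      moreover have "(f has_derivative L) (at (u + 0 *\<^sub>R (w - u)) within (\<lambda>s. u + s *\<^sub>R (w - u)) ` {0..1})"
        using has_derivative_subset[OF L sub] by simp
      ultimately have "((\<lambda>s. f (u + s *\<^sub>R (w - u))) has_derivative (\<lambda>s. L (s *\<^sub>R (w - u)))) (at 0 within {0..1})"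
        by (rule has_derivative_in_compose)
      moreover have "L (s *\<^sub>R (w - u)) = s *\<^sub>R L (w - u)" for s
        using has_derivative_bounded_linear[OF L] by (simp add: linear_cmul bounded_linear.linear)
      ultimately show ?thesis by (simp add: has_vector_derivative_def)
    qed
    have "at (0::real) within {0..1} \<noteq> bot" by (simp add: trivial_limit_within islimpt_Icc)
    from vector_derivative_unique_within[OF this curve[OF d1] curve[OF d2]] show ?thesis .
  qed
  obtain c r where c: "r > 0" "ball c r \<subseteq> S" "c \<in> S"
    using S(2) mem_interior by (metis all_not_in_conv centre_in_ball subsetD)
  show ?thesis
  proof
    fix v :: 'a
    define e where "e = r / (2 * (norm v + 1))"
    have n: "norm v + 1 > 0" by (intro add_nonneg_pos) auto
    have e: "e > 0" using c n by (simp add: e_def)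
    have "e * norm v < r"
    proof -
      have "norm v < 2 * (norm v + 1)" using norm_ge_zero[of v] by argo
      then have "e * norm v < e * (2 * (norm v + 1))" using e by (rule mult_strict_left_mono)
      also have "\<dots> = r" using n by (simp add: e_def)
      finally show ?thesis .
    qed
    then have "c + e *\<^sub>R v \<in> S" using c(2) e by (intro subsetD[OF c(2)]) (simp add: dist_norm)
    \<comment> \<open>Subtracting the identities for two points of the ball around \<open>c\<close>
      isolates the direction \<open>v\<close>.\<close>
    from eq[OF this] eq[OF c(3)]
    have "L1 (c + e *\<^sub>R v - u) - L1 (c - u) = L2 (c + e *\<^sub>R v - u) - L2 (c - u)" by simp
    then have "L1 (e *\<^sub>R v) = L2 (e *\<^sub>R v)"
      by (simp flip: l1.diff l2.diff)
    then show "L1 v = L2 v" using e by (simp add: l1.scaleR l2.scaleR)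
  qed
qed

text \<open>\<open>dp_dq (L (1, 0)) (L (0, 1))\<close> is the determinant of
  \<open>L\<close>.\<close>

lemma dp_dq_linear:
  assumes "linear L"
  shows "dp_dq (L a) (L b) = dp_dq (L (1, 0)) (L (0, 1)) * dp_dq a b"
proof -
  have *: "L x = fst x *\<^sub>R L (1, 0) + snd x *\<^sub>R L (0, 1)" for x
  proof -
    have "L x = L (fst x *\<^sub>R (1, 0) + snd x *\<^sub>R (0, 1))" by (simp add: prod_eq_iff)
    then show ?thesis by (simp only: linear_add[OF assms] linear_cmul[OF assms])
  qed
  show ?thesis
    by (subst (1 2) *) (simp add: dp_dq_def algebra_simps)
qed

text \<open>
  The identity \<open>\<integral> div (f(z) z) dz = 0\<close>, obtained by differentiating
  \<open>\<integral> f(s z) dz = s\<^sup>-\<^sup>2 \<integral> f(z) dz\<close> at \<open>s = 1\<close> for the extension of \<open>f\<close> by zero.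
\<close>

lemma integral_radial_derivative:
  fixes f :: "plane \<Rightarrow> real"
  assumes D: "compact D" "negligible (frontier D)"
    and lip: "\<And>z w. z \<in> D \<Longrightarrow> w \<in> D \<Longrightarrow> \<bar>f w - f z\<bar> \<le> C * norm (w - z)"
    and C: "C \<ge> 0"
    and bd: "\<And>z. z \<in> frontier D \<Longrightarrow> f z = 0"
    and der: "\<And>z. z \<in> interior D \<Longrightarrow> (f has_derivative f' z) (at z)"
  shows "integral D (\<lambda>z. f' z z) = - 2 * integral D f"
proof -
  \<comment> \<open>Extension by zero. It is globally Lipschitz because \<open>f\<close> vanishes on
    the frontier; this is where the boundary condition enters.\<close>
  define F where "F z = (if z \<in> D then f z else 0)" for z
  have closed: "closed D" using D(1) compact_imp_closed by blast
  have cross: "\<bar>F w - F z\<bar> \<le> C * norm (w - z)" if z: "z \<in> D" and w: "w \<notin> D" for z w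
  proof -
    \<comment> \<open>A segment leaving \<open>D\<close> crosses the frontier at a point where
      \<open>f\<close> is \<open>0\<close>, which is also the value of \<open>F w\<close>.\<close>
    have "closed_segment z w \<inter> frontier D \<noteq> {}"
      by (rule connected_Int_frontier) (use z w in \<open>auto intro: exI[of _ z] exI[of _ w]\<close>)
    then obtain b where b: "b \<in> closed_segment z w" "b \<in> frontier D" by blast
    have bD: "b \<in> D" using b(2) closed by (simp add: frontier_def)
    have "\<bar>F w - F z\<bar> = \<bar>f b - f z\<bar>" using z w bd[OF b(2)] by (simp add: F_def)
    also have "\<dots> \<le> C * norm (b - z)" by (rule lip[OF z bD])
    also have "\<dots> \<le> C * norm (w - z)"
      using b(1) C by (intro mult_left_mono segment_bound1[of b z w]) (auto simp: norm_minus_commute)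
    finally show ?thesis .
  qed
  have Flip: "\<bar>F w - F z\<bar> \<le> C * norm (w - z)" for z w
  proof (cases "z \<in> D"; cases "w \<in> D")
    assume "z \<in> D" "w \<in> D" then show ?thesis using lip by (simp add: F_def)
  next
    assume "z \<in> D" "w \<notin> D" then show ?thesis by (rule cross)
  next
    assume "z \<notin> D" "w \<in> D" then show ?thesis using cross[of w z] by (simp add: norm_minus_commute abs_minus_commute)
  next
    assume "z \<notin> D" "w \<notin> D" then show ?thesis using C by (simp add: F_def)
  qed
  have Fcont: "continuous_on UNIV F"
  proof -
    have "C-lipschitz_on UNIV F"
      using Flip C by (auto simp: lipschitz_on_def dist_norm norm_minus_commute)
    then show ?thesis by (rule lipschitz_on_continuous_on)
  qed
  obtain a b where ab: "D \<subseteq> cbox a b" using bounded_subset_cbox_symmetric[OF compact_imp_bounded[OF D(1)]] by blast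
  obtain R where R: "R > 0" "D \<subseteq> cball 0 R"
    using compact_imp_bounded[OF D(1)] unfolding bounded_pos by (auto simp: subset_iff)
  define I where "I = integral D f"
  have FI: "(F has_integral I) (cbox a b)"
  proof -
    have "F integrable_on cbox a b" by (intro integrable_continuous continuous_on_subset[OF Fcont]) auto
    moreover have "integral (cbox a b) F = I"
      unfolding I_def F_def using integral_restrict_Int[of "cbox a b" D f] ab by (simp add: Int_absorb2 Int_commute)
    ultimately show ?thesis using integrable_integral by metis
  qed
  have FU: "(F has_integral I) UNIV"
    by (rule has_integral_on_superset[OF FI]) (use ab in \<open>auto simp: F_def\<close>)
  have scaled: "((\<lambda>z. F (s *\<^sub>R z)) has_integral I / s\<^sup>2) UNIV" if s: "s > 0" for s
  proof -
    let ?im = "(\<lambda>x. (1 / s) *\<^sub>R x + - ((1 / s) *\<^sub>R 0)) ` cbox a b"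
    have "((\<lambda>x. F (s *\<^sub>R x + 0)) has_integral (1 / \<bar>s\<bar> ^ DIM(plane)) *\<^sub>R I) ?im"
      using has_integral_affinity[OF FI, of s 0] s by auto
    then have "((\<lambda>x. F (s *\<^sub>R x)) has_integral I / s\<^sup>2) ?im"
      using s by (simp add: power2_eq_square)
    then show ?thesis
    proof (rule has_integral_on_superset)
      fix x assume x: "x \<notin> ?im"
      have "s *\<^sub>R x \<notin> cbox a b"
      proof
        assume "s *\<^sub>R x \<in> cbox a b"
        then have "(1 / s) *\<^sub>R (s *\<^sub>R x) + - ((1 / s) *\<^sub>R 0) \<in> ?im" by (rule imageI)
        then show False using x s by simp
      qed
      then show "F (s *\<^sub>R x) = 0" using ab by (auto simp: F_def)
    qed auto
  qed
  \<comment> \<open>Difference quotient of \<open>F (s *\<^sub>R z)\<close> at \<open>s = 1\<close>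
    with step \<open>1 / real (Suc n)\<close>. The frontier, where it need not converge, is removed
    in \<open>S\<close>.\<close>
  define q where "q n z = real (Suc n) * (F ((1 + 1 / real (Suc n)) *\<^sub>R z) - F z)" for n z
  define S where "S = cball 0 R - frontier D"
  have q0: "q n z = 0" if "z \<notin> cball 0 R" for n z
  proof -
    have "norm z \<le> norm ((1 + 1 / real (Suc n)) *\<^sub>R z)"
      using mult_right_mono[of 1 "1 + 1 / real (Suc n)" "norm z"] by simp
    then have "(1 + 1 / real (Suc n)) *\<^sub>R z \<notin> cball 0 R" using that by auto
    then have "(1 + 1 / real (Suc n)) *\<^sub>R z \<notin> D" "z \<notin> D" using R(2) that by blast+
    then show ?thesis by (simp add: q_def F_def)
  qed
  have qI: "(q n has_integral real (Suc n) * (I / (1 + 1 / real (Suc n))\<^sup>2 - I)) S" for n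
  proof -
    have "(q n has_integral real (Suc n) * (I / (1 + 1 / real (Suc n))\<^sup>2 - I)) UNIV"
      unfolding q_def by (intro has_integral_mult_right has_integral_diff scaled FU) (simp add: add_pos_pos)
    moreover have "q n = (\<lambda>z. if z \<in> cball 0 R then q n z else 0)" using q0 by auto
    ultimately have "(q n has_integral real (Suc n) * (I / (1 + 1 / real (Suc n))\<^sup>2 - I)) (cball 0 R)"
      by (metis has_integral_restrict_UNIV)
    then show ?thesis
      unfolding S_def using has_integral_spike_set_eq[of "cball 0 R" "cball 0 R - frontier D" "q n"]
        negligible_subset[OF D(2)] by (smt (verit, del_insts) DiffD1 DiffD2 DiffI Diff_subset mem_Collect_eq subsetI)
  qed
  define G where "G z = (if z \<in> interior D then f' z z else 0)" for z
  have lim: "(\<lambda>n. q n z) \<longlonglongrightarrow> G z" if z: "z \<in> S" for z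
  proof -
    have conv: "(\<lambda>n. (1 + 1 / real (Suc n)) *\<^sub>R z) \<longlonglongrightarrow> (1 + 0) *\<^sub>R z"
      by (intro tendsto_intros LIMSEQ_Suc[OF lim_1_over_n])
    consider "z \<in> interior D" | "z \<in> - D"
      using z closed by (auto simp: S_def frontier_def)
    then show ?thesis
    proof cases
      case 1
      have "((\<lambda>s. f (z + s *\<^sub>R z)) has_derivative (\<lambda>s. f' z (s *\<^sub>R z))) (at 0)"
        by (rule has_derivative_compose[of "\<lambda>s. z + s *\<^sub>R z" "\<lambda>s. s *\<^sub>R z" 0 UNIV f "f' z"])
           (use der[OF 1] in \<open>auto intro!: derivative_eq_intros\<close>)
      moreover have "f' z (s *\<^sub>R z) = s * f' z z" for s
        using has_derivative_bounded_linear[OF der[OF 1]] by (simp add: linear_cmul bounded_linear.linear)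
      ultimately have "((\<lambda>s. f (z + s *\<^sub>R z)) has_real_derivative f' z z) (at 0)"
        by (simp add: has_field_derivative_def mult_commute_abs)
      then have "(\<lambda>s. (f (z + s *\<^sub>R z) - f z) / s) \<midarrow>0\<rightarrow> f' z z"
        by (simp add: DERIV_def)
      moreover have "filterlim (\<lambda>n. 1 / real (Suc n)) (at 0) sequentially"
        unfolding filterlim_at using LIMSEQ_Suc[OF lim_1_over_n] by auto
      ultimately have l: "(\<lambda>n. (f (z + (1 / real (Suc n)) *\<^sub>R z) - f z) / (1 / real (Suc n))) \<longlonglongrightarrow> f' z z"
        by (rule filterlim_compose)
      have "eventually (\<lambda>n. (1 + 1 / real (Suc n)) *\<^sub>R z \<in> interior D) sequentially"
        using topological_tendstoD[OF conv open_interior] 1 by simp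
      then have "eventually (\<lambda>n. (f (z + (1 / real (Suc n)) *\<^sub>R z) - f z) / (1 / real (Suc n)) = q n z) sequentially"
      proof eventually_elim
        case (elim n)
        have "(1 + 1 / real (Suc n)) *\<^sub>R z = z + (1 / real (Suc n)) *\<^sub>R z" by (simp add: algebra_simps)
        then show ?case using elim 1 interior_subset[of D] by (auto simp: q_def F_def)
      qed
      then show ?thesis using l 1 by (auto simp: G_def intro: Lim_transform_eventually)
    next
      case 2
      have "eventually (\<lambda>n. (1 + 1 / real (Suc n)) *\<^sub>R z \<in> - D) sequentially"
        using topological_tendstoD[OF conv, of "- D"] 2 closed by (auto simp: open_Compl)
      then have "eventually (\<lambda>n. 0 = q n z) sequentially"
        by eventually_elim (use 2 in \<open>auto simp: q_def F_def\<close>)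
      moreover have "G z = 0" using 2 interior_subset by (auto simp: G_def)
      ultimately show ?thesis by (auto intro: Lim_transform_eventually)
    qed
  qed
  \<comment> \<open>The step size cancels in the Lipschitz bound, which gives a majorant independent
    of \<open>n\<close>.\<close>
  have qb: "norm (q n z) \<le> C * R" if "z \<in> S" for n z
  proof -
    have "\<bar>q n z\<bar> = real (Suc n) * \<bar>F ((1 + 1 / real (Suc n)) *\<^sub>R z) - F z\<bar>"
      by (simp add: q_def abs_mult)
    also have "\<dots> \<le> real (Suc n) * (C * norm ((1 + 1 / real (Suc n)) *\<^sub>R z - z))"
      by (intro mult_left_mono Flip) auto
    also have "(1 + 1 / real (Suc n)) *\<^sub>R z - z = (1 / real (Suc n)) *\<^sub>R z"
      by (simp add: algebra_simps)
    also have "real (Suc n) * (C * norm ((1 / real (Suc n)) *\<^sub>R z)) = C * norm z" by simp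
    also have "\<dots> \<le> C * R" using that C by (intro mult_left_mono) (auto simp: S_def)
    finally show ?thesis by simp
  qed
  have "S \<in> lmeasurable"
    unfolding S_def by (intro fmeasurable_Diff lmeasurable_cball) (use closed in auto)
  then have "(\<lambda>z. C * R) integrable_on S" by (rule integrable_on_const)
  then have L1: "(\<lambda>n. integral S (q n)) \<longlonglongrightarrow> integral S G"
    by (intro dominated_convergence(2)[where h = "\<lambda>z. C * R"] has_integral_integrable[OF qI] qb lim)
  \<comment> \<open>Scaling multiplies the integral by the inverse square of \<open>s\<close>; the
    derivative of that factor at \<open>s = 1\<close> is \<open>- 2\<close>.\<close>
  have L2: "(\<lambda>n. integral S (q n)) \<longlonglongrightarrow> - 2 * I"
  proof -
    have e: "integral S (q n) = - I * (2 + 1 / real (Suc n)) / (1 + 1 / real (Suc n))\<^sup>2" for n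
    proof -
      have "integral S (q n) = real (Suc n) * (I / (1 + 1 / real (Suc n))\<^sup>2 - I)"
        using qI by (rule integral_unique)
      also have "\<dots> = - I * (2 + 1 / real (Suc n)) / (1 + 1 / real (Suc n))\<^sup>2"
      proof -
        define t where "t = 1 / real (Suc n)"
        have t: "t > 0" "real (Suc n) = 1 / t" by (simp_all add: t_def)
        have "I / (1 + t)\<^sup>2 - I = (I - I * (1 + t)\<^sup>2) / (1 + t)\<^sup>2"
          using t(1) by (simp add: diff_divide_distrib)
        also have "I - I * (1 + t)\<^sup>2 = t * (- I * (2 + t))"
          by (simp add: algebra_simps power2_eq_square)
        finally show ?thesis unfolding t_def[symmetric] unfolding t(2) using t(1) by simp
      qed
      finally show ?thesis .
    qed
    have "(\<lambda>n. - I * (2 + 1 / real (Suc n)) / (1 + 1 / real (Suc n))\<^sup>2) \<longlonglongrightarrow> - I * (2 + 0) / (1 + 0)\<^sup>2"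
      by (intro tendsto_intros LIMSEQ_Suc[OF lim_1_over_n]) auto
    then show ?thesis by (simp add: e mult.commute[of 2 I])
  qed
  have "integral S G = integral (interior D) (\<lambda>z. f' z z)"
  proof -
    have "interior D \<subseteq> S"
      using R(2) interior_subset by (force simp: S_def frontier_def)
    then have "S \<inter> interior D = interior D" by blast
    then show ?thesis unfolding G_def using integral_restrict_Int[of S "interior D" "\<lambda>z. f' z z"]
      by (simp add: Int_commute)
  qed
  also have "\<dots> = integral D (\<lambda>z. f' z z)"
    by (rule integral_spike_set) (use D(2) closed interior_subset in \<open>auto simp: frontier_def intro: negligible_subset\<close>)
  finally show ?thesis using LIMSEQ_unique[OF L1 L2] by (simp add: I_def)
qed

text \<open>The maps are extensions of a chart and of its inverse to open neighbourhoods, so that at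
  boundary points they have derivatives in all directions. They are known to be mutually inverse
  only on the closed ball and on \<open>D\<close>.\<close>

locale plane_disk =
  fixes D U V :: "plane set" and \<Phi> \<Psi> :: "plane \<Rightarrow> plane"
  assumes smooth_Phi: "smooth_open U \<Phi>" and cball_U: "cball 0 1 \<subseteq> U"
    and smooth_Psi: "smooth_open V \<Psi>" and D_V: "D \<subseteq> V"
    and Phi_cball: "\<Phi> ` cball 0 1 = D"
    and Psi_Phi: "u \<in> cball 0 1 \<Longrightarrow> \<Psi> (\<Phi> u) = u"
begin

lemma Phi_in: "u \<in> cball 0 1 \<Longrightarrow> \<Phi> u \<in> D"
  using Phi_cball by blast

lemma Psi_in: "z \<in> D \<Longrightarrow> \<Psi> z \<in> cball 0 1"
  using Phi_cball Psi_Phi by (metis imageE)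

lemma Phi_Psi: "z \<in> D \<Longrightarrow> \<Phi> (\<Psi> z) = z"
  using Phi_cball Psi_Phi by (metis imageE)

lemma homeomorphism_Phi: "homeomorphism (cball 0 1) D \<Phi> \<Psi>"
proof -
  have "\<Psi> ` D = cball 0 1"
    using Phi_cball Psi_Phi by (force simp: image_image simp flip: Phi_cball)
  then show ?thesis
    unfolding homeomorphism_def
    using Phi_cball Psi_Phi Phi_Psi continuous_on_subset[OF smooth_open_continuous[OF smooth_Phi] cball_U]
      continuous_on_subset[OF smooth_open_continuous[OF smooth_Psi] D_V]
    by auto
qed

lemma compact_D: "compact D"
  using compact_continuous_image[OF homeomorphism_cont1[OF homeomorphism_Phi] compact_cball]
  by (simp add: Phi_cball)

lemma closed_D: "closed D"
  using compact_D by (rule compact_imp_closed)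

lemma frontier_D: "frontier D = \<Phi> ` sphere 0 1"
  using homeomorphism_image_frontier[OF homeomorphism_Phi closed_cball closed_D] by simp

lemma frontier_subset_D: "frontier D \<subseteq> D"
  using closed_D by (simp add: frontier_subset_closed)

lemma frontier_nonempty: "frontier D \<noteq> {}"
proof -
  have "(1, 0) \<in> sphere (0 :: plane) 1" by (simp add: norm_prod_def)
  then show ?thesis unfolding frontier_D by blast
qed

lemma negligible_frontier: "negligible (frontier D)"
  unfolding frontier_D
proof (rule negligible_differentiable_image_negligible)
  show "negligible (sphere (0 :: plane) 1)" by (rule negligible_sphere)
  have "\<Phi> differentiable at u within sphere 0 1" if "u \<in> sphere 0 1" for u
  proof -
    have "u \<in> U" using that cball_U sphere_cball by blast
    from has_derivative_at_withinI[OF smooth_open_derivative[OF smooth_Phi this]]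
    show ?thesis by (rule differentiableI)
  qed
  then show "\<Phi> differentiable_on sphere 0 1" by (simp add: differentiable_on_def)
qed simp

lemma has_derivative_Phi: "u \<in> cball 0 1 \<Longrightarrow> (\<Phi> has_derivative fd \<Phi> u) (at u)"
  using smooth_open_derivative[OF smooth_Phi] cball_U by blast

lemma has_derivative_Psi: "z \<in> D \<Longrightarrow> (\<Psi> has_derivative fd \<Psi> z) (at z)"
  using smooth_open_derivative[OF smooth_Psi] D_V by blast

lemma linear_fd_Phi: "u \<in> cball 0 1 \<Longrightarrow> linear (fd \<Phi> u)"
  using has_derivative_linear[OF has_derivative_Phi] .

lemma linear_fd_Psi: "z \<in> D \<Longrightarrow> linear (fd \<Psi> z)"
  using has_derivative_linear[OF has_derivative_Psi] .

text \<open>\<open>\<Psi> \<circ> \<Phi>\<close> is the identity only on the closed ball, so at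
  boundary points the identity can be differentiated only within the ball; uniqueness of such
  derivatives identifies the result of the chain rule.\<close>

lemma fd_Psi_Phi:
  assumes u: "u \<in> cball 0 1"
  shows "fd \<Psi> (\<Phi> u) (fd \<Phi> u v) = v"
proof -
  have "((\<lambda>x. \<Psi> (\<Phi> x)) has_derivative (\<lambda>v. fd \<Psi> (\<Phi> u) (fd \<Phi> u v))) (at u within cball 0 1)"
    using has_derivative_compose[OF has_derivative_Phi[OF u] has_derivative_Psi[OF Phi_in[OF u]]]
    by (rule has_derivative_at_withinI)
  then have d1: "((\<lambda>x. x) has_derivative (\<lambda>v. fd \<Psi> (\<Phi> u) (fd \<Phi> u v))) (at u within cball 0 1)"
    by (rule has_derivative_transform[OF u, rotated]) (simp add: Psi_Phi)
  have d2: "((\<lambda>x. x) has_derivative (\<lambda>v. v)) (at u within cball 0 1)"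
    by (rule has_derivative_ident)
  have "interior (cball 0 1) \<noteq> ({} :: plane set)" by simp
  from has_derivative_within_convex_unique[OF convex_cball this u d1 d2] show ?thesis by metis
qed

lemma surj_fd_Phi: "u \<in> cball 0 1 \<Longrightarrow> surj (fd \<Phi> u)"
  by (rule linear_injective_imp_surjective[OF linear_fd_Phi]) (metis fd_Psi_Phi injI)+

abbreviation det_Phi :: "plane \<Rightarrow> real" where
  "det_Phi u \<equiv> dp_dq (fd \<Phi> u (1, 0)) (fd \<Phi> u (0, 1))"

lemma det_fd_Phi_nonzero:
  assumes u: "u \<in> cball 0 1"
  shows "det_Phi u \<noteq> 0"
proof
  assume "det_Phi u = 0"
  then have "dp_dq (fd \<Psi> (\<Phi> u) (fd \<Phi> u (1, 0))) (fd \<Psi> (\<Phi> u) (fd \<Phi> u (0, 1))) = 0"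
    by (subst dp_dq_linear[OF linear_fd_Psi[OF Phi_in[OF u]]]) simp
  then show False by (simp add: fd_Psi_Phi[OF u] dp_dq_def)
qed

text \<open>Composing with \<open>\<Phi>\<close> moves the question to the ball, which is convex;
  surjectivity of \<open>fd \<Phi>\<close> brings the answer back.\<close>

lemma derivative_within_D_unique:
  fixes f :: "plane \<Rightarrow> 'b::real_normed_vector"
  assumes z: "z \<in> D" and d1: "(f has_derivative L1) (at z within D)"
    and d2: "(f has_derivative L2) (at z within D)"
  shows "L1 = L2"
proof -
  let ?u = "\<Psi> z"
  have u: "?u \<in> cball 0 1" using Psi_in z .
  have d: "((\<lambda>x. f (\<Phi> x)) has_derivative (\<lambda>v. L (fd \<Phi> ?u v))) (at ?u within cball 0 1)"
    if "(f has_derivative L) (at z within D)" for L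
    using has_derivative_in_compose[OF has_derivative_at_withinI[OF has_derivative_Phi[OF u]], of f L "cball 0 1"]
      that by (simp add: Phi_cball Phi_Psi[OF z])
  have "interior (cball 0 1) \<noteq> ({} :: plane set)" by simp
  from has_derivative_within_convex_unique[OF convex_cball this u d[OF d1] d[OF d2]]
  have "L1 (fd \<Phi> ?u v) = L2 (fd \<Phi> ?u v)" for v by metis
  then show ?thesis using surj_fd_Phi[OF u] by (metis ext surjD)
qed

lemma frechet_derivative_within_D:
  assumes "z \<in> D" "(f has_derivative L) (at z within D)"
  shows "frechet_derivative f (at z within D) = L"
  using assms derivative_within_D_unique frechet_derivative_works differentiableI by metis

text \<open>Pulled back to the convex ball, a function with quadratically small increments has
  derivative zero, hence is constant. This replaces differentiating the difference of the two
  actions.\<close>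

lemma quadratic_estimate_imp_constant:
  fixes f :: "plane \<Rightarrow> real"
  assumes est: "\<And>z w. z \<in> D \<Longrightarrow> w \<in> D \<Longrightarrow> \<bar>f w - f z\<bar> \<le> C * (norm (w - z))\<^sup>2"
  obtains c where "\<And>z. z \<in> D \<Longrightarrow> f z = c"
proof -
  obtain M where M: "M \<ge> 0" "\<And>u v. u \<in> cball 0 1 \<Longrightarrow> v \<in> cball 0 1 \<Longrightarrow> norm (\<Phi> v - \<Phi> u) \<le> M * norm (v - u)"
    using smooth_open_lipschitz_compact[OF smooth_Phi compact_cball cball_U] by blast
  have e: "\<bar>f (\<Phi> v) - f (\<Phi> u)\<bar> \<le> \<bar>C\<bar> * M\<^sup>2 * (norm (v - u))\<^sup>2" if "u \<in> cball 0 1" "v \<in> cball 0 1" for u v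
  proof -
    have "\<bar>f (\<Phi> v) - f (\<Phi> u)\<bar> \<le> C * (norm (\<Phi> v - \<Phi> u))\<^sup>2" using est Phi_in that by blast
    also have "\<dots> \<le> \<bar>C\<bar> * (norm (\<Phi> v - \<Phi> u))\<^sup>2" by (intro mult_right_mono) auto
    also have "\<dots> \<le> \<bar>C\<bar> * (M * norm (v - u))\<^sup>2"
      using M that by (intro mult_left_mono power_mono) auto
    finally show ?thesis by (simp add: power_mult_distrib mult.assoc)
  qed
  have "\<exists>c. \<forall>u\<in>cball 0 1. f (\<Phi> u) = c"
  proof (rule has_derivative_zero_constant[OF convex_cball])
    fix u :: "plane" assume u: "u \<in> cball 0 1"
    show "((\<lambda>u. f (\<Phi> u)) has_derivative (\<lambda>h. 0)) (at u within cball 0 1)"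
    proof (rule has_derivativeI_sandwich[of 1])
      fix v assume v: "v \<in> cball 0 1" "v \<noteq> u"
      have "norm (f (\<Phi> v) - f (\<Phi> u) - 0) / norm (v - u) \<le> (\<bar>C\<bar> * M\<^sup>2 * (norm (v - u))\<^sup>2) / norm (v - u)"
        using e[OF u v(1)] by (intro divide_right_mono) auto
      then show "norm (f (\<Phi> v) - f (\<Phi> u) - 0) / norm (v - u) \<le> \<bar>C\<bar> * M\<^sup>2 * norm (v - u)"
        using v(2) by (simp add: power2_eq_square)
    next
      have "((\<lambda>v. \<bar>C\<bar> * M\<^sup>2 * norm (v - u)) \<longlongrightarrow> \<bar>C\<bar> * M\<^sup>2 * norm (u - u)) (at u within cball 0 1)"
        by (intro tendsto_intros)
      then show "((\<lambda>v. \<bar>C\<bar> * M\<^sup>2 * norm (v - u)) \<longlongrightarrow> 0) (at u within cball 0 1)" by simp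
    qed auto
  qed
  then show ?thesis using that Psi_in Phi_Psi by metis
qed

end

lemma smooth_closed_disk_imp_plane_disk:
  assumes "smooth_closed_disk D"
  obtains U V \<Phi> \<Psi> where "plane_disk D U V \<Phi> \<Psi>"
proof -
  obtain \<phi> :: "plane \<Rightarrow> plane" where \<phi>: "bij_betw \<phi> (cball 0 1) D" "smooth_on (cball 0 1) \<phi>"
    "smooth_on D (inv_into (cball 0 1) \<phi>)"
    using assms unfolding smooth_closed_disk_def diffeo_between_def by blast
  obtain U \<Phi> where U: "open U" "cball 0 1 \<subseteq> U" "\<forall>k. Ck_on k U \<Phi>" "\<forall>x\<in>cball 0 1. \<Phi> x = \<phi> x"
    using \<phi>(2) unfolding smooth_on_def by blast
  obtain V \<Psi> where V: "open V" "D \<subseteq> V" "\<forall>k. Ck_on k V \<Psi>" "\<forall>x\<in>D. \<Psi> x = inv_into (cball 0 1) \<phi> x"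
    using \<phi>(3) unfolding smooth_on_def by blast
  have "\<Phi> ` cball 0 1 = D"
    using \<phi>(1) U(4) by (auto simp: bij_betw_def)
  moreover have "\<Psi> (\<Phi> u) = u" if "u \<in> cball 0 1" for u
    using \<phi>(1) U(4) V(4) that by (metis bij_betw_imp_inj_on bij_betw_apply inv_into_f_f)
  ultimately have "plane_disk D U V \<Phi> \<Psi>"
    using U V by unfold_locales (auto simp: smooth_open_def)
  then show ?thesis using that by blast
qed

section \<open>Area and boundary\<close>

definition polar :: "real \<Rightarrow> real \<Rightarrow> plane" where
  "polar r \<theta> = (r * cos \<theta>, r * sin \<theta>)"

lemma norm_polar: "norm (polar r \<theta>) = \<bar>r\<bar>"
proof -
  have "(r * cos \<theta>)\<^sup>2 + (r * sin \<theta>)\<^sup>2 = r\<^sup>2 * ((cos \<theta>)\<^sup>2 + (sin \<theta>)\<^sup>2)"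
    by (simp only: power_mult_distrib distrib_left)
  then show ?thesis by (simp add: polar_def norm_prod_def)
qed

lemma polar_exists:
  fixes u :: "plane"
  assumes "u \<noteq> 0"
  obtains \<theta> where "0 \<le> \<theta>" "\<theta> < 2 * pi" "u = polar (norm u) \<theta>"
proof -
  have n: "norm u > 0" using assms by simp
  have "(norm u)\<^sup>2 = (fst u)\<^sup>2 + (snd u)\<^sup>2" by (simp add: norm_prod_def)
  then have "(fst u / norm u)\<^sup>2 + (snd u / norm u)\<^sup>2 = 1"
    using assms unfolding power_divide add_divide_distrib[symmetric] by (auto simp: prod_eq_iff)
  then obtain t where t: "0 \<le> t" "t < 2 * pi" "fst u / norm u = cos t" "snd u / norm u = sin t"
    by (rule sincos_total_2pi)
  have "u = polar (norm u) t"
    unfolding polar_def t(3,4)[symmetric] using n by (simp add: prod_eq_iff)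
  then show ?thesis using that t(1,2) by blast
qed

lemma polar_eq_iff:
  assumes "r > 0" "r' > 0" "polar r \<theta> = polar r' \<theta>'"
  shows "r = r' \<and> (\<exists>n::int. \<theta> = \<theta>' + 2 * pi * n)"
proof -
  have "r = r'" using norm_polar[of r \<theta>] norm_polar[of r' \<theta>'] assms by simp
  then have "sin \<theta> = sin \<theta>' \<and> cos \<theta> = cos \<theta>'" using assms by (simp add: polar_def)
  then show ?thesis using \<open>r = r'\<close> sin_cos_eq_iff by blast
qed

section \<open>Area as an integral over the boundary\<close>

context plane_disk
begin

definition boundary_curve :: "real \<Rightarrow> plane" where
  "boundary_curve \<theta> = \<Phi> (polar 1 \<theta>)"

definition boundary_tangent :: "real \<Rightarrow> plane" where
  "boundary_tangent \<theta> = fd \<Phi> (polar 1 \<theta>) (- sin \<theta>, cos \<theta>)"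

text \<open>The pull-back of \<open>\<lambda>\<close> by \<open>boundary_curve\<close>.\<close>

definition boundary_form :: "real \<Rightarrow> real" where
  "boundary_form \<theta> = dp_dq (boundary_curve \<theta>) (boundary_tangent \<theta>) / 2"

text \<open>The signed Jacobian determinant of \<open>\<Phi> (polar r \<theta>)\<close> in
  \<open>r\<close> and \<open>\<theta>\<close>.\<close>

definition polar_jacobian :: "real \<Rightarrow> real \<Rightarrow> real" where
  "polar_jacobian r \<theta> =
     dp_dq (fd \<Phi> (polar r \<theta>) (cos \<theta>, sin \<theta>)) (r *\<^sub>R fd \<Phi> (polar r \<theta>) (- sin \<theta>, cos \<theta>))"

definition boundary_period :: real where
  "boundary_period = integral {0..2 * pi} boundary_form"

text \<open>A continuous nonvanishing function on the connected ball has constant sign. The chart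
  may reverse orientation, so either sign is possible.\<close>

lemma det_fd_Phi_sign:
  obtains s :: real where "s = 1 \<or> s = - 1"
    "\<And>u. u \<in> cball 0 1 \<Longrightarrow> \<bar>det_Phi u\<bar> = s * det_Phi u"
proof -
  have "continuous_on (cball 0 1) det_Phi"
    by (intro bounded_bilinear.continuous_on[OF bounded_bilinear_dp_dq]
        continuous_on_subset[OF smooth_open_continuous[OF smooth_open_fd[OF smooth_Phi]] cball_U])
  then have conn: "connected (det_Phi ` cball 0 1)"
    by (rule connected_continuous_image[OF _ connected_cball])
  have "0 \<notin> det_Phi ` cball 0 1" using det_fd_Phi_nonzero by fastforce
  have "(\<forall>x\<in>det_Phi ` cball 0 1. x > 0) \<or> (\<forall>x\<in>det_Phi ` cball 0 1. x < 0)"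
  proof (rule ccontr)
    assume "\<not> ?thesis"
    then obtain x y where xy: "x \<in> det_Phi ` cball 0 1" "y \<in> det_Phi ` cball 0 1" "x \<le> 0" "0 \<le> y"
      by (auto simp: not_less)
    then show False using connectedD_interval[OF conn xy(1,2), of 0] xy(3,4) \<open>0 \<notin> det_Phi ` cball 0 1\<close> by blast
  qed
  then show ?thesis
  proof
    assume "\<forall>x\<in>det_Phi ` cball 0 1. x > 0"
    then show ?thesis by (intro that[of 1]) (auto intro!: abs_of_pos)
  next
    assume "\<forall>x\<in>det_Phi ` cball 0 1. x < 0"
    then show ?thesis by (intro that[of "- 1"]) (auto intro!: abs_of_neg)
  qed
qed

text \<open>Stokes' theorem on the parameter rectangle. With \<open>P\<close>, its partial
  derivatives \<open>Pr\<close>, \<open>Pt\<close> and the mixed one \<open>Q\<close>, twice the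
  Jacobian is the \<open>r\<close>-derivative \<open>Mr\<close> of \<open>dp_dq P Pt\<close> minus
  the \<open>\<theta>\<close>-derivative \<open>Nt\<close> of \<open>dp_dq P Pr\<close>. The latter
  integrates to \<open>0\<close> by periodicity; the former leaves only the circle
  \<open>r = 1\<close>, as \<open>Pt\<close> vanishes at \<open>r = 0\<close>.\<close>

lemma boundary_period_polar:
  "integral (cbox (0, 0) (1, 2 * pi)) (\<lambda>(r, \<theta>). polar_jacobian r \<theta>) = boundary_period"
proof -
  let ?B = "cbox (0 :: real, 0 :: real) (1, 2 * pi)"
  let ?I = "cbox (0 :: real) 1" and ?J = "cbox (0 :: real) (2 * pi)"
  define X1 X2 where "X1 u = fd \<Phi> u (1, 0)" and "X2 u = fd \<Phi> u (0, 1)" for u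
  define X11 X12 X22 where "X11 u = fd X1 u (1, 0)" and "X12 u = fd X1 u (0, 1)"
    and "X22 u = fd X2 u (0, 1)" for u
  have sX: "smooth_open U X1" "smooth_open U X2"
    unfolding X1_def X2_def by (intro smooth_open_fd smooth_Phi)+
  have sXX: "smooth_open U X11" "smooth_open U X12" "smooth_open U X22"
    unfolding X11_def X12_def X22_def by (intro smooth_open_fd sX)+
  \<comment> \<open>By this symmetry the \<open>r\<close>-derivative of \<open>Pt\<close> and the
    \<open>\<theta>\<close>-derivative of \<open>Pr\<close> are the same \<open>Q\<close>.\<close>
  have X21: "fd X2 u (1, 0) = X12 u" if "u \<in> U" for u
    unfolding X12_def X1_def X2_def by (rule fd_symmetric[OF smooth_Phi that])
  have lin: "L (a, b) = a *\<^sub>R L (1, 0) + b *\<^sub>R L (0, 1)" if "linear L" for L :: "plane \<Rightarrow> plane" and a b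
  proof -
    have "L (a, b) = L (a *\<^sub>R (1, 0) + b *\<^sub>R (0, 1))" by simp
    then show ?thesis by (simp only: linear_add[OF that] linear_cmul[OF that])
  qed
  have linU: "linear (fd f u)" if "smooth_open U f" "u \<in> U" for f :: "plane \<Rightarrow> plane" and u
    using smooth_open_linear[OF that] by (rule bounded_linear.linear)
  have pU: "polar r \<theta> \<in> U" if "r \<in> ?I" for r \<theta>
    using cball_U that norm_polar[of r \<theta>] by (auto intro!: subsetD[OF cball_U])
  define P where "P r \<theta> = \<Phi> (polar r \<theta>)" for r \<theta>
  define Pr where "Pr r \<theta> = cos \<theta> *\<^sub>R X1 (polar r \<theta>) + sin \<theta> *\<^sub>R X2 (polar r \<theta>)" for r \<theta>
  define Pt where "Pt r \<theta> = r *\<^sub>R (- sin \<theta> *\<^sub>R X1 (polar r \<theta>) + cos \<theta> *\<^sub>R X2 (polar r \<theta>))" for r \<theta>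
  define Q where "Q r \<theta> = - sin \<theta> *\<^sub>R X1 (polar r \<theta>) + cos \<theta> *\<^sub>R X2 (polar r \<theta>)
     + (r * sin \<theta> * cos \<theta>) *\<^sub>R (X22 (polar r \<theta>) - X11 (polar r \<theta>))
     + (r * (cos \<theta> * cos \<theta> - sin \<theta> * sin \<theta>)) *\<^sub>R X12 (polar r \<theta>)" for r \<theta>
  have Pr_eq: "fd \<Phi> (polar r \<theta>) (cos \<theta>, sin \<theta>) = Pr r \<theta>" if "r \<in> ?I" for r \<theta>
    unfolding Pr_def X1_def X2_def by (rule lin[OF linU[OF smooth_Phi pU[OF that]]])
  have Pt_eq: "r *\<^sub>R fd \<Phi> (polar r \<theta>) (- sin \<theta>, cos \<theta>) = Pt r \<theta>" if "r \<in> ?I" for r \<theta>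
    unfolding Pt_def X1_def X2_def by (subst lin[OF linU[OF smooth_Phi pU[OF that]]]) simp
  have der_r: "((\<lambda>r. f (polar r \<theta>)) has_vector_derivative cos \<theta> *\<^sub>R fd f (polar r \<theta>) (1, 0) + sin \<theta> *\<^sub>R fd f (polar r \<theta>) (0, 1)) (at r within A)"
    if f: "smooth_open U f" and r: "r \<in> ?I" for f :: "plane \<Rightarrow> plane" and r \<theta> A
  proof -
    have "((\<lambda>r. polar r \<theta>) has_derivative (\<lambda>h. h *\<^sub>R (cos \<theta>, sin \<theta>))) (at r within A)"
      unfolding polar_def by (auto intro!: derivative_eq_intros)
    from has_derivative_compose[OF this smooth_open_derivative[OF f pU[OF r]]]
    have "((\<lambda>r. f (polar r \<theta>)) has_derivative (\<lambda>h. fd f (polar r \<theta>) (h *\<^sub>R (cos \<theta>, sin \<theta>)))) (at r within A)" .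
    then show ?thesis
      unfolding has_vector_derivative_def linear_cmul[OF linU[OF f pU[OF r]]] lin[OF linU[OF f pU[OF r]], where a = "cos \<theta>" and b = "sin \<theta>"] .
  qed
  have der_t: "((\<lambda>\<theta>. f (polar r \<theta>)) has_vector_derivative (- r * sin \<theta>) *\<^sub>R fd f (polar r \<theta>) (1, 0) + (r * cos \<theta>) *\<^sub>R fd f (polar r \<theta>) (0, 1)) (at \<theta> within A)"
    if f: "smooth_open U f" and r: "r \<in> ?I" for f :: "plane \<Rightarrow> plane" and r \<theta> A
  proof -
    have "((\<lambda>\<theta>. polar r \<theta>) has_derivative (\<lambda>h. h *\<^sub>R (- r * sin \<theta>, r * cos \<theta>))) (at \<theta> within A)"
      unfolding polar_def by (auto intro!: derivative_eq_intros simp: algebra_simps)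
    from has_derivative_compose[OF this smooth_open_derivative[OF f pU[OF r]]]
    have "((\<lambda>\<theta>. f (polar r \<theta>)) has_derivative (\<lambda>h. fd f (polar r \<theta>) (h *\<^sub>R (- r * sin \<theta>, r * cos \<theta>)))) (at \<theta> within A)" .
    then show ?thesis
      unfolding has_vector_derivative_def linear_cmul[OF linU[OF f pU[OF r]]] lin[OF linU[OF f pU[OF r]], where a = "- r * sin \<theta>" and b = "r * cos \<theta>"] .
  qed
  have dP_r: "((\<lambda>r. P r \<theta>) has_vector_derivative Pr r \<theta>) (at r within ?I)" if "r \<in> ?I" for r \<theta>
    using der_r[OF smooth_Phi that] unfolding P_def Pr_def X1_def X2_def .
  have dP_t: "(P r has_vector_derivative Pt r \<theta>) (at \<theta> within ?J)" if "r \<in> ?I" for r \<theta>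
    using der_t[OF smooth_Phi that] unfolding P_def Pt_def X1_def X2_def by (simp add: algebra_simps)
  have dPt_r: "((\<lambda>r. Pt r \<theta>) has_vector_derivative Q r \<theta>) (at r within ?I)" if r: "r \<in> ?I" for r \<theta>
    unfolding Pt_def
    by (rule has_vector_derivative_eq_rhs,
        rule has_vector_derivative_scaleR, rule DERIV_ident,
        (rule has_vector_derivative_add has_vector_derivative_scaleR has_vector_derivative_minus DERIV_const
          der_r[OF sX(1) r] der_r[OF sX(2) r])+)
       (simp add: Q_def X21[OF pU[OF r]] X11_def[symmetric] X12_def[symmetric] X22_def[symmetric] algebra_simps)
  have dPr_t: "(Pr r has_vector_derivative Q r \<theta>) (at \<theta> within ?J)" if r: "r \<in> ?I" for r \<theta>
    unfolding Pr_def
    by (rule has_vector_derivative_eq_rhs,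
        rule has_vector_derivative_add,
        (rule has_vector_derivative_scaleR has_field_derivative_at_within[OF DERIV_cos] has_field_derivative_at_within[OF DERIV_sin]
          der_t[OF sX(1) r] der_t[OF sX(2) r])+)
       (simp add: Q_def X21[OF pU[OF r]] X11_def[symmetric] X12_def[symmetric] X22_def[symmetric] algebra_simps)
  have cont: "continuous_on ?B (\<lambda>x. f (polar (fst x) (snd x)))" if "smooth_open U f" for f :: "plane \<Rightarrow> plane"
  proof (rule continuous_on_compose2[OF smooth_open_continuous[OF that]])
    show "continuous_on ?B (\<lambda>x. polar (fst x) (snd x))"
      unfolding polar_def by (intro continuous_intros)
    show "(\<lambda>x. polar (fst x) (snd x)) ` ?B \<subseteq> U"
      using pU by (force simp: cbox_Pair_eq)
  qed
  have cPr: "continuous_on ?B (\<lambda>x. Pr (fst x) (snd x))" and cPt: "continuous_on ?B (\<lambda>x. Pt (fst x) (snd x))"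
    and cP: "continuous_on ?B (\<lambda>x. P (fst x) (snd x))" and cQ: "continuous_on ?B (\<lambda>x. Q (fst x) (snd x))"
    unfolding Pr_def Pt_def P_def Q_def
    by (intro continuous_intros cont sX sXX smooth_Phi)+
  define Mr where "Mr r \<theta> = dp_dq (P r \<theta>) (Q r \<theta>) + dp_dq (Pr r \<theta>) (Pt r \<theta>)" for r \<theta>
  define Nt where "Nt r \<theta> = dp_dq (P r \<theta>) (Q r \<theta>) + dp_dq (Pt r \<theta>) (Pr r \<theta>)" for r \<theta>
  have cM: "continuous_on ?B (\<lambda>(r, \<theta>). Mr r \<theta>)" and cN: "continuous_on ?B (\<lambda>(r, \<theta>). Nt r \<theta>)"
    unfolding Mr_def Nt_def split_beta
    by (intro continuous_intros bounded_bilinear.continuous_on[OF bounded_bilinear_dp_dq] cPr cPt cP cQ)+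
  have "integral ?B (\<lambda>(r, \<theta>). polar_jacobian r \<theta>)
      = integral ?B (\<lambda>x. (1/2) * (case x of (r, \<theta>) \<Rightarrow> Mr r \<theta>) - (1/2) * (case x of (r, \<theta>) \<Rightarrow> Nt r \<theta>))"
  proof (rule integral_cong)
    fix x assume "x \<in> ?B"
    then obtain r \<theta> where x: "x = (r, \<theta>)" "r \<in> ?I" by (cases x) (auto simp: cbox_Pair_eq)
    have "dp_dq (Pt r \<theta>) (Pr r \<theta>) = - dp_dq (Pr r \<theta>) (Pt r \<theta>)" by (simp add: dp_dq_def)
    then show "(case x of (r, \<theta>) \<Rightarrow> polar_jacobian r \<theta>)
      = (1/2) * (case x of (r, \<theta>) \<Rightarrow> Mr r \<theta>) - (1/2) * (case x of (r, \<theta>) \<Rightarrow> Nt r \<theta>)"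
      by (simp add: x(1) polar_jacobian_def Pr_eq[OF x(2)] Pt_eq[OF x(2)] Mr_def Nt_def field_simps)
  qed
  also have "\<dots> = (1/2) * integral ?B (\<lambda>(r, \<theta>). Mr r \<theta>) - (1/2) * integral ?B (\<lambda>(r, \<theta>). Nt r \<theta>)"
    using integrable_continuous[OF cM] integrable_continuous[OF cN]
    by (subst integral_diff) (auto intro: integrable_on_mult_right)
  also have "integral ?B (\<lambda>(r, \<theta>). Nt r \<theta>) = integral ?I (\<lambda>r. integral ?J (Nt r))"
    using integral_prod_continuous[OF cN] by simp
  also have "\<dots> = integral ?I (\<lambda>r. 0)"
  proof (rule integral_cong)
    fix r assume r: "r \<in> ?I"
    have "(Nt r has_integral dp_dq (P r (2 * pi)) (Pr r (2 * pi)) - dp_dq (P r 0) (Pr r 0)) {0..2 * pi}"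
      unfolding Nt_def
      by (rule fundamental_theorem_of_calculus)
         (use bounded_bilinear.has_vector_derivative[OF bounded_bilinear_dp_dq dP_t[OF r] dPr_t[OF r]] in auto)
    moreover have "polar r (2 * pi) = polar r 0" by (simp add: polar_def)
    ultimately have "(Nt r has_integral 0) ?J" by (simp add: P_def Pr_def)
    then show "integral ?J (Nt r) = 0" by (rule integral_unique)
  qed
  also have "integral ?B (\<lambda>(r, \<theta>). Mr r \<theta>) = integral ?I (\<lambda>r. integral ?J (Mr r))"
    using integral_prod_continuous[OF cM] by simp
  also have "\<dots> = integral ?J (\<lambda>\<theta>. integral ?I (\<lambda>r. Mr r \<theta>))"
    by (rule integral_swap_continuous[OF cM])
  also have "\<dots> = integral ?J (\<lambda>\<theta>. 2 * boundary_form \<theta>)"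
  proof (rule integral_cong)
    fix \<theta>
    have "((\<lambda>r. Mr r \<theta>) has_integral dp_dq (P 1 \<theta>) (Pt 1 \<theta>) - dp_dq (P 0 \<theta>) (Pt 0 \<theta>)) {0..1}"
      unfolding Mr_def
      by (rule fundamental_theorem_of_calculus)
         (use bounded_bilinear.has_vector_derivative[OF bounded_bilinear_dp_dq dP_r dPt_r] in auto)
    moreover have "dp_dq (P 0 \<theta>) (Pt 0 \<theta>) = 0" by (simp add: Pt_def dp_dq_def)
    moreover have "dp_dq (P 1 \<theta>) (Pt 1 \<theta>) = 2 * boundary_form \<theta>"
      using Pt_eq[of 1 \<theta>] by (simp add: boundary_form_def boundary_curve_def boundary_tangent_def P_def)
    ultimately show "integral ?I (\<lambda>r. Mr r \<theta>) = 2 * boundary_form \<theta>" by (simp add: integral_unique)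
  qed
  finally show ?thesis by (simp add: boundary_period_def)
qed

text \<open>Polar coordinates are injective on the open rectangle. Its image misses from
  \<open>D\<close> only the frontier and the image of the slit at angle \<open>0\<close>, both null
  sets.\<close>

lemma symp_area_polar:
  "symp_area D = integral (cbox (0, 0) (1, 2 * pi)) (\<lambda>(r, \<theta>). \<bar>polar_jacobian r \<theta>\<bar>)"
proof -
  let ?B = "box (0 :: real, 0 :: real) (1, 2 * pi)"
  let ?g = "\<lambda>x. \<Phi> (polar (fst x) (snd x))"
  let ?g' = "\<lambda>x v. fd \<Phi> (polar (fst x) (snd x))
     (fst v * cos (snd x) - fst x * (snd v * sin (snd x)), fst v * sin (snd x) + fst x * (snd v * cos (snd x)))"
  have B: "x \<in> ?B \<longleftrightarrow> 0 < fst x \<and> fst x < 1 \<and> 0 < snd x \<and> snd x < 2 * pi" for x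
    by (cases x) (auto simp: mem_box Basis_prod_def ball_Un)
  have in_ball: "polar (fst x) (snd x) \<in> cball 0 1" if "x \<in> ?B" for x
    using that by (auto simp: B norm_polar)
  have der: "(?g has_derivative ?g' x) (at x)" if x: "x \<in> ?B" for x
  proof -
    have "((\<lambda>x. polar (fst x) (snd x)) has_derivative
       (\<lambda>v. (fst v * cos (snd x) - fst x * (snd v * sin (snd x)), fst v * sin (snd x) + fst x * (snd v * cos (snd x))))) (at x)"
      unfolding polar_def by (auto intro!: derivative_eq_intros simp: algebra_simps)
    from has_derivative_compose[OF this, of \<Phi> "fd \<Phi> (polar (fst x) (snd x))"]
    show ?thesis using has_derivative_Phi[OF in_ball[OF x]] by simp
  qed
  have inj: "inj_on ?g ?B"
  proof (rule inj_onI)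
    fix x y assume x: "x \<in> ?B" and y: "y \<in> ?B" and eq: "?g x = ?g y"
    have "polar (fst x) (snd x) = polar (fst y) (snd y)"
      using arg_cong[OF eq, of \<Psi>] by (simp only: Psi_Phi[OF in_ball[OF x]] Psi_Phi[OF in_ball[OF y]])
    then obtain n :: int where n: "fst x = fst y" "snd x = snd y + 2 * pi * n"
      using polar_eq_iff[of "fst x" "fst y" "snd x" "snd y"] x y B by blast
    have "\<bar>2 * pi * n\<bar> < 2 * pi" using n x y B[of x] B[of y] by linarith
    then have "\<bar>real_of_int n\<bar> < 1" by (simp add: abs_mult)
    \<comment> \<open>Both angles lie strictly between \<open>0\<close> and \<open>2 * pi\<close>,
      so they cannot differ by a full turn.\<close>
    then have "n = 0" by linarith
    then show "x = y" using n by (simp add: prod_eq_iff)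
  qed
  have contg: "continuous_on ?B ?g"
    using der has_derivative_continuous by (blast intro: continuous_at_imp_continuous_on)
  have sub: "?g ` ?B \<subseteq> D" using Phi_in in_ball by blast
  have bdd: "bounded (?g ` ?B)" using sub compact_imp_bounded[OF compact_D] bounded_subset by blast
  have op: "open (?g ` ?B)" by (rule invariance_of_domain[OF contg open_box inj])
  have "(\<lambda>x. 1 :: real) absolutely_integrable_on ?g ` ?B"
    by (rule bounded_continuous_absolutely_integrable[where B = 1]) (use op bdd in auto)
  from plane_change_of_variables(2)[OF open_box bounded_box bdd der inj this]
  have "integral (?g ` ?B) (\<lambda>x. 1) = integral ?B (\<lambda>x. \<bar>dp_dq (?g' x (1, 0)) (?g' x (0, 1))\<bar>)" by simp
  also have "\<dots> = integral ?B (\<lambda>(r, \<theta>). \<bar>polar_jacobian r \<theta>\<bar>)"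
  proof (rule integral_cong)
    fix x assume x: "x \<in> ?B"
    have "r *\<^sub>R fd \<Phi> (polar (fst x) (snd x)) v = fd \<Phi> (polar (fst x) (snd x)) (r *\<^sub>R v)" for r v
      by (rule linear_cmul[symmetric, OF linear_fd_Phi[OF in_ball[OF x]]])
    then show "\<bar>dp_dq (?g' x (1, 0)) (?g' x (0, 1))\<bar> = (case x of (r, \<theta>) \<Rightarrow> \<bar>polar_jacobian r \<theta>\<bar>)"
      by (simp add: split_beta polar_jacobian_def)
  qed
  also have "\<dots> = integral (cbox (0, 0) (1, 2 * pi)) (\<lambda>(r, \<theta>). \<bar>polar_jacobian r \<theta>\<bar>)"
    by (rule integral_open_interval)
  also have "integral (?g ` ?B) (\<lambda>x. 1 :: real) = integral D (\<lambda>x. 1)"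
  proof (rule integral_spike_set)
    \<comment> \<open>The slit, including the centre of the ball.\<close>
    let ?R = "{0 .. 1 :: real} \<times> {0 :: real}"
    have R: "?R \<subseteq> cball 0 1" by (auto simp: norm_prod_def)
    have "negligible ?R"
    proof (rule negligible_subset)
      show "negligible {x :: plane. (0, 1) \<bullet> x = 0}" by (rule negligible_hyperplane) (simp add: zero_prod_def)
    qed auto
    moreover have "\<Phi> differentiable_on ?R"
      unfolding differentiable_on_def
      using has_derivative_at_withinI[OF has_derivative_Phi] R differentiableI by blast
    ultimately have nR: "negligible (\<Phi> ` ?R)"
      by (intro negligible_differentiable_image_negligible) auto
    have "D - ?g ` ?B \<subseteq> frontier D \<union> \<Phi> ` ?R"
    proof
      fix z assume z: "z \<in> D - ?g ` ?B"
      show "z \<in> frontier D \<union> \<Phi> ` ?R"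
      proof (rule ccontr)
        assume nz: "z \<notin> frontier D \<union> \<Phi> ` ?R"
        obtain u where u: "u \<in> cball 0 1" "z = \<Phi> u" using z Phi_cball by blast
        then have "u \<notin> sphere 0 1" using nz frontier_D by blast
        then have u1: "norm u < 1" using u(1) by simp
        have nR: "u \<notin> ?R"
        proof
          assume "u \<in> ?R"
          then have "\<Phi> u \<in> \<Phi> ` ?R" by (rule imageI)
          then show False using nz u(2) by simp
        qed
        moreover have "0 \<in> ?R" by (simp add: zero_prod_def)
        ultimately have "u \<noteq> 0" by metis
        obtain t where t: "0 \<le> t" "t < 2 * pi" "u = polar (norm u) t"
          using polar_exists[OF \<open>u \<noteq> 0\<close>] by metis
        have "t \<noteq> 0"
        proof
          assume "t = 0"
          then have "u = (norm u, 0)" using t(3) by (simp add: polar_def)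
          moreover have "(norm u, 0) \<in> ?R" using u1 by simp
          ultimately show False using nR by metis
        qed
        then have "(norm u, t) \<in> ?B" using t u1 \<open>u \<noteq> 0\<close> by (simp add: B)
        moreover have "z = ?g (norm u, t)" using t(3) u(2) by simp
        ultimately show False using z by blast
      qed
    qed
    then have "negligible (D - ?g ` ?B)"
      by (rule negligible_subset[OF negligible_Un[OF negligible_frontier nR]])
    then show "negligible {x \<in> D - ?g ` ?B. (1 :: real) \<noteq> 0}" by (simp add: set_diff_eq)
    show "negligible {x \<in> ?g ` ?B - D. (1 :: real) \<noteq> 0}" using sub by (simp add: Diff_eq_empty_iff[THEN iffD2])
  qed
  finally show ?thesis by (simp add: symp_area_def)
qed

text \<open>The absolute Jacobian is the signed one times the constant sign of
  \<open>det_Phi\<close>, as the factor \<open>r\<close> from polar coordinates is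
  nonnegative.\<close>

lemma boundary_period_eq_area: "boundary_period = symp_area D \<or> boundary_period = - symp_area D"
proof -
  obtain s :: real where s: "s = 1 \<or> s = - 1"
    "\<And>u. u \<in> cball 0 1 \<Longrightarrow> \<bar>det_Phi u\<bar> = s * det_Phi u"
    using det_fd_Phi_sign by metis
  have "symp_area D = integral (cbox (0, 0) (1, 2 * pi)) (\<lambda>(r, \<theta>). \<bar>polar_jacobian r \<theta>\<bar>)"
    by (rule symp_area_polar)
  also have "\<dots> = integral (cbox (0, 0) (1, 2 * pi)) (\<lambda>x. s * (case x of (r, \<theta>) \<Rightarrow> polar_jacobian r \<theta>))"
  proof (rule integral_cong)
    fix x :: "plane" assume "x \<in> cbox (0, 0) (1, 2 * pi)"
    then obtain r \<theta> where x: "x = (r, \<theta>)" "0 \<le> r" "r \<le> 1" by (cases x) (auto simp: cbox_Pair_eq)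
    have u: "polar r \<theta> \<in> cball 0 1" using x by (simp add: norm_polar)
    have "polar_jacobian r \<theta> = dp_dq (fd \<Phi> (polar r \<theta>) (cos \<theta>, sin \<theta>)) (fd \<Phi> (polar r \<theta>) (r *\<^sub>R (- sin \<theta>, cos \<theta>)))"
      by (simp only: polar_jacobian_def linear_cmul[OF linear_fd_Phi[OF u]])
    also have "\<dots> = det_Phi (polar r \<theta>) * dp_dq (cos \<theta>, sin \<theta>) (r *\<^sub>R (- sin \<theta>, cos \<theta>))"
      by (rule dp_dq_linear[OF linear_fd_Phi[OF u]])
    also have "dp_dq (cos \<theta>, sin \<theta>) (r *\<^sub>R (- sin \<theta>, cos \<theta>)) = r"
    proof -
      have "dp_dq (cos \<theta>, sin \<theta>) (r *\<^sub>R (- sin \<theta>, cos \<theta>)) = r * (cos \<theta> * cos \<theta> + sin \<theta> * sin \<theta>)"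
        unfolding dp_dq_def by (simp add: distrib_left del: sin_cos_squared_add3)
      then show ?thesis by (simp only: sin_cos_squared_add3 mult_1_right)
    qed
    finally have K: "polar_jacobian r \<theta> = det_Phi (polar r \<theta>) * r" .
    show "(case x of (r, \<theta>) \<Rightarrow> \<bar>polar_jacobian r \<theta>\<bar>) = s * (case x of (r, \<theta>) \<Rightarrow> polar_jacobian r \<theta>)"
      unfolding x(1) split K abs_mult s(2)[OF u] using x(2) by simp
  qed
  also have "\<dots> = s * boundary_period"
    unfolding boundary_period_polar[symmetric] by (rule integral_mult_right)
  finally show ?thesis using s(1) by auto
qed

end

text \<open>The angle comes from a complex logarithm on the interval, which gives only continuity;
  differentiability is recovered locally from \<open>arcsin\<close>.\<close>

lemma circle_lift:
  fixes u :: "real \<Rightarrow> plane"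
  assumes cont: "continuous_on {a..b} u" and n1: "\<And>t. t \<in> {a..b} \<Longrightarrow> norm (u t) = 1"
  obtains \<theta> where "continuous_on {a..b} \<theta>" "\<And>t. t \<in> {a..b} \<Longrightarrow> u t = polar 1 (\<theta> t)"
    "\<And>t u'. t \<in> {a<..<b} \<Longrightarrow> (u has_vector_derivative u') (at t) \<Longrightarrow>
       (\<theta> has_real_derivative dp_dq (u t) u') (at t)"
proof -
  define f where "f t = Complex (fst (u t)) (snd (u t))" for t
  have f: "continuous_on {a..b} f"
    unfolding f_def Complex_eq by (intro continuous_intros cont)
  have nf: "norm (f t) = 1" if "t \<in> {a..b}" for t
    using n1[OF that] by (simp add: f_def cmod_def norm_prod_def)
  have f0: "f t \<noteq> 0" if "t \<in> {a..b}" for t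
    using nf[OF that] by auto
  have "contractible {a..b}" by (rule convex_imp_contractible) simp
  then obtain g where g: "continuous_on {a..b} g" "\<And>t. t \<in> {a..b} \<Longrightarrow> f t = exp (g t)"
    using continuous_logarithm_on_contractible[OF f] f0 by metis
  define \<theta> where "\<theta> t = Im (g t)" for t
  have \<theta>: "continuous_on {a..b} \<theta>" unfolding \<theta>_def by (intro continuous_intros g)
  have polar: "u t = polar 1 (\<theta> t)" if t: "t \<in> {a..b}" for t
  proof -
    have "exp (Re (g t)) = 1" using nf[OF t] g(2)[OF t] by simp
    moreover have "fst (u t) = Re (exp (g t))" "snd (u t) = Im (exp (g t))"
      using g(2)[OF t] by (simp_all add: f_def flip: g(2)[OF t])
    ultimately show ?thesis
      by (simp add: polar_def prod_eq_iff Re_exp Im_exp \<theta>_def)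
  qed
  have "(\<theta> has_real_derivative dp_dq (u t) u') (at t)"
    if t: "t \<in> {a<..<b}" and u': "(u has_vector_derivative u') (at t)" for t u'
  proof -
    \<comment> \<open>\<open>p s\<close> is the sine of the angle from \<open>u t\<close> to
      \<open>u s\<close>.\<close>
    define p where "p s = dp_dq (u t) (u s)" for s
    have p: "(p has_real_derivative dp_dq (u t) u') (at t)"
      unfolding p_def has_real_derivative_iff_has_vector_derivative
      by (rule bounded_linear.has_vector_derivative[OF bounded_bilinear.bounded_linear_right[OF bounded_bilinear_dp_dq] u'])
    have p0: "p t = 0" by (simp add: p_def dp_dq_def)
    have "((\<lambda>s. \<theta> t + arcsin (p s)) has_real_derivative inverse (sqrt (1 - (p t)\<^sup>2)) * dp_dq (u t) u') (at t)"
      using p p0 by (auto intro!: derivative_eq_intros)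
    then have A: "((\<lambda>s. \<theta> t + arcsin (p s)) has_real_derivative dp_dq (u t) u') (at t)"
      by (simp add: p0)
    have "isCont \<theta> t"
      by (rule continuous_on_interior[OF \<theta>]) (use t in simp)
    \<comment> \<open>Keeping the angle within a quarter turn of \<open>\<theta> t\<close> lets
      \<open>arcsin\<close> invert the sine.\<close>
    then obtain d where d: "d > 0" "\<And>s. dist s t < d \<Longrightarrow> dist (\<theta> s) (\<theta> t) < pi / 2"
      unfolding continuous_at_eps_delta using pi_half_gt_zero by blast
    define e where "e = min d (min (t - a) (b - t))"
    show ?thesis
    proof (rule has_field_derivative_transform_within[OF A])
      show "0 < e" using d t by (simp add: e_def)
      fix s assume s: "dist s t < e"
      have sab: "s \<in> {a..b}" using s by (auto simp: e_def dist_real_def)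
      have "p s = sin (\<theta> s - \<theta> t)"
        using polar[OF sab] polar[of t] t by (simp add: p_def dp_dq_def polar_def sin_diff algebra_simps)
      moreover have "\<bar>\<theta> s - \<theta> t\<bar> < pi / 2" using d(2)[of s] s by (simp add: e_def dist_real_def)
      moreover from this have "- (pi / 2) \<le> \<theta> s - \<theta> t" "\<theta> s - \<theta> t \<le> pi / 2" by arith+
      then have "arcsin (sin (\<theta> s - \<theta> t)) = \<theta> s - \<theta> t" by (rule arcsin_sin)
      ultimately show "\<theta> t + arcsin (p s) = \<theta> s" by simp
    qed simp
  qed
  then show ?thesis using that \<theta> polar by blast
qed

text \<open>The primitive has to live on the whole line, since the angle of a boundary curve may
  leave any fixed interval.\<close>

lemma continuous_has_primitive:
  fixes f :: "real \<Rightarrow> real"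
  assumes f: "continuous_on UNIV f"
  obtains F where "\<And>x. (F has_real_derivative f x) (at x)"
proof -
  define F where "F x = integral {0..x} f - integral {x..0} f" for x
  have int: "f integrable_on {a..b}" for a b
    by (intro integrable_continuous_interval continuous_on_subset[OF f]) auto
  \<comment> \<open>With a base point \<open>- N\<close> to the left of both \<open>x\<close> and
    \<open>0\<close>, \<open>F\<close> is an ordinary integral function minus a constant, so both
    signs of \<open>x\<close> are treated at once.\<close>
  have F: "F x = integral {- N..x} f - integral {- N..0} f" if N: "- N \<le> x" "0 \<le> N" for N x
  proof (cases "0 \<le> x")
    case True
    have "integral {- N..0} f + integral {0..x} f = integral {- N..x} f"
      by (rule Henstock_Kurzweil_Integration.integral_combine) (use N True int in auto)
    moreover have "integral {x..0} f = 0"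
      using True by (cases "x = 0") auto
    ultimately show ?thesis by (simp add: F_def)
  next
    case False
    have "integral {- N..x} f + integral {x..0} f = integral {- N..0} f"
      by (rule Henstock_Kurzweil_Integration.integral_combine) (use N False int in auto)
    then show ?thesis using False by (simp add: F_def)
  qed
  have "(F has_real_derivative f x) (at x)" for x
  proof -
    define N where "N = \<bar>x\<bar> + 1"
    have x: "- N < x" "x < N" "0 \<le> N" by (auto simp: N_def)
    have "((\<lambda>y. integral {- N..y} f) has_real_derivative f x) (at x within {- N..N})"
      by (rule integral_has_real_derivative) (use x continuous_on_subset[OF f] in auto)
    then have "((\<lambda>y. integral {- N..y} f - integral {- N..0} f) has_real_derivative f x) (at x)"
      using x by (auto intro!: derivative_eq_intros simp: at_within_Icc_at)
    then show ?thesis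
      by (rule has_field_derivative_transform_within_open[of _ _ _ "{- N<..<N}"])
         (use x F[of N] in auto)
  qed
  then show ?thesis using that by blast
qed

section \<open>Curves on the boundary\<close>

context plane_disk
begin

lemma polar_1_in_cball: "polar 1 \<theta> \<in> cball 0 1"
  by (simp add: norm_polar)

lemma range_boundary_curve: "range boundary_curve = frontier D"
proof -
  have "sphere 0 1 = range (polar 1)"
  proof
    show "sphere 0 1 \<subseteq> range (polar 1)"
    proof
      fix u :: "plane" assume "u \<in> sphere 0 1"
      then have u: "norm u = 1" by simp
      then have "u \<noteq> 0" by auto
      then show "u \<in> range (polar 1)" using polar_exists[of u] u by (metis rangeI)
    qed
  qed (auto simp: norm_polar)
  then show ?thesis unfolding frontier_D boundary_curve_def by (simp add: image_image)
qed

lemma has_vector_derivative_boundary_curve: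
  "(boundary_curve has_vector_derivative boundary_tangent \<theta>) (at \<theta>)"
proof -
  have "((\<lambda>\<theta>. polar 1 \<theta>) has_derivative (\<lambda>h. h *\<^sub>R (- sin \<theta>, cos \<theta>))) (at \<theta>)"
    unfolding polar_def by (auto intro!: derivative_eq_intros simp: algebra_simps)
  from has_derivative_compose[OF this has_derivative_Phi[OF polar_1_in_cball]]
  show ?thesis
    unfolding has_vector_derivative_def boundary_curve_def boundary_tangent_def
    by (simp only: linear_cmul[OF linear_fd_Phi[OF polar_1_in_cball]])
qed

lemma continuous_boundary_form: "continuous_on UNIV boundary_form"
proof -
  have polar: "continuous_on UNIV (\<lambda>\<theta>. polar 1 \<theta>)"
    unfolding polar_def by (intro continuous_intros)
  have c: "continuous_on UNIV (\<lambda>\<theta>. f (polar 1 \<theta>))" if "smooth_open U f" for f :: "plane \<Rightarrow> plane"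
    using continuous_on_compose2[OF smooth_open_continuous[OF that] polar] polar_1_in_cball cball_U by blast
  have "boundary_tangent \<theta> = - sin \<theta> *\<^sub>R fd \<Phi> (polar 1 \<theta>) (1, 0) + cos \<theta> *\<^sub>R fd \<Phi> (polar 1 \<theta>) (0, 1)" for \<theta>
  proof -
    have "boundary_tangent \<theta> = fd \<Phi> (polar 1 \<theta>) (- sin \<theta> *\<^sub>R (1, 0) + cos \<theta> *\<^sub>R (0, 1))"
      by (simp add: boundary_tangent_def)
    then show ?thesis
      by (simp only: linear_add[OF linear_fd_Phi[OF polar_1_in_cball]] linear_cmul[OF linear_fd_Phi[OF polar_1_in_cball]])
  qed
  then have "continuous_on UNIV boundary_tangent \<longleftrightarrow> continuous_on UNIV
      (\<lambda>\<theta>. - sin \<theta> *\<^sub>R fd \<Phi> (polar 1 \<theta>) (1, 0) + cos \<theta> *\<^sub>R fd \<Phi> (polar 1 \<theta>) (0, 1))"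
    by (intro continuous_on_cong) auto
  moreover have "continuous_on UNIV
      (\<lambda>\<theta>. - sin \<theta> *\<^sub>R fd \<Phi> (polar 1 \<theta>) (1, 0) + cos \<theta> *\<^sub>R fd \<Phi> (polar 1 \<theta>) (0, 1))"
    by (intro continuous_intros c smooth_open_fd smooth_Phi)
  ultimately have "continuous_on UNIV boundary_tangent" by blast
  moreover have "continuous_on UNIV boundary_curve"
    unfolding boundary_curve_def by (rule c[OF smooth_Phi])
  ultimately show ?thesis
    unfolding boundary_form_def
    by (intro continuous_intros bounded_bilinear.continuous_on[OF bounded_bilinear_dp_dq]) simp_all
qed

lemma boundary_form_periodic: "boundary_form (\<theta> + 2 * pi) = boundary_form \<theta>"
  by (simp add: boundary_form_def boundary_curve_def boundary_tangent_def polar_def)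

text \<open>\<open>\<Lambda>\<close> is an antiderivative of \<open>\<lambda>\<close> on the
  universal cover of the boundary: each full turn adds \<open>boundary_period\<close>. This is the
  source of the integer in the theorem.\<close>

lemma boundary_primitive:
  obtains \<Lambda> where "\<And>x. (\<Lambda> has_real_derivative boundary_form x) (at x)"
    "\<And>x n. \<Lambda> (x + 2 * pi * of_int n) = \<Lambda> x + of_int n * boundary_period"
proof -
  obtain \<Lambda> where \<Lambda>: "\<And>x. (\<Lambda> has_real_derivative boundary_form x) (at x)"
    using continuous_has_primitive[OF continuous_boundary_form] by blast
  have "((\<lambda>x. \<Lambda> (x + 2 * pi) - \<Lambda> x) has_real_derivative 0) (at x)" for x
  proof -
    have "((\<lambda>x. \<Lambda> (x + 2 * pi)) has_real_derivative boundary_form (x + 2 * pi)) (at x)"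
      using \<Lambda>[of "x + 2 * pi"] by (simp add: DERIV_shift)
    from DERIV_diff[OF this \<Lambda>[of x]] show ?thesis by (simp add: boundary_form_periodic)
  qed
  then have const: "\<Lambda> (x + 2 * pi) - \<Lambda> x = \<Lambda> (0 + 2 * pi) - \<Lambda> 0" for x
    using DERIV_isconst_all[of "\<lambda>x. \<Lambda> (x + 2 * pi) - \<Lambda> x"] by blast
  have "(boundary_form has_integral \<Lambda> (2 * pi) - \<Lambda> 0) {0..2 * pi}"
    by (rule fundamental_theorem_of_calculus)
       (use \<Lambda> in \<open>auto simp: has_real_derivative_iff_has_vector_derivative intro: has_vector_derivative_at_within\<close>)
  then have 1: "\<Lambda> (x + 2 * pi) = \<Lambda> x + boundary_period" for x
    using const[of x] by (simp add: boundary_period_def integral_unique)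
  have "\<Lambda> (x + 2 * pi * of_int n) = \<Lambda> x + of_int n * boundary_period" for x n
  proof (induction n rule: int_induct[of _ 0])
    case (step1 i)
    have "x + 2 * pi * of_int (i + 1) = (x + 2 * pi * of_int i) + 2 * pi" by (simp add: algebra_simps)
    then show ?case using 1[of "x + 2 * pi * of_int i"] step1 by (simp add: algebra_simps)
  next
    case (step2 i)
    have "x + 2 * pi * of_int i = (x + 2 * pi * of_int (i - 1)) + 2 * pi" by (simp add: algebra_simps)
    then show ?case using 1[of "x + 2 * pi * of_int (i - 1)"] step2 by (simp add: algebra_simps)
  qed simp
  with \<Lambda> show ?thesis using that by blast
qed

text \<open>
  In the disk coordinate \<open>u = \<Psi> \<circ> \<gamma>\<close> the norm of \<open>u\<close> is maximal at \<open>t\<close>, so the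
  velocity of \<open>u\<close> there is orthogonal to \<open>u\<close>.
\<close>

lemma velocity_at_boundary:
  assumes d: "d > 0" "\<And>s. \<bar>s - t\<bar> < d \<Longrightarrow> \<gamma> s \<in> D"
    and \<gamma>t: "\<Psi> (\<gamma> t) = polar 1 \<theta>" and v: "(\<gamma> has_vector_derivative v) (at t)"
  shows "v = dp_dq (polar 1 \<theta>) (fd \<Psi> (\<gamma> t) v) *\<^sub>R boundary_tangent \<theta>"
    and "((\<lambda>s. \<Psi> (\<gamma> s)) has_vector_derivative fd \<Psi> (\<gamma> t) v) (at t)"
proof -
  let ?u = "\<lambda>s. \<Psi> (\<gamma> s)" and ?w = "fd \<Psi> (\<gamma> t) v"
  have tD: "\<gamma> t \<in> D" using d by simp
  show u: "(?u has_vector_derivative ?w) (at t)"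
  proof -
    have "(?u has_derivative (\<lambda>h. fd \<Psi> (\<gamma> t) (h *\<^sub>R v))) (at t)"
      using has_derivative_compose[OF v[unfolded has_vector_derivative_def] has_derivative_Psi[OF tD]] .
    then show ?thesis
      unfolding has_vector_derivative_def linear_cmul[OF linear_fd_Psi[OF tD]] .
  qed
  have "((\<lambda>s. ?u s \<bullet> ?u s) has_real_derivative ?u t \<bullet> ?w + ?w \<bullet> ?u t) (at t)"
    unfolding has_real_derivative_iff_has_vector_derivative
    by (rule bounded_bilinear.has_vector_derivative[OF bounded_bilinear_inner u u])
  then have "?u t \<bullet> ?w + ?w \<bullet> ?u t = 0"
  proof (rule DERIV_local_max[OF _ d(1)], intro allI impI)
    fix s assume "\<bar>t - s\<bar> < d"
    then have "norm (?u s) \<le> 1" using d(2)[of s] Psi_in[of "\<gamma> s"] by simp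
    moreover have "norm (?u t) = 1" by (simp add: \<gamma>t norm_polar)
    ultimately show "?u s \<bullet> ?u s \<le> ?u t \<bullet> ?u t"
      by (simp add: dot_square_norm power_le_one)
  qed
  then have orth: "cos \<theta> * fst ?w + sin \<theta> * snd ?w = 0"
    unfolding \<gamma>t by (simp add: polar_def inner_prod_def algebra_simps)
  \<comment> \<open>A vector orthogonal to \<open>polar 1 \<theta>\<close> is a multiple of that
    unit vector rotated by a quarter turn.\<close>
  have w: "?w = dp_dq (polar 1 \<theta>) ?w *\<^sub>R (- sin \<theta>, cos \<theta>)"
  proof (rule prod_eqI)
    have sc: "cos \<theta> * cos \<theta> + sin \<theta> * sin \<theta> = 1" by (rule sin_cos_squared_add3)
    let ?a = "fst ?w" and ?b = "snd ?w"
    have "?a = ?a * (cos \<theta> * cos \<theta> + sin \<theta> * sin \<theta>) - cos \<theta> * (cos \<theta> * ?a + sin \<theta> * ?b)"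
      by (simp only: sc orth; simp)
    also have "\<dots> = fst (dp_dq (polar 1 \<theta>) ?w *\<^sub>R (- sin \<theta>, cos \<theta>))"
      by (simp add: dp_dq_def polar_def algebra_simps del: sin_cos_squared_add3)
    finally show "?a = fst (dp_dq (polar 1 \<theta>) ?w *\<^sub>R (- sin \<theta>, cos \<theta>))" .
    have "?b = ?b * (cos \<theta> * cos \<theta> + sin \<theta> * sin \<theta>) - sin \<theta> * (cos \<theta> * ?a + sin \<theta> * ?b)"
      by (simp only: sc orth; simp)
    also have "\<dots> = snd (dp_dq (polar 1 \<theta>) ?w *\<^sub>R (- sin \<theta>, cos \<theta>))"
      by (simp add: dp_dq_def polar_def algebra_simps del: sin_cos_squared_add3)
    finally show "?b = snd (dp_dq (polar 1 \<theta>) ?w *\<^sub>R (- sin \<theta>, cos \<theta>))" .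
  qed
  have c: "polar 1 \<theta> \<in> cball 0 1" by (rule polar_1_in_cball)
  have "((\<lambda>s. \<Phi> (?u s)) has_vector_derivative fd \<Phi> (polar 1 \<theta>) ?w) (at t)"
  proof -
    have "((\<lambda>s. \<Phi> (?u s)) has_derivative (\<lambda>h. fd \<Phi> (polar 1 \<theta>) (h *\<^sub>R ?w))) (at t)"
      using has_derivative_compose[OF u[unfolded has_vector_derivative_def], of \<Phi> "fd \<Phi> (polar 1 \<theta>)"]
        has_derivative_Phi[OF c] \<gamma>t by simp
    then show ?thesis unfolding has_vector_derivative_def linear_cmul[OF linear_fd_Phi[OF c]] .
  qed
  \<comment> \<open>Near \<open>t\<close> the curve is
    \<open>\<Phi> \<circ> \<Psi> \<circ> \<gamma>\<close>, so its velocity is the image of the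
    tangential vector \<open>?w\<close>.\<close>
  then have "(\<gamma> has_vector_derivative fd \<Phi> (polar 1 \<theta>) ?w) (at t)"
    unfolding has_vector_derivative_def
    by (rule has_derivative_transform_within[OF _ d(1)]) (use d(2) Phi_Psi in \<open>auto simp: dist_real_def\<close>)
  then have "v = fd \<Phi> (polar 1 \<theta>) ?w" by (rule vector_derivative_unique_at[OF v])
  also have "\<dots> = fd \<Phi> (polar 1 \<theta>) (dp_dq (polar 1 \<theta>) ?w *\<^sub>R (- sin \<theta>, cos \<theta>))" using w by simp
  also have "\<dots> = dp_dq (polar 1 \<theta>) ?w *\<^sub>R boundary_tangent \<theta>"
    unfolding boundary_tangent_def by (rule linear_cmul[OF linear_fd_Phi[OF c]])
  finally show "v = dp_dq (polar 1 \<theta>) ?w *\<^sub>R boundary_tangent \<theta>" .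
qed

text \<open>At boundary points only the derivative within \<open>D\<close> is given; since the
  boundary curve stays in \<open>D\<close>, the chain rule still applies along it.\<close>

lemma constant_on_frontier:
  fixes f :: "plane \<Rightarrow> real"
  assumes der: "\<And>z. z \<in> frontier D \<Longrightarrow> (f has_derivative f' z) (at z within D)"
    and zero: "\<And>\<theta>. f' (boundary_curve \<theta>) (boundary_tangent \<theta>) = 0"
  obtains c where "\<And>z. z \<in> frontier D \<Longrightarrow> f z = c"
proof -
  have fr: "boundary_curve \<theta> \<in> frontier D" for \<theta> using range_boundary_curve by blast
  have "((\<lambda>\<theta>. f (boundary_curve \<theta>)) has_real_derivative 0) (at \<theta>)" for \<theta>
  proof -
    have "range boundary_curve \<subseteq> D" using range_boundary_curve frontier_subset_D by blast
    then have "(f has_derivative f' (boundary_curve \<theta>)) (at (boundary_curve \<theta>) within range boundary_curve)"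
      using has_derivative_subset[OF der[OF fr]] by blast
    from has_derivative_in_compose[OF has_vector_derivative_boundary_curve[unfolded has_vector_derivative_def] this]
    have "((\<lambda>\<theta>. f (boundary_curve \<theta>)) has_derivative (\<lambda>h. f' (boundary_curve \<theta>) (h *\<^sub>R boundary_tangent \<theta>))) (at \<theta>)" .
    moreover have "(\<lambda>h. f' (boundary_curve \<theta>) (h *\<^sub>R boundary_tangent \<theta>)) = (*) 0"
      using linear_cmul[OF has_derivative_linear[OF der[OF fr]]] zero by auto
    ultimately show ?thesis by (simp only: has_field_derivative_def)
  qed
  then have "f (boundary_curve \<theta>) = f (boundary_curve 0)" for \<theta>
    using DERIV_isconst_all[of "\<lambda>\<theta>. f (boundary_curve \<theta>)"] by blast
  then show ?thesis using that range_boundary_curve by (metis imageE)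
qed

text \<open>If \<open>\<theta>\<close> is a continuous angle of
  \<open>\<Psi> \<circ> \<gamma>\<close>, then \<open>\<Lambda> \<circ> \<theta>\<close> is an
  antiderivative of the integrand, because \<open>\<gamma>'\<close> is the angular speed times the
  boundary tangent.\<close>

lemma boundary_curve_action:
  assumes \<Lambda>: "\<And>x. (\<Lambda> has_real_derivative boundary_form x) (at x)"
    and T: "0 \<le> T" and E: "finite E" and cont: "continuous_on {0..T} \<gamma>"
    and fr: "\<And>t. t \<in> {0..T} \<Longrightarrow> \<gamma> t \<in> frontier D"
    and der: "\<And>t. t \<in> {0<..<T} - E \<Longrightarrow> (\<gamma> has_vector_derivative \<gamma>' t) (at t)"
  obtains a b where "\<Psi> (\<gamma> 0) = polar 1 a" "\<Psi> (\<gamma> T) = polar 1 b"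
    "((\<lambda>t. dp_dq (\<gamma> t) (\<gamma>' t) / 2) has_integral \<Lambda> b - \<Lambda> a) {0..T}"
proof -
  let ?u = "\<lambda>t. \<Psi> (\<gamma> t)"
  have u1: "norm (?u t) = 1" if "t \<in> {0..T}" for t
  proof -
    have "\<gamma> t \<in> \<Phi> ` sphere 0 1" using fr[OF that] frontier_D by simp
    then obtain x where "x \<in> sphere 0 1" "\<gamma> t = \<Phi> x" by blast
    then show ?thesis using Psi_Phi[of x] by simp
  qed
  have contu: "continuous_on {0..T} ?u"
    by (rule continuous_on_compose2[OF smooth_open_continuous[OF smooth_Psi] cont])
       (use fr frontier_subset_D D_V in blast)
  obtain \<theta> where \<theta>: "continuous_on {0..T} \<theta>" "\<And>t. t \<in> {0..T} \<Longrightarrow> ?u t = polar 1 (\<theta> t)"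
    "\<And>t u'. t \<in> {0<..<T} \<Longrightarrow> (?u has_vector_derivative u') (at t) \<Longrightarrow> (\<theta> has_real_derivative dp_dq (?u t) u') (at t)"
    by (rule circle_lift[OF contu u1]) blast+
  have "((\<lambda>t. dp_dq (\<gamma> t) (\<gamma>' t) / 2) has_integral \<Lambda> (\<theta> T) - \<Lambda> (\<theta> 0)) {0..T}"
  proof (rule fundamental_theorem_of_calculus_interior_strong[OF E T])
    show "continuous_on {0..T} (\<lambda>t. \<Lambda> (\<theta> t))"
    proof (rule continuous_on_compose2[OF _ \<theta>(1)])
      show "continuous_on UNIV \<Lambda>"
        using \<Lambda> DERIV_isCont by (blast intro: continuous_at_imp_continuous_on)
    qed simp
    fix t assume t: "t \<in> {0<..<T} - E"
    then have tT: "t \<in> {0..T}" "t \<in> {0<..<T}" by auto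
    have d: "0 < min t (T - t)" "\<And>s. \<bar>s - t\<bar> < min t (T - t) \<Longrightarrow> \<gamma> s \<in> D"
      using t fr frontier_subset_D by (auto simp: abs_less_iff)
    let ?w = "fd \<Psi> (\<gamma> t) (\<gamma>' t)"
    note vel = velocity_at_boundary[OF d \<theta>(2)[OF tT(1)] der[OF t]]
    have "(\<theta> has_real_derivative dp_dq (polar 1 (\<theta> t)) ?w) (at t)"
      using \<theta>(3)[OF tT(2) vel(2)] \<theta>(2)[OF tT(1)] by simp
    from DERIV_chain2[OF \<Lambda> this]
    have D: "((\<lambda>t. \<Lambda> (\<theta> t)) has_real_derivative boundary_form (\<theta> t) * dp_dq (polar 1 (\<theta> t)) ?w) (at t)" .
    have \<gamma>: "\<gamma> t = boundary_curve (\<theta> t)"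
      unfolding boundary_curve_def \<theta>(2)[OF tT(1), symmetric]
      using Phi_Psi[of "\<gamma> t"] fr[OF tT(1)] frontier_subset_D by auto
    have "boundary_form (\<theta> t) * dp_dq (polar 1 (\<theta> t)) ?w
      = dp_dq (\<gamma> t) (dp_dq (polar 1 (\<theta> t)) ?w *\<^sub>R boundary_tangent (\<theta> t)) / 2"
      by (simp add: boundary_form_def \<gamma> bounded_bilinear.scaleR_right[OF bounded_bilinear_dp_dq])
    also have "\<dots> = dp_dq (\<gamma> t) (\<gamma>' t) / 2" by (simp only: vel(1)[symmetric])
    finally show "((\<lambda>t. \<Lambda> (\<theta> t)) has_vector_derivative dp_dq (\<gamma> t) (\<gamma>' t) / 2) (at t)"
      using D by (simp only: has_real_derivative_iff_has_vector_derivative)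
  qed
  then show ?thesis using that[of "\<theta> 0" "\<theta> T"] \<theta>(2) T by auto
qed

text \<open>Equal end points have angles that differ by whole turns, and \<open>\<Lambda>\<close>
  converts each turn into one period.\<close>

lemma boundary_actions_difference:
  assumes T: "0 \<le> T" and E: "finite E"
    and cont: "continuous_on {0..T} \<gamma>\<^sub>1" "continuous_on {0..T} \<gamma>\<^sub>2"
    and fr: "\<And>t. t \<in> {0..T} \<Longrightarrow> \<gamma>\<^sub>1 t \<in> frontier D" "\<And>t. t \<in> {0..T} \<Longrightarrow> \<gamma>\<^sub>2 t \<in> frontier D"
    and der: "\<And>t. t \<in> {0<..<T} - E \<Longrightarrow> (\<gamma>\<^sub>1 has_vector_derivative \<gamma>\<^sub>1' t) (at t)"
      "\<And>t. t \<in> {0<..<T} - E \<Longrightarrow> (\<gamma>\<^sub>2 has_vector_derivative \<gamma>\<^sub>2' t) (at t)"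
    and ends: "\<gamma>\<^sub>1 0 = \<gamma>\<^sub>2 0" "\<gamma>\<^sub>1 T = \<gamma>\<^sub>2 T"
  obtains n :: int where
    "integral {0..T} (\<lambda>t. dp_dq (\<gamma>\<^sub>1 t) (\<gamma>\<^sub>1' t) / 2) - integral {0..T} (\<lambda>t. dp_dq (\<gamma>\<^sub>2 t) (\<gamma>\<^sub>2' t) / 2)
      = of_int n * boundary_period"
proof -
  obtain \<Lambda> where \<Lambda>: "\<And>x. (\<Lambda> has_real_derivative boundary_form x) (at x)"
    "\<And>x n. \<Lambda> (x + 2 * pi * of_int n) = \<Lambda> x + of_int n * boundary_period"
    using boundary_primitive by metis
  obtain a1 b1 where 1: "\<Psi> (\<gamma>\<^sub>1 0) = polar 1 a1" "\<Psi> (\<gamma>\<^sub>1 T) = polar 1 b1"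
    "((\<lambda>t. dp_dq (\<gamma>\<^sub>1 t) (\<gamma>\<^sub>1' t) / 2) has_integral \<Lambda> b1 - \<Lambda> a1) {0..T}"
    using boundary_curve_action[OF \<Lambda>(1) T E cont(1) fr(1) der(1)] .
  obtain a2 b2 where 2: "\<Psi> (\<gamma>\<^sub>2 0) = polar 1 a2" "\<Psi> (\<gamma>\<^sub>2 T) = polar 1 b2"
    "((\<lambda>t. dp_dq (\<gamma>\<^sub>2 t) (\<gamma>\<^sub>2' t) / 2) has_integral \<Lambda> b2 - \<Lambda> a2) {0..T}"
    using boundary_curve_action[OF \<Lambda>(1) T E cont(2) fr(2) der(2)] .
  obtain m n :: int where mn: "a1 = a2 + 2 * pi * m" "b1 = b2 + 2 * pi * n"
    using polar_eq_iff[of 1 1 a1 a2] polar_eq_iff[of 1 1 b1 b2] 1(1,2) 2(1,2) ends by auto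
  have "(\<Lambda> b1 - \<Lambda> a1) - (\<Lambda> b2 - \<Lambda> a2) = of_int (n - m) * boundary_period"
    unfolding mn \<Lambda>(2) by (simp add: algebra_simps)
  then show ?thesis using that 1(3) 2(3) integral_unique by metis
qed

end

section \<open>Hamiltonian flows on a disk\<close>

lemma dp_dq_expand:
  assumes "dp_dq a b = 1"
  shows "v = dp_dq v b *\<^sub>R a - dp_dq v a *\<^sub>R b"
proof (rule prod_eqI)
  have 1: "fst a * snd b - snd a * fst b = 1" using assms by (simp add: dp_dq_def)
  have "fst v = fst v * (fst a * snd b - snd a * fst b)" by (simp only: 1 mult_1_right)
  then show "fst v = fst (dp_dq v b *\<^sub>R a - dp_dq v a *\<^sub>R b)"
    by (simp add: dp_dq_def algebra_simps)
  have "snd v = snd v * (fst a * snd b - snd a * fst b)" by (simp only: 1 mult_1_right)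
  then show "snd v = snd (dp_dq v b *\<^sub>R a - dp_dq v a *\<^sub>R b)"
    by (simp add: dp_dq_def algebra_simps)
qed

text \<open>
  A map that preserves the areas of small triangles up to third order is differentiable: the
  estimate, applied to triangles of very different side lengths, determines the components of
  \<open>G w - G z\<close> with respect to limits \<open>Y\<^sub>1, Y\<^sub>2\<close> of difference quotients.
\<close>

lemma area_estimate_imp_derivative:
  fixes G :: "plane \<Rightarrow> plane"
  assumes z: "z \<in> interior D"
    and lip: "\<And>w. w \<in> D \<Longrightarrow> norm (G w - G z) \<le> M * norm (w - z)"
    and area: "\<And>w1 w2. w1 \<in> D \<Longrightarrow> w2 \<in> D \<Longrightarrow>
      \<bar>dp_dq (G w1 - G z) (G w2 - G z) - dp_dq (w1 - z) (w2 - z)\<bar>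
        \<le> K * norm (w1 - z) * norm (w2 - z) * (norm (w1 - z) + norm (w2 - z))"
  obtains Y1 Y2 where "dp_dq Y1 Y2 = 1"
    "(G has_derivative (\<lambda>v. fst v *\<^sub>R Y1 + snd v *\<^sub>R Y2)) (at z)"
proof -
  interpret bounded_bilinear dp_dq by (rule bounded_bilinear_dp_dq)
  obtain r where r: "r > 0" "ball z r \<subseteq> D" using z mem_interior by blast
  define e1 e2 where "e1 = (1 :: real, 0 :: real)" and "e2 = (0 :: real, 1 :: real)"
  have ne: "norm e1 = 1" "norm e2 = 1" by (simp_all add: e1_def e2_def)
  define h where "h n = r / 2 * (1 / real (Suc n))" for n
  have h: "h n > 0" "h n < r" for n
  proof -
    show "h n > 0" using r by (simp add: h_def)
    have "r / 2 * (1 / real (Suc n)) \<le> r / 2 * 1" using r by (intro mult_left_mono) auto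
    then show "h n < r" using r unfolding h_def by linarith
  qed
  have hlim: "h \<longlonglongrightarrow> 0"
    using tendsto_mult_right_zero[OF LIMSEQ_Suc[OF lim_1_over_n], of "r / 2"] unfolding h_def[abs_def] .
  \<comment> \<open>Difference quotients along the axes; the Lipschitz bound keeps them in a compact
    ball, so along a subsequence they converge to \<open>Y1\<close> and \<open>Y2\<close>.\<close>
  define y where "y e n = (1 / h n) *\<^sub>R (G (z + h n *\<^sub>R e) - G z)" for e n
  have inD: "z + h n *\<^sub>R e \<in> D" if "norm e = 1" for e n
    by (rule subsetD[OF r(2)]) (use h[of n] that in \<open>simp add: dist_norm\<close>)
  have y_area: "\<bar>dp_dq (G w - G z) (y e n) - dp_dq (w - z) e\<bar> \<le> K * norm (w - z) * (norm (w - z) + h n)"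
    if w: "w \<in> D" and e: "norm e = 1" for w e n
  proof -
    let ?q = "dp_dq (G w - G z) (G (z + h n *\<^sub>R e) - G z) - dp_dq (w - z) (h n *\<^sub>R e)"
    have "\<bar>?q\<bar>
        \<le> K * norm (w - z) * h n * (norm (w - z) + h n)"
      using area[OF w inD[OF e, of n]] e h(1)[of n] by simp
    then have "(1 / h n) * \<bar>?q\<bar>
        \<le> (1 / h n) * (K * norm (w - z) * h n * (norm (w - z) + h n))"
      using h(1)[of n] by (intro mult_left_mono) auto
    also have "(1 / h n) * \<bar>?q\<bar>
        = \<bar>(1 / h n) * (?q)\<bar>"
      using h(1)[of n] by (simp add: abs_mult)
    also have "(1 / h n) * (?q)
        = dp_dq (G w - G z) (y e n) - dp_dq (w - z) e"
      using h(1)[of n] by (simp add: y_def scaleR_right right_diff_distrib)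
    also have "(1 / h n) * (K * norm (w - z) * h n * (norm (w - z) + h n)) = K * norm (w - z) * (norm (w - z) + h n)"
      using h(1)[of n] by simp
    finally show ?thesis .
  qed
  have y_bound: "norm (y e n) \<le> M" if e: "norm e = 1" for e n
  proof -
    have "norm (G (z + h n *\<^sub>R e) - G z) \<le> M * h n"
      using lip[OF inD[OF e, of n]] e h(1)[of n] by simp
    then have "norm (G (z + h n *\<^sub>R e) - G z) / h n \<le> M" using h(1)[of n] by (simp add: divide_le_eq)
    then show ?thesis using h(1)[of n] by (simp add: y_def)
  qed
  have "compact (cball (0 :: plane) M \<times> cball (0 :: plane) M)"
    by (intro compact_Times compact_cball)
  moreover have "\<forall>n. (y e1 n, y e2 n) \<in> cball 0 M \<times> cball 0 M"
    using y_bound[OF ne(1)] y_bound[OF ne(2)] by simp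
  ultimately obtain Y s where Y: "strict_mono (s :: nat \<Rightarrow> nat)"
    "((\<lambda>n. (y e1 n, y e2 n)) \<circ> s) \<longlonglongrightarrow> Y"
    unfolding compact_def by metis
  define Y1 Y2 where "Y1 = fst Y" and "Y2 = snd Y"
  have Ylim: "(\<lambda>n. y e1 (s n)) \<longlonglongrightarrow> Y1" "(\<lambda>n. y e2 (s n)) \<longlonglongrightarrow> Y2"
    using tendsto_fst[OF Y(2)] tendsto_snd[OF Y(2)] by (simp_all add: Y1_def Y2_def o_def)
  have hs: "(\<lambda>n. h (s n)) \<longlonglongrightarrow> 0"
    using LIMSEQ_subseq_LIMSEQ[OF hlim Y(1)] by (simp add: o_def)
  \<comment> \<open>One side of the triangle shrinks to zero while \<open>w\<close> stays fixed;
    after division by its length the error is quadratic in \<open>norm (w - z)\<close>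
    alone.\<close>
  have est: "\<bar>dp_dq (G w - G z) Z - dp_dq (w - z) e\<bar> \<le> K * norm (w - z) * (norm (w - z) + 0)"
    if w: "w \<in> D" and e: "norm e = 1" and Z: "(\<lambda>n. y e (s n)) \<longlonglongrightarrow> Z" for w e Z
  proof (rule LIMSEQ_le)
    show "(\<lambda>n. \<bar>dp_dq (G w - G z) (y e (s n)) - dp_dq (w - z) e\<bar>) \<longlonglongrightarrow> \<bar>dp_dq (G w - G z) Z - dp_dq (w - z) e\<bar>"
      by (intro tendsto_intros tendsto Z)
    show "(\<lambda>n. K * norm (w - z) * (norm (w - z) + h (s n))) \<longlonglongrightarrow> K * norm (w - z) * (norm (w - z) + 0)"
      by (intro tendsto_intros hs)
  qed (use y_area[OF w e] in blast)
  \<comment> \<open>The estimate \<open>est\<close> is applied with \<open>w\<close> on the first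
    axis and divided by \<open>h n\<close> before passing to the limit.\<close>
  have det: "dp_dq Y1 Y2 = 1"
  proof -
    have b: "\<bar>dp_dq (y e1 n) Y2 - 1\<bar> \<le> K * h n" for n
    proof -
      let ?q = "dp_dq (G (z + h n *\<^sub>R e1) - G z) Y2 - h n"
      have "\<bar>?q\<bar> \<le> K * h n * h n"
        using est[OF inD[OF ne(1), of n] ne(2) Ylim(2)] ne h(1)[of n]
        by (simp add: e1_def e2_def dp_dq_def)
      then have "(1 / h n) * \<bar>?q\<bar> \<le> (1 / h n) * (K * h n * h n)"
        using h(1)[of n] by (intro mult_left_mono) auto
      also have "(1 / h n) * \<bar>?q\<bar>
          = \<bar>(1 / h n) * (?q)\<bar>"
        using h(1)[of n] by (simp add: abs_mult)
      also have "(1 / h n) * (?q) = dp_dq (y e1 n) Y2 - 1"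
        using h(1)[of n] by (simp add: y_def scaleR_left right_diff_distrib)
      also have "(1 / h n) * (K * h n * h n) = K * h n" using h(1)[of n] by simp
      finally show ?thesis .
    qed
    have "\<bar>dp_dq Y1 Y2 - 1\<bar> \<le> K * 0"
    proof (rule LIMSEQ_le)
      show "(\<lambda>n. \<bar>dp_dq (y e1 (s n)) Y2 - 1\<bar>) \<longlonglongrightarrow> \<bar>dp_dq Y1 Y2 - 1\<bar>"
        by (intro tendsto_intros tendsto Ylim)
      show "(\<lambda>n. K * h (s n)) \<longlonglongrightarrow> K * 0" by (intro tendsto_intros hs)
    qed (use b in blast)
    then show ?thesis by simp
  qed
  let ?L = "\<lambda>v :: plane. fst v *\<^sub>R Y1 + snd v *\<^sub>R Y2"
  have bl: "bounded_linear ?L"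
    by (intro bounded_linear_add bounded_linear_compose[OF bounded_linear_scaleR_left]
        bounded_linear_fst bounded_linear_snd)
  have rem: "norm (G w - G z - ?L (w - z)) \<le> K * (norm Y1 + norm Y2) * norm (w - z) * norm (w - z)"
    if w: "w \<in> D" for w
  proof -
    let ?a = "dp_dq (G w - G z) Y2 - fst (w - z)" and ?b = "dp_dq (G w - G z) Y1 + snd (w - z)"
    have a: "\<bar>?a\<bar> \<le> K * norm (w - z) * norm (w - z)"
      using est[OF w ne(2) Ylim(2)] by (simp add: e2_def dp_dq_def)
    have b: "\<bar>?b\<bar> \<le> K * norm (w - z) * norm (w - z)"
      using est[OF w ne(1) Ylim(1)] by (simp add: e1_def dp_dq_def)
    \<comment> \<open>The components of \<open>G w - G z\<close> in the basis \<open>Y1\<close>,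
      \<open>Y2\<close> are, up to sign, its values of \<open>dp_dq\<close> against
      \<open>Y2\<close> and \<open>Y1\<close>, which \<open>est\<close> controls.\<close>
    have "G w - G z - ?L (w - z) = ?a *\<^sub>R Y1 - ?b *\<^sub>R Y2"
      by (subst (1) dp_dq_expand[OF det, of "G w - G z"]) (simp add: algebra_simps)
    also have "norm \<dots> \<le> \<bar>?a\<bar> * norm Y1 + \<bar>?b\<bar> * norm Y2"
      using norm_triangle_ineq4[of "?a *\<^sub>R Y1" "?b *\<^sub>R Y2"] by simp
    also have "\<dots> \<le> K * norm (w - z) * norm (w - z) * norm Y1 + K * norm (w - z) * norm (w - z) * norm Y2"
      using a b by (intro add_mono mult_right_mono) auto
    finally show ?thesis by (simp add: algebra_simps)
  qed
  have "(G has_derivative ?L) (at z)"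
  proof (rule has_derivativeI_sandwich[OF r(1) bl])
    fix w assume w: "w \<noteq> z" "dist w z < r"
    have wD: "w \<in> D" using w(2) r(2) by (auto simp: dist_commute)
    have "norm (G w - G z - ?L (w - z)) / norm (w - z) \<le> K * (norm Y1 + norm Y2) * norm (w - z) * norm (w - z) / norm (w - z)"
      using rem[OF wD] by (intro divide_right_mono) auto
    then show "norm (G w - G z - ?L (w - z)) / norm (w - z) \<le> K * (norm Y1 + norm Y2) * norm (w - z)"
      using w(1) by simp
  next
    have "((\<lambda>w. K * (norm Y1 + norm Y2) * norm (w - z)) \<longlongrightarrow> K * (norm Y1 + norm Y2) * norm (z - z)) (at z)"
      by (intro tendsto_intros)
    then show "((\<lambda>w. K * (norm Y1 + norm Y2) * norm (w - z)) \<longlongrightarrow> 0) (at z)" by simp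
  qed
  then show ?thesis using that det by blast
qed

section \<open>The Hamiltonian between jump times\<close>

locale disk_system = plane_disk D U V \<Phi> \<Psi>
  for D U V :: "plane set" and \<Phi> \<Psi> :: "plane \<Rightarrow> plane" +
  fixes J :: "real set" and H :: "plane \<Rightarrow> real \<Rightarrow> real" and g :: "real \<Rightarrow> plane \<Rightarrow> plane"
  assumes hamiltonian: "is_hamiltonian D J H"
    and flow: "is_ham_flow D J H g"
    and flow_image: "\<And>t. g t ` D = D"
begin

abbreviation X :: "real \<Rightarrow> plane \<Rightarrow> plane" where
  "X t z \<equiv> ham_field D (\<lambda>w. H w t) z"

definition jumps :: "real set" where "jumps = J \<inter> {0..2 * pi}"

text \<open>Leaving out the end points makes the set open. Estimates in time are stated on this set,
  since values of the Hamiltonian at jump times are arbitrary.\<close>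

definition regular :: "real set" where "regular = {0<..<2 * pi} - jumps"

lemma finite_jumps: "finite jumps"
proof (rule finite_subset)
  show "jumps \<subseteq> (J \<inter> {0..<2 * pi}) \<union> {2 * pi}" by (auto simp: jumps_def)
  show "finite ((J \<inter> {0..<2 * pi}) \<union> {2 * pi})"
    using hamiltonian by (simp add: is_hamiltonian_def)
qed

lemma regular_not_J: "t \<in> regular \<Longrightarrow> t \<notin> J"
  by (auto simp: regular_def jumps_def)

lemma open_regular: "open regular"
  unfolding regular_def by (intro open_Diff finite_imp_closed finite_jumps) simp

text \<open>Pairs of neighbouring division points. There are finitely many, so bounds obtained piece
  by piece combine into one.\<close>

definition pieces :: "plane set" where
  "pieces = {(a, b). a \<in> insert 0 (insert (2 * pi) jumps) \<and> b \<in> insert 0 (insert (2 * pi) jumps) \<and>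
     a < b \<and> {a<..<b} \<inter> J = {}}"

lemma finite_pieces: "finite pieces"
proof (rule finite_subset)
  show "pieces \<subseteq> insert 0 (insert (2 * pi) jumps) \<times> insert 0 (insert (2 * pi) jumps)"
    by (auto simp: pieces_def)
qed (use finite_jumps in simp)

lemma regular_piece:
  assumes t: "t \<in> regular"
  obtains a b where "(a, b) \<in> pieces" "a < t" "t < b" "{a<..<b} \<subseteq> regular"
proof -
  let ?P = "insert 0 (insert (2 * pi) jumps)"
  have fin: "finite ?P" using finite_jumps by simp
  have P: "?P \<subseteq> {0..2 * pi}" by (auto simp: jumps_def)
  have t02: "0 < t" "t < 2 * pi" "t \<notin> jumps" using t by (auto simp: regular_def)
  \<comment> \<open>The nearest division points on both sides of \<open>t\<close>; \<open>0\<close>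
    and \<open>2 * pi\<close> make the two sets nonempty.\<close>
  define a where "a = Max {p \<in> ?P. p < t}"
  define b where "b = Min {p \<in> ?P. t < p}"
  have fa: "finite {p \<in> ?P. p < t}" "0 \<in> {p \<in> ?P. p < t}" using fin t02 by auto
  have fb: "finite {p \<in> ?P. t < p}" "2 * pi \<in> {p \<in> ?P. t < p}" using fin t02 by auto
  have a: "a \<in> {p \<in> ?P. p < t}" unfolding a_def by (rule Max_in) (use fa in auto)
  have b: "b \<in> {p \<in> ?P. t < p}" unfolding b_def by (rule Min_in) (use fb in auto)
  have a': "p \<le> a" if "p \<in> ?P" "p < t" for p
    unfolding a_def by (rule Max_ge) (use fa that in auto)
  have b': "b \<le> p" if "p \<in> ?P" "t < p" for p
    unfolding b_def by (rule Min_le) (use fb that in auto)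
  have noP: "s \<notin> ?P" if s: "a < s" "s < b" for s
  proof
    assume sP: "s \<in> ?P"
    show False
    proof (rule linorder_cases[of s t])
      assume "s < t" then show False using a'[OF sP] s by simp
    next
      assume "s = t" then show False using sP t02 by simp
    next
      assume "t < s" then show False using b'[OF sP] s by simp
    qed
  qed
  have ab: "0 \<le> a" "b \<le> 2 * pi" using a b P by auto
  have noJ: "{a<..<b} \<inter> J = {}"
  proof (rule ccontr)
    assume "{a<..<b} \<inter> J \<noteq> {}"
    then obtain s where s: "a < s" "s < b" "s \<in> J" by auto
    then have "s \<in> jumps" using ab by (simp add: jumps_def)
    then show False using noP[OF s(1,2)] by simp
  qed
  show ?thesis
  proof (rule that)
    show "(a, b) \<in> pieces" using a b noJ by (simp add: pieces_def)
    show "{a<..<b} \<subseteq> regular"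
      using ab noP by (auto simp: regular_def)
  qed (use a b in auto)
qed

definition partial_p :: "(plane \<times> real \<Rightarrow> real) \<Rightarrow> plane \<times> real \<Rightarrow> real" where
  "partial_p G x = fd G x ((1, 0), 0)"

definition partial_q :: "(plane \<times> real \<Rightarrow> real) \<Rightarrow> plane \<times> real \<Rightarrow> real" where
  "partial_q G x = fd G x ((0, 1), 0)"

lemma fd_space:
  assumes "smooth_open W G" "x \<in> W"
  shows "fd G x (v, 0) = fst v * partial_p G x + snd v * partial_q G x"
proof -
  have lin: "linear (fd G x)" using smooth_open_linear[OF assms] by (rule bounded_linear.linear)
  have "fd G x (v, 0) = fd G x (fst v *\<^sub>R ((1, 0), 0) + snd v *\<^sub>R ((0, 1), 0))"
    by (cases v) simp
  then show ?thesis
    by (simp only: linear_add[OF lin] linear_cmul[OF lin] partial_p_def partial_q_def real_scaleR_def)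
qed

text \<open>\<open>G\<close> is smooth near the compact product with the closed time interval, which
  gives uniform bounds, but it is tied to \<open>H\<close> only on the open interval, as the value
  of \<open>H\<close> at a jump time is arbitrary.\<close>

definition extends_H ::
  "real \<Rightarrow> real \<Rightarrow> (plane \<times> real) set \<Rightarrow> (plane \<times> real \<Rightarrow> real) \<Rightarrow> bool" where
  "extends_H a b W G \<longleftrightarrow> smooth_open W G \<and> D \<times> {a..b} \<subseteq> W \<and>
     (\<forall>z\<in>D. \<forall>t\<in>{a<..<b}. G (z, t) = H z t \<and>
        ((\<lambda>w. H w t) has_derivative (\<lambda>v. fd G (z, t) (v, 0))) (at z within D) \<and>
        X t z = (- partial_q G (z, t), partial_p G (z, t)))"

lemma extends_HD:
  assumes "extends_H a b W G"
  shows "smooth_open W G" "D \<times> {a..b} \<subseteq> W"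
    and "z \<in> D \<Longrightarrow> t \<in> {a<..<b} \<Longrightarrow> G (z, t) = H z t"
    and "z \<in> D \<Longrightarrow> t \<in> {a<..<b} \<Longrightarrow>
       ((\<lambda>w. H w t) has_derivative (\<lambda>v. fd G (z, t) (v, 0))) (at z within D)"
    and "z \<in> D \<Longrightarrow> t \<in> {a<..<b} \<Longrightarrow> X t z = (- partial_q G (z, t), partial_p G (z, t))"
  using assms unfolding extends_H_def by blast+

lemma smooth_piece:
  assumes "(a, b) \<in> pieces"
  obtains W G where "extends_H a b W G"
proof -
  have ab: "a < b \<and> {a<..<b} \<inter> J = {}" using assms by (simp add: pieces_def)
  then obtain F where F: "smooth_on (D \<times> {a..b}) F" "\<forall>z\<in>D. \<forall>t\<in>{a<..<b}. F (z, t) = H z t"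
    using hamiltonian unfolding is_hamiltonian_def by metis
  obtain W G where W: "open W" "D \<times> {a..b} \<subseteq> W" "\<forall>k. Ck_on k W G" "\<forall>x\<in>D \<times> {a..b}. G x = F x"
    using F(1) unfolding smooth_on_def by metis
  have s: "smooth_open W G" using W by (simp add: smooth_open_def)
  have eq: "G (z, t) = H z t" if "z \<in> D" "t \<in> {a<..<b}" for z t
    using W(4) F(2) that by auto
  have der: "((\<lambda>w. H w t) has_derivative (\<lambda>v. fd G (z, t) (v, 0))) (at z within D)"
    if zt: "z \<in> D" "t \<in> {a<..<b}" for z t
  proof -
    have "(z, t) \<in> W" using zt W(2) by auto
    have "((\<lambda>w. (w, t)) has_derivative (\<lambda>v. (v, 0))) (at z within D)"
      by (intro has_derivative_Pair has_derivative_ident has_derivative_const)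
    from has_derivative_compose[OF this smooth_open_derivative[OF s \<open>(z, t) \<in> W\<close>]]
    have "((\<lambda>w. G (w, t)) has_derivative (\<lambda>v. fd G (z, t) (v, 0))) (at z within D)" .
    then show ?thesis
      by (rule has_derivative_transform[OF zt(1), rotated]) (use eq zt in auto)
  qed
  have X: "X t z = (- partial_q G (z, t), partial_p G (z, t))" if zt: "z \<in> D" "t \<in> {a<..<b}" for z t
    unfolding ham_field_def frechet_derivative_within_D[OF zt(1) der[OF zt]] partial_p_def partial_q_def ..
  show ?thesis using that[of W G] s W(2) eq der X unfolding extends_H_def by blast
qed

text \<open>Hamilton's equations in the form \<open>dH = \<omega>(\<cdot>, X)\<close>.\<close>

lemma has_derivative_H:
  assumes z: "z \<in> D" and t: "t \<in> regular"
  shows "((\<lambda>w. H w t) has_derivative (\<lambda>v. dp_dq v (X t z))) (at z within D)"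
proof -
  obtain a b where ab: "(a, b) \<in> pieces" "a < t" "t < b" by (rule regular_piece[OF t])
  obtain W G where "extends_H a b W G" by (rule smooth_piece[OF ab(1)])
  note W = extends_HD[OF this]
  have tab: "t \<in> {a<..<b}" using ab by simp
  have "(z, t) \<in> W" using W(2) z ab by auto
  then have "fd G (z, t) (v, 0) = dp_dq v (X t z)" for v
    using fd_space[OF W(1)] W(5)[OF z tab] by (simp add: dp_dq_def)
  then show ?thesis using W(4)[OF z tab] by simp
qed

text \<open>The last clause is the quantitative form of \<open>X\<close> being divergence free: its
  linear part is traceless, so the terms of second order in the two differences cancel and the error
  is of third order. The quadratic estimate for \<open>H\<close> is its Taylor formula, with the
  derivative expressed by \<open>X\<close>.\<close>

definition bounds_at :: "real \<Rightarrow> real \<Rightarrow> bool" where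
  "bounds_at C t \<longleftrightarrow>
     (\<forall>z\<in>D. \<bar>H z t\<bar> \<le> C \<and> norm (X t z) \<le> C) \<and>
     (\<forall>z\<in>D. \<forall>w\<in>D. \<bar>H w t - H z t\<bar> \<le> C * norm (w - z) \<and> norm (X t w - X t z) \<le> C * norm (w - z) \<and>
        \<bar>H w t - H z t - dp_dq (w - z) (X t z)\<bar> \<le> C * (norm (w - z))\<^sup>2) \<and>
     (\<forall>z\<in>D. \<forall>w1\<in>D. \<forall>w2\<in>D. \<bar>dp_dq (X t w1 - X t z) (w2 - z) + dp_dq (w1 - z) (X t w2 - X t z)\<bar>
        \<le> C * norm (w1 - z) * norm (w2 - z) * (norm (w1 - z) + norm (w2 - z)))"

lemma bounds_atD:
  assumes "bounds_at C t" "z \<in> D"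
  shows "\<bar>H z t\<bar> \<le> C" "norm (X t z) \<le> C"
    and "w \<in> D \<Longrightarrow> \<bar>H w t - H z t\<bar> \<le> C * norm (w - z)"
    and "w \<in> D \<Longrightarrow> norm (X t w - X t z) \<le> C * norm (w - z)"
    and "w \<in> D \<Longrightarrow> \<bar>H w t - H z t - dp_dq (w - z) (X t z)\<bar> \<le> C * (norm (w - z))\<^sup>2"
    and "w1 \<in> D \<Longrightarrow> w2 \<in> D \<Longrightarrow>
      \<bar>dp_dq (X t w1 - X t z) (w2 - z) + dp_dq (w1 - z) (X t w2 - X t z)\<bar>
        \<le> C * norm (w1 - z) * norm (w2 - z) * (norm (w1 - z) + norm (w2 - z))"
  using assms unfolding bounds_at_def by blast+

lemma bounds_at_mono:
  assumes b: "bounds_at C t" and le: "C \<le> C'"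
  shows "bounds_at C' t"
proof -
  have m: "C * x \<le> C' * x" if "0 \<le> x" for x using le that by (rule mult_right_mono)
  show ?thesis
    unfolding bounds_at_def
  proof (intro conjI ballI)
    fix z assume z: "z \<in> D"
    show "\<bar>H z t\<bar> \<le> C'" by (rule order_trans[OF bounds_atD(1)[OF b z] le])
    show "norm (X t z) \<le> C'" by (rule order_trans[OF bounds_atD(2)[OF b z] le])
    fix w assume w: "w \<in> D"
    show "\<bar>H w t - H z t\<bar> \<le> C' * norm (w - z)"
      by (rule order_trans[OF bounds_atD(3)[OF b z w] m]) simp
    show "norm (X t w - X t z) \<le> C' * norm (w - z)"
      by (rule order_trans[OF bounds_atD(4)[OF b z w] m]) simp
    show "\<bar>H w t - H z t - dp_dq (w - z) (X t z)\<bar> \<le> C' * (norm (w - z))\<^sup>2"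
      by (rule order_trans[OF bounds_atD(5)[OF b z w] m]) simp
  next
    fix z w1 w2 assume z: "z \<in> D" "w1 \<in> D" "w2 \<in> D"
    let ?l = "\<bar>dp_dq (X t w1 - X t z) (w2 - z) + dp_dq (w1 - z) (X t w2 - X t z)\<bar>"
    have "?l \<le> C * norm (w1 - z) * norm (w2 - z) * (norm (w1 - z) + norm (w2 - z))"
      by (rule bounds_atD(6)[OF b z])
    also have "\<dots> \<le> C' * norm (w1 - z) * norm (w2 - z) * (norm (w1 - z) + norm (w2 - z))"
      using le by (intro mult_right_mono) auto
    finally show "?l \<le> C' * norm (w1 - z) * norm (w2 - z) * (norm (w1 - z) + norm (w2 - z))" .
  qed
qed

lemma bounds_on_piece:
  assumes "(a, b) \<in> pieces"
  shows "\<exists>C\<ge>0. \<forall>t\<in>{a<..<b}. bounds_at C t"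
proof -
  obtain W G where "extends_H a b W G" by (rule smooth_piece[OF assms])
  note W = extends_HD[OF this]
  let ?K = "D \<times> {a..b}"
  have K: "compact ?K" by (intro compact_Times compact_D) simp
  have sp: "smooth_open W (partial_p G)" and sq: "smooth_open W (partial_q G)"
    unfolding partial_p_def[abs_def] partial_q_def[abs_def] by (intro smooth_open_fd W(1))+
  have c: "continuous_on ?K f" if "smooth_open W f" for f :: "plane \<times> real \<Rightarrow> real"
    using continuous_on_subset[OF smooth_open_continuous[OF that] W(2)] .
  obtain B where B: "B \<ge> 0" "\<And>x. x \<in> ?K \<Longrightarrow> norm (G x) \<le> B"
    using compact_norm_bound[OF K c[OF W(1)]] by blast
  obtain Bp where Bp: "Bp \<ge> 0" "\<And>x. x \<in> ?K \<Longrightarrow> norm (partial_p G x) \<le> Bp"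
    using compact_norm_bound[OF K c[OF sp]] by blast
  obtain Bq where Bq: "Bq \<ge> 0" "\<And>x. x \<in> ?K \<Longrightarrow> norm (partial_q G x) \<le> Bq"
    using compact_norm_bound[OF K c[OF sq]] by blast
  obtain L where L: "L \<ge> 0" "\<And>x y. x \<in> ?K \<Longrightarrow> y \<in> ?K \<Longrightarrow> norm (G y - G x) \<le> L * norm (y - x)"
    using smooth_open_lipschitz_compact[OF W(1) K W(2)] by blast
  obtain Lp where Lp: "Lp \<ge> 0" "\<And>x y. x \<in> ?K \<Longrightarrow> y \<in> ?K \<Longrightarrow> norm (partial_p G y - partial_p G x) \<le> Lp * norm (y - x)"
    using smooth_open_lipschitz_compact[OF sp K W(2)] by blast
  obtain Lq where Lq: "Lq \<ge> 0" "\<And>x y. x \<in> ?K \<Longrightarrow> y \<in> ?K \<Longrightarrow> norm (partial_q G y - partial_q G x) \<le> Lq * norm (y - x)"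
    using smooth_open_lipschitz_compact[OF sq K W(2)] by blast
  obtain R where R: "R \<ge> 0" "\<And>x y. x \<in> ?K \<Longrightarrow> y \<in> ?K \<Longrightarrow> norm (G y - G x - fd G x (y - x)) \<le> R * (norm (y - x))\<^sup>2"
    using smooth_open_taylor_compact[OF W(1) K W(2)] by blast
  obtain Rp where Rp: "Rp \<ge> 0" "\<And>x y. x \<in> ?K \<Longrightarrow> y \<in> ?K \<Longrightarrow> norm (partial_p G y - partial_p G x - fd (partial_p G) x (y - x)) \<le> Rp * (norm (y - x))\<^sup>2"
    using smooth_open_taylor_compact[OF sp K W(2)] by blast
  obtain Rq where Rq: "Rq \<ge> 0" "\<And>x y. x \<in> ?K \<Longrightarrow> y \<in> ?K \<Longrightarrow> norm (partial_q G y - partial_q G x - fd (partial_q G) x (y - x)) \<le> Rq * (norm (y - x))\<^sup>2"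
    using smooth_open_taylor_compact[OF sq K W(2)] by blast
  have pair_norm: "norm (- u, v) \<le> \<bar>u\<bar> + \<bar>v\<bar>" for u v :: real
    using norm_Pair_le[of "- u" v] by simp
  define C where "C = B + Bp + Bq + L + Lp + Lq + R + 2 * Rp + 2 * Rq"
  note nonneg = B(1) Bp(1) Bq(1) L(1) Lp(1) Lq(1) R(1) Rp(1) Rq(1)
  have C0: "C \<ge> 0" using nonneg by (simp add: C_def)
  have "bounds_at C t" if t: "t \<in> {a<..<b}" for t
    unfolding bounds_at_def
  proof (intro conjI ballI)
    have inK: "(z, t) \<in> ?K" if "z \<in> D" for z using that t by auto
    fix z assume z: "z \<in> D"
    have "\<bar>H z t\<bar> \<le> B" using B(2)[OF inK[OF z]] W(3)[OF z t] by simp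
    also have "\<dots> \<le> C" using nonneg by (simp add: C_def)
    finally show "\<bar>H z t\<bar> \<le> C" .
    have "norm (X t z) \<le> \<bar>partial_q G (z, t)\<bar> + \<bar>partial_p G (z, t)\<bar>" unfolding W(5)[OF z t] by (rule pair_norm)
    also have "\<dots> \<le> Bq + Bp" using Bp(2)[OF inK[OF z]] Bq(2)[OF inK[OF z]] by simp
    also have "\<dots> \<le> C" using nonneg by (simp add: C_def)
    finally show "norm (X t z) \<le> C" .
    fix w assume w: "w \<in> D"
    have n: "norm ((w, t) - (z, t)) = norm (w - z)" by simp
    have "\<bar>H w t - H z t\<bar> \<le> L * norm (w - z)"
      using L(2)[OF inK[OF z] inK[OF w]] W(3)[OF z t] W(3)[OF w t] by simp
    also have "\<dots> \<le> C * norm (w - z)"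
      using nonneg by (intro mult_right_mono) (auto simp: C_def)
    finally show "\<bar>H w t - H z t\<bar> \<le> C * norm (w - z)" .
    have "X t w - X t z = (- (partial_q G (w, t) - partial_q G (z, t)), partial_p G (w, t) - partial_p G (z, t))"
      unfolding W(5)[OF z t] W(5)[OF w t] by simp
    also have "norm \<dots> \<le> \<bar>partial_q G (w, t) - partial_q G (z, t)\<bar> + \<bar>partial_p G (w, t) - partial_p G (z, t)\<bar>" by (rule pair_norm)
    also have "\<dots> \<le> Lq * norm (w - z) + Lp * norm (w - z)"
      using Lp(2)[OF inK[OF z] inK[OF w]] Lq(2)[OF inK[OF z] inK[OF w]] by simp
    also have "\<dots> = (Lq + Lp) * norm (w - z)" by (simp add: distrib_right)
    also have "\<dots> \<le> C * norm (w - z)"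
      using nonneg by (intro mult_right_mono) (auto simp: C_def)
    finally show "norm (X t w - X t z) \<le> C * norm (w - z)" .
    have zW: "(z, t) \<in> W" using inK[OF z] W(2) by blast
    have "\<bar>H w t - H z t - dp_dq (w - z) (X t z)\<bar> \<le> R * (norm (w - z))\<^sup>2"
      using R(2)[OF inK[OF z] inK[OF w]] W(3)[OF z t] W(3)[OF w t] fd_space[OF W(1) zW, of "w - z"]
      by (simp add: W(5)[OF z t] dp_dq_def)
    also have "\<dots> \<le> C * (norm (w - z))\<^sup>2"
      using nonneg by (intro mult_right_mono) (auto simp: C_def)
    finally show "\<bar>H w t - H z t - dp_dq (w - z) (X t z)\<bar> \<le> C * (norm (w - z))\<^sup>2" .
  next
    have inK: "(z, t) \<in> ?K" if "z \<in> D" for z using that t by auto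
    fix z w1 w2 assume z: "z \<in> D" and w1: "w1 \<in> D" and w2: "w2 \<in> D"
    have zW: "(z, t) \<in> W" using inK[OF z] W(2) by blast
    \<comment> \<open>Equality of mixed partial derivatives makes the linear part of the field
      traceless.\<close>
    have sym: "partial_p (partial_q G) (z, t) = partial_q (partial_p G) (z, t)"
      using fd_symmetric[OF W(1) zW, of "((0, 1), 0)" "((1, 0), 0)"]
      unfolding partial_p_def[abs_def] partial_q_def[abs_def] .
    define \<rho>p where "\<rho>p w = partial_p G (w, t) - partial_p G (z, t) - (fst (w - z) * partial_p (partial_p G) (z, t) + snd (w - z) * partial_q (partial_p G) (z, t))" for w
    define \<rho>q where "\<rho>q w = partial_q G (w, t) - partial_q G (z, t) - (fst (w - z) * partial_p (partial_q G) (z, t) + snd (w - z) * partial_q (partial_q G) (z, t))" for w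
    have \<rho>p: "\<bar>\<rho>p w\<bar> \<le> Rp * (norm (w - z))\<^sup>2" if w: "w \<in> D" for w
      using Rp(2)[OF inK[OF z] inK[OF w]] fd_space[OF sp zW, of "w - z"] by (simp add: \<rho>p_def)
    have \<rho>q: "\<bar>\<rho>q w\<bar> \<le> Rq * (norm (w - z))\<^sup>2" if w: "w \<in> D" for w
      using Rq(2)[OF inK[OF z] inK[OF w]] fd_space[OF sq zW, of "w - z"] by (simp add: \<rho>q_def)
    have Xd: "X t w - X t z = (- (partial_q G (w, t) - partial_q G (z, t)), partial_p G (w, t) - partial_p G (z, t))" if "w \<in> D" for w
      unfolding W(5)[OF z t] W(5)[OF that t] by simp
    have dp: "partial_p G (w, t) - partial_p G (z, t) = \<rho>p w + (fst (w - z) * partial_p (partial_p G) (z, t) + snd (w - z) * partial_q (partial_p G) (z, t))"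
      and dq: "partial_q G (w, t) - partial_q G (z, t) = \<rho>q w + (fst (w - z) * partial_q (partial_p G) (z, t) + snd (w - z) * partial_q (partial_q G) (z, t))" for w
      by (simp_all add: \<rho>p_def \<rho>q_def sym)
    let ?n1 = "norm (w1 - z)" and ?n2 = "norm (w2 - z)"
    \<comment> \<open>All terms with second derivatives cancel; only the Taylor remainders
      \<open>\<rho>p\<close> and \<open>\<rho>q\<close> are left.\<close>
    have "dp_dq (X t w1 - X t z) (w2 - z) + dp_dq (w1 - z) (X t w2 - X t z)
        = - \<rho>q w1 * snd (w2 - z) - \<rho>p w1 * fst (w2 - z) + fst (w1 - z) * \<rho>p w2 + snd (w1 - z) * \<rho>q w2"
      unfolding Xd[OF w1] Xd[OF w2] dp dq dp_dq_def fst_conv snd_conv by algebra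
    also have "\<bar>\<dots>\<bar> \<le> \<bar>\<rho>q w1\<bar> * \<bar>snd (w2 - z)\<bar> + \<bar>\<rho>p w1\<bar> * \<bar>fst (w2 - z)\<bar>
        + \<bar>fst (w1 - z)\<bar> * \<bar>\<rho>p w2\<bar> + \<bar>snd (w1 - z)\<bar> * \<bar>\<rho>q w2\<bar>"
      unfolding abs_mult[symmetric] by linarith
    also have "\<dots> \<le> (Rq * ?n1\<^sup>2) * ?n2 + (Rp * ?n1\<^sup>2) * ?n2 + ?n1 * (Rp * ?n2\<^sup>2) + ?n1 * (Rq * ?n2\<^sup>2)"
    proof -
      have f: "\<bar>fst v\<bar> \<le> norm v" "\<bar>snd v\<bar> \<le> norm v" for v :: "plane"
        using norm_fst_le[of "fst v" "snd v"] norm_snd_le[of "snd v" "fst v"] by simp_all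
      show ?thesis
        by (intro add_mono mult_mono \<rho>p \<rho>q f w1 w2) (use Rp(1) Rq(1) in auto)
    qed
    also have "\<dots> = (Rp + Rq) * ?n1 * ?n2 * (?n1 + ?n2)"
      by (simp add: power2_eq_square algebra_simps)
    also have "\<dots> \<le> C * ?n1 * ?n2 * (?n1 + ?n2)"
      using nonneg by (intro mult_right_mono) (auto simp: C_def)
    finally show "\<bar>dp_dq (X t w1 - X t z) (w2 - z) + dp_dq (w1 - z) (X t w2 - X t z)\<bar> \<le> C * ?n1 * ?n2 * (?n1 + ?n2)" .
  qed
  with C0 show ?thesis by blast
qed

lemma uniform_bounds:
  obtains C where "C \<ge> 0" "\<And>t. t \<in> regular \<Longrightarrow> bounds_at C t"
proof -
  have "\<forall>p\<in>pieces. \<exists>C\<ge>0. \<forall>t\<in>{fst p<..<snd p}. bounds_at C t"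
    using bounds_on_piece by auto
  then obtain Cp where Cp: "\<And>p. p \<in> pieces \<Longrightarrow> Cp p \<ge> 0"
    "\<And>p t. p \<in> pieces \<Longrightarrow> t \<in> {fst p<..<snd p} \<Longrightarrow> bounds_at (Cp p) t"
    by metis
  define C where "C = (\<Sum>p\<in>pieces. Cp p)"
  show ?thesis
  proof (rule that)
    show "C \<ge> 0" unfolding C_def by (intro sum_nonneg Cp)
    fix t assume "t \<in> regular"
    then obtain a b where ab: "(a, b) \<in> pieces" "a < t" "t < b" by (rule regular_piece)
    have "bounds_at (Cp (a, b)) t" using Cp(2)[OF ab(1)] ab(2,3) by simp
    moreover have "Cp (a, b) \<le> C"
      unfolding C_def by (rule member_le_sum[OF ab(1) _ finite_pieces]) (use Cp(1) in auto)
    ultimately show "bounds_at C t" by (rule bounds_at_mono)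
  qed
qed

text \<open>Continuity is local, and the time interval of each piece is open.\<close>

lemma continuous_on_pieces:
  assumes "\<And>a b. (a, b) \<in> pieces \<Longrightarrow> continuous_on (D \<times> {a<..<b}) f"
  shows "continuous_on (D \<times> regular) f"
  unfolding continuous_on_eq_continuous_within
proof
  fix x assume x: "x \<in> D \<times> regular"
  then obtain z t where zt: "x = (z, t)" "z \<in> D" "t \<in> regular" by auto
  obtain a b where ab: "(a, b) \<in> pieces" "a < t" "t < b" "{a<..<b} \<subseteq> regular" by (rule regular_piece[OF zt(3)])
  have "at x within (D \<times> regular) = at x within (D \<times> {a<..<b})"
  proof (rule at_within_nhd)
    show "x \<in> UNIV \<times> {a<..<b}" using ab zt by simp
    show "open ((UNIV :: plane set) \<times> {a<..<b})" by (intro open_Times) auto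
    show "D \<times> regular \<inter> UNIV \<times> {a<..<b} - {x} = D \<times> {a<..<b} \<inter> UNIV \<times> {a<..<b} - {x}"
      using ab(4) by auto
  qed
  moreover have "continuous (at x within (D \<times> {a<..<b})) f"
    using assms[OF ab(1)] zt ab unfolding continuous_on_eq_continuous_within by auto
  ultimately show "continuous (at x within (D \<times> regular)) f" by simp
qed

lemma continuous_on_H: "continuous_on (D \<times> regular) (\<lambda>x. H (fst x) (snd x))"
  and continuous_on_X: "continuous_on (D \<times> regular) (\<lambda>x. X (snd x) (fst x))"
proof -
  have both: "continuous_on (D \<times> {a<..<b}) (\<lambda>x. H (fst x) (snd x)) \<and> continuous_on (D \<times> {a<..<b}) (\<lambda>x. X (snd x) (fst x))"
    if ab: "(a, b) \<in> pieces" for a b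
  proof -
    obtain W G where "extends_H a b W G" by (rule smooth_piece[OF ab])
    note W = extends_HD[OF this]
    have sub: "D \<times> {a<..<b} \<subseteq> W" using W(2) by force
    have sp: "smooth_open W (partial_p G)" and sq: "smooth_open W (partial_q G)"
      unfolding partial_p_def[abs_def] partial_q_def[abs_def] by (intro smooth_open_fd W(1))+
    have "continuous_on (D \<times> {a<..<b}) G"
      by (rule continuous_on_subset[OF smooth_open_continuous[OF W(1)] sub])
    then have 1: "continuous_on (D \<times> {a<..<b}) (\<lambda>x. H (fst x) (snd x))"
      by (rule continuous_on_eq) (use W(3) in auto)
    have "continuous_on (D \<times> {a<..<b}) (\<lambda>x. (- partial_q G x, partial_p G x))"
      by (intro continuous_intros continuous_on_subset[OF smooth_open_continuous[OF sp] sub]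
          continuous_on_subset[OF smooth_open_continuous[OF sq] sub])
    then have "continuous_on (D \<times> {a<..<b}) (\<lambda>x. X (snd x) (fst x))"
      by (rule continuous_on_eq) (use W(5) in auto)
    with 1 show ?thesis by blast
  qed
  show "continuous_on (D \<times> regular) (\<lambda>x. H (fst x) (snd x))"
    by (rule continuous_on_pieces) (use both in blast)
  show "continuous_on (D \<times> regular) (\<lambda>x. X (snd x) (fst x))"
    by (rule continuous_on_pieces) (use both in blast)
qed

end

section \<open>The flow as an area-preserving map\<close>

context disk_system
begin

lemma flow_0: "z \<in> D \<Longrightarrow> g 0 z = z"
  and flow_in: "z \<in> D \<Longrightarrow> g t z \<in> D"
  and flow_continuous: "z \<in> D \<Longrightarrow> continuous_on UNIV (\<lambda>t. g t z)"
  and flow_derivative: "z \<in> D \<Longrightarrow> t \<notin> J \<Longrightarrow> ((\<lambda>s. g s z) has_vector_derivative X t (g t z)) (at t)"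
  using flow unfolding is_ham_flow_def by blast+

lemma flow_derivative_regular:
  assumes "z \<in> D" "s \<in> {0<..<t} - jumps" "t \<le> 2 * pi"
  shows "((\<lambda>s. g s z) has_vector_derivative X s (g s z)) (at s)" and "s \<in> regular"
proof -
  show "s \<in> regular" using assms by (auto simp: regular_def)
  then show "((\<lambda>s. g s z) has_vector_derivative X s (g s z)) (at s)"
    using flow_derivative[OF assms(1) regular_not_J] by blast
qed

text \<open>Gronwall's inequality for the difference of two orbits, forwards for the upper and
  backwards for the lower bound; the finitely many jumps interrupt only its differentiability, not
  its continuity.\<close>

lemma flow_bilipschitz:
  obtains M where "M \<ge> 0"
    "\<And>t z w. t \<in> {0..2 * pi} \<Longrightarrow> z \<in> D \<Longrightarrow> w \<in> D \<Longrightarrow> norm (g t w - g t z) \<le> M * norm (w - z)"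
    "\<And>t z w. t \<in> {0..2 * pi} \<Longrightarrow> z \<in> D \<Longrightarrow> w \<in> D \<Longrightarrow> norm (w - z) \<le> M * norm (g t w - g t z)"
proof -
  obtain C where C: "C \<ge> 0" "\<And>t. t \<in> regular \<Longrightarrow> bounds_at C t"
    by (rule uniform_bounds) blast
  have gr: "norm (g t w - g t z) \<le> exp (C * (2 * pi)) * norm (w - z)
      \<and> norm (w - z) \<le> exp (C * (2 * pi)) * norm (g t w - g t z)"
    if t: "t \<in> {0..2 * pi}" and z: "z \<in> D" and w: "w \<in> D" for t z w
  proof -
    let ?d = "\<lambda>s. g s w - g s z"
    have t2: "0 \<le> t" "t \<le> 2 * pi" using t by auto
    have der: "(?d has_vector_derivative X s (g s w) - X s (g s z)) (at s)" if "s \<in> {0<..<t} - jumps" for s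
      by (intro has_vector_derivative_diff flow_derivative_regular(1)[OF _ that t2(2)] z w)
    have cont: "continuous_on {0..t} ?d"
      by (intro continuous_intros continuous_on_subset[OF flow_continuous] z w) auto
    have bound: "norm (X s (g s w) - X s (g s z)) \<le> C * norm (?d s)" if "s \<in> {0<..<t} - jumps" for s
      by (rule bounds_atD(4)[OF C(2)[OF flow_derivative_regular(2)[OF z that t2(2)]]]) (intro flow_in z w)+
    have "exp (C * (t - 0)) \<le> exp (C * (2 * pi))" using C(1) t2 by (simp add: mult_left_mono)
    then have m: "exp (C * (t - 0)) * norm v \<le> exp (C * (2 * pi)) * norm v" for v :: "plane"
      by (rule mult_right_mono) simp
    have "norm (?d t) \<le> exp (C * (t - 0)) * norm (?d 0)" "norm (?d 0) \<le> exp (C * (t - 0)) * norm (?d t)"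
      by (rule gronwall_off_finite[OF finite_jumps t2(1) der cont bound]; assumption)+
    then show ?thesis
      using order_trans[OF _ m] by (simp only: flow_0[OF z] flow_0[OF w])
  qed
  show ?thesis by (rule that[of "exp (C * (2 * pi))"]) (use gr in auto)
qed

text \<open>Bijectivity comes from the lower Lipschitz bound and the invariance of \<open>D\<close>;
  compactness then gives continuity of the inverse.\<close>

lemma flow_homeomorphism:
  assumes t: "t \<in> {0..2 * pi}"
  shows "homeomorphism D D (g t) (inv_into D (g t))" and "inj_on (g t) D" and "continuous_on D (g t)"
proof -
  obtain M where M: "M \<ge> 0"
    "\<And>t z w. t \<in> {0..2 * pi} \<Longrightarrow> z \<in> D \<Longrightarrow> w \<in> D \<Longrightarrow> norm (g t w - g t z) \<le> M * norm (w - z)"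
    "\<And>t z w. t \<in> {0..2 * pi} \<Longrightarrow> z \<in> D \<Longrightarrow> w \<in> D \<Longrightarrow> norm (w - z) \<le> M * norm (g t w - g t z)"
    by (rule flow_bilipschitz) blast
  show inj: "inj_on (g t) D"
  proof (rule inj_onI)
    fix z w assume "z \<in> D" "w \<in> D" "g t z = g t w"
    then show "z = w" using M(3)[OF t, of z w] by simp
  qed
  have "M-lipschitz_on D (g t)"
    by (rule lipschitz_onI) (use M(1,2) t in \<open>auto simp: dist_norm\<close>)
  then show cont: "continuous_on D (g t)" by (rule lipschitz_on_continuous_on)
  show "homeomorphism D D (g t) (inv_into D (g t))"
  proof (rule homeomorphismI)
    show "continuous_on D (inv_into D (g t))"
      using continuous_on_inv[OF cont compact_D, of "inv_into D (g t)"] inv_into_f_f[OF inj]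
      by (simp add: flow_image)
    show "inv_into D (g t) ` D \<subseteq> D" using flow_image[of t] by (metis image_subsetI inv_into_into)
    show "inv_into D (g t) (g t z) = z" if "z \<in> D" for z using inv_into_f_f[OF inj that] .
    show "g t (inv_into D (g t) z) = z" if "z \<in> D" for z
      by (rule f_inv_into_f) (use that flow_image in simp)
  qed (use cont flow_image in auto)
qed

lemma flow_frontier: "t \<in> {0..2 * pi} \<Longrightarrow> g t ` frontier D = frontier D"
  using homeomorphism_image_frontier[OF flow_homeomorphism(1) closed_D closed_D] .

lemma flow_interior: "t \<in> {0..2 * pi} \<Longrightarrow> g t ` interior D = interior D"
  using homeomorphism_image_interior[OF flow_homeomorphism(1)] .

text \<open>By the last clause of \<open>bounds_at\<close> the time derivative of
  \<open>dp_dq\<close> of two orbit differences is of third order. Each difference costs one factor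
  \<open>M\<close>, hence \<open>M ^ 3\<close>, and the length of the period gives
  \<open>2 * pi\<close>.\<close>

lemma flow_area_estimate:
  obtains K where
    "\<And>t z w1 w2. t \<in> {0..2 * pi} \<Longrightarrow> z \<in> D \<Longrightarrow> w1 \<in> D \<Longrightarrow> w2 \<in> D \<Longrightarrow>
      \<bar>dp_dq (g t w1 - g t z) (g t w2 - g t z) - dp_dq (w1 - z) (w2 - z)\<bar>
        \<le> K * norm (w1 - z) * norm (w2 - z) * (norm (w1 - z) + norm (w2 - z))"
proof -
  obtain C where C: "C \<ge> 0" "\<And>t. t \<in> regular \<Longrightarrow> bounds_at C t"
    by (rule uniform_bounds) blast
  obtain M where M: "M \<ge> 0"
    "\<And>t z w. t \<in> {0..2 * pi} \<Longrightarrow> z \<in> D \<Longrightarrow> w \<in> D \<Longrightarrow> norm (g t w - g t z) \<le> M * norm (w - z)"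
    by (rule flow_bilipschitz) blast
  define K where "K = C * M ^ 3 * (2 * pi)"
  have "\<bar>dp_dq (g t w1 - g t z) (g t w2 - g t z) - dp_dq (w1 - z) (w2 - z)\<bar>
        \<le> K * norm (w1 - z) * norm (w2 - z) * (norm (w1 - z) + norm (w2 - z))"
    if t: "t \<in> {0..2 * pi}" and z: "z \<in> D" and w: "w1 \<in> D" "w2 \<in> D" for t z w1 w2
  proof -
    let ?d1 = "\<lambda>s. g s w1 - g s z" and ?d2 = "\<lambda>s. g s w2 - g s z"
    let ?n1 = "norm (w1 - z)" and ?n2 = "norm (w2 - z)"
    let ?B = "C * (M * ?n1) * (M * ?n2) * (M * ?n1 + M * ?n2)"
    have t2: "0 \<le> t" "t \<le> 2 * pi" using t by auto
    have "norm (dp_dq (?d1 t) (?d2 t) - dp_dq (?d1 0) (?d2 0)) \<le> ?B * (t - 0)"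
    proof (rule FTC_bound_off_finite[OF finite_jumps t2(1),
          where f' = "\<lambda>s. dp_dq (?d1 s) (X s (g s w2) - X s (g s z)) + dp_dq (X s (g s w1) - X s (g s z)) (?d2 s)"])
      show "0 \<le> ?B" using C(1) M(1) by simp
      show "continuous_on {0..t} (\<lambda>s. dp_dq (?d1 s) (?d2 s))"
        by (intro bounded_bilinear.continuous_on[OF bounded_bilinear_dp_dq] continuous_intros
            continuous_on_subset[OF flow_continuous] z w) auto
      fix s assume s: "s \<in> {0<..<t} - jumps"
      show "((\<lambda>s. dp_dq (?d1 s) (?d2 s)) has_vector_derivative
          dp_dq (?d1 s) (X s (g s w2) - X s (g s z)) + dp_dq (X s (g s w1) - X s (g s z)) (?d2 s)) (at s)"
        by (intro bounded_bilinear.has_vector_derivative[OF bounded_bilinear_dp_dq]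
            has_vector_derivative_diff flow_derivative_regular(1)[OF _ s t2(2)] z w)
      have sT: "s \<in> regular" by (rule flow_derivative_regular(2)[OF z s t2(2)])
      have s2: "s \<in> {0..2 * pi}" using s t2 by auto
      have "\<bar>dp_dq (X s (g s w1) - X s (g s z)) (?d2 s) + dp_dq (?d1 s) (X s (g s w2) - X s (g s z))\<bar>
          \<le> C * norm (?d1 s) * norm (?d2 s) * (norm (?d1 s) + norm (?d2 s))"
        by (rule bounds_atD(6)[OF C(2)[OF sT]]) (intro flow_in z w)+
      also have "\<dots> \<le> ?B"
        by (intro mult_mono add_mono M(2)[OF s2] z w order_refl) (use C(1) M(1) in auto)
      finally show "norm (dp_dq (?d1 s) (X s (g s w2) - X s (g s z)) + dp_dq (X s (g s w1) - X s (g s z)) (?d2 s)) \<le> ?B"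
        by (simp add: add.commute)
    qed
    also have "\<dots> \<le> ?B * (2 * pi)" using t2 C(1) M(1) by (intro mult_left_mono) auto
    also have "\<dots> = K * ?n1 * ?n2 * (?n1 + ?n2)"
      by (simp add: K_def power3_eq_cube algebra_simps)
    finally show ?thesis by (simp add: flow_0 z w)
  qed
  then show ?thesis using that by blast
qed

text \<open>The area estimate makes the flow differentiable with determinant one in the interior,
  which is mapped onto itself; the frontier is a null set.\<close>

lemma flow_preserves_integral:
  fixes f :: "plane \<Rightarrow> real"
  assumes t: "t \<in> {0..2 * pi}" and f: "continuous_on D f"
  shows "integral D (\<lambda>z. f (g t z)) = integral D f"
proof -
  obtain M where M: "M \<ge> 0"
    "\<And>t z w. t \<in> {0..2 * pi} \<Longrightarrow> z \<in> D \<Longrightarrow> w \<in> D \<Longrightarrow> norm (g t w - g t z) \<le> M * norm (w - z)"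
    by (rule flow_bilipschitz) blast
  obtain K where K:
    "\<And>t z w1 w2. t \<in> {0..2 * pi} \<Longrightarrow> z \<in> D \<Longrightarrow> w1 \<in> D \<Longrightarrow> w2 \<in> D \<Longrightarrow>
      \<bar>dp_dq (g t w1 - g t z) (g t w2 - g t z) - dp_dq (w1 - z) (w2 - z)\<bar>
        \<le> K * norm (w1 - z) * norm (w2 - z) * (norm (w1 - z) + norm (w2 - z))"
    by (rule flow_area_estimate) blast
  have "\<forall>z\<in>interior D. \<exists>L. dp_dq (L (1, 0)) (L (0, 1)) = 1 \<and> (g t has_derivative L) (at z)"
  proof
    fix z assume z: "z \<in> interior D"
    then have zD: "z \<in> D" using interior_subset by blast
    obtain Y1 Y2 where "dp_dq Y1 Y2 = 1" "(g t has_derivative (\<lambda>v. fst v *\<^sub>R Y1 + snd v *\<^sub>R Y2)) (at z)"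
      by (rule area_estimate_imp_derivative[OF z, of "g t" M K])
         (use M(2)[OF t zD] K[OF t zD] in auto)
    then show "\<exists>L. dp_dq (L (1, 0)) (L (0, 1)) = 1 \<and> (g t has_derivative L) (at z)"
      by (intro exI[of _ "\<lambda>v. fst v *\<^sub>R Y1 + snd v *\<^sub>R Y2"]) simp
  qed
  then obtain L where L: "\<And>z. z \<in> interior D \<Longrightarrow> dp_dq (L z (1, 0)) (L z (0, 1)) = 1"
    "\<And>z. z \<in> interior D \<Longrightarrow> (g t has_derivative L z) (at z)"
    by metis
  have bdd: "bounded (interior D)"
    using compact_imp_bounded[OF compact_D] interior_subset bounded_subset by blast
  have img: "g t ` interior D = interior D" by (rule flow_interior[OF t])
  obtain B where B: "\<And>z. z \<in> D \<Longrightarrow> norm (f z) \<le> B"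
    using compact_norm_bound[OF compact_D f] by blast
  have "f absolutely_integrable_on interior D"
    by (rule bounded_continuous_absolutely_integrable[OF _ bdd continuous_on_subset[OF f interior_subset], of B])
       (use B interior_subset in auto)
  then have ai: "f absolutely_integrable_on g t ` interior D" by (simp only: img)
  have inj: "inj_on (g t) (interior D)"
    by (rule inj_on_subset[OF flow_homeomorphism(2)[OF t] interior_subset])
  have "integral (interior D) (\<lambda>z. \<bar>dp_dq (L z (1, 0)) (L z (0, 1))\<bar> * f (g t z)) = integral (interior D) f"
    using plane_change_of_variables(2)[OF open_interior bdd _ L(2) inj ai] bdd by (simp add: img)
  moreover have "integral (interior D) (\<lambda>z. \<bar>dp_dq (L z (1, 0)) (L z (0, 1))\<bar> * f (g t z))
      = integral (interior D) (\<lambda>z. f (g t z))"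
    by (rule integral_cong) (simp add: L(1))
  moreover have "integral (interior D) F = integral D F" for F :: "plane \<Rightarrow> real"
    by (rule integral_spike_set)
       (use negligible_frontier closed_D interior_subset in \<open>auto simp: frontier_def intro: negligible_subset\<close>)
  ultimately show ?thesis by simp
qed

text \<open>Every boundary point is passed at time \<open>t\<close> by an orbit that stays in
  \<open>D\<close>, so \<open>X\<close> is tangent to the boundary there, and \<open>dp_dq\<close>
  of the boundary tangent and \<open>X\<close>, which is the derivative of \<open>H\<close> along
  the boundary, vanishes. This also justifies the definite description in
  \<open>boundary_value\<close>.\<close>

lemma boundary_value_eq:
  assumes t: "t \<in> regular" and z: "z \<in> frontier D"
  shows "H z t = boundary_value D H t"
proof -
  have zero: "dp_dq (boundary_tangent \<theta>) (X t (boundary_curve \<theta>)) = 0" for \<theta>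
  proof -
    have fr: "boundary_curve \<theta> \<in> frontier D" using range_boundary_curve by blast
    then have "boundary_curve \<theta> \<in> g t ` D" using flow_image frontier_subset_D by auto
    then obtain z0 where z0: "z0 \<in> D" "boundary_curve \<theta> = g t z0" by blast
    have "\<Psi> (g t z0) = polar 1 \<theta>"
      unfolding z0(2)[symmetric] boundary_curve_def by (rule Psi_Phi[OF polar_1_in_cball])
    from velocity_at_boundary(1)[OF zero_less_one flow_in[OF z0(1)] this flow_derivative[OF z0(1) regular_not_J[OF t]]]
    obtain k where "X t (g t z0) = k *\<^sub>R boundary_tangent \<theta>" by blast
    then show ?thesis by (simp add: z0(2) dp_dq_def)
  qed
  have "\<And>z. z \<in> frontier D \<Longrightarrow> ((\<lambda>w. H w t) has_derivative (\<lambda>v. dp_dq v (X t z))) (at z within D)"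
    using has_derivative_H[OF _ t] frontier_subset_D by blast
  then obtain c where c: "\<And>z. z \<in> frontier D \<Longrightarrow> H z t = c"
    using constant_on_frontier[of "\<lambda>w. H w t" "\<lambda>z v. dp_dq v (X t z)"] zero by metis
  have "boundary_value D H t = c"
    unfolding boundary_value_def
  proof (rule the_equality)
    show "\<forall>z\<in>frontier D. H z t = c" using c by blast
    fix c' assume "\<forall>z\<in>frontier D. H z t = c'"
    then show "c' = c" using c z by metis
  qed
  then show ?thesis using c[OF z] by simp
qed

section \<open>The action and its integral\<close>

definition Lagr :: "real \<Rightarrow> plane \<Rightarrow> real" where
  "Lagr t z = dp_dq z (X t z) / 2 - (H z t - boundary_value D H t)"

definition action :: "plane \<Rightarrow> real" where
  "action z = integral {0..2 * pi} (\<lambda>t. Lagr t (g t z))"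

lemma negligible_irregular:
  "negligible {t \<in> {0..2 * pi} - regular. P t}" "negligible {t \<in> regular - {0..2 * pi}. P t}"
proof -
  have neg: "negligible (jumps \<union> {0, 2 * pi})" using finite_jumps by (intro negligible_finite) simp
  show "negligible {t \<in> {0..2 * pi} - regular. P t}" "negligible {t \<in> regular - {0..2 * pi}. P t}"
    by (rule negligible_subset[OF neg]; auto simp: regular_def)+
qed

lemma integral_regular: "integral {0..2 * pi} f = integral regular f" for f :: "real \<Rightarrow> real"
  by (rule integral_spike_set) (rule negligible_irregular)+

text \<open>The boundary value is that of \<open>H\<close> at one fixed frontier point, so its
  continuity in time is read off there.\<close>

lemma continuous_on_boundary_value: "continuous_on regular (boundary_value D H)"
proof -
  obtain z where z: "z \<in> frontier D" using frontier_nonempty by blast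
  have "continuous_on regular (\<lambda>t. H (fst (z, t)) (snd (z, t)))"
    by (rule continuous_on_compose2[OF continuous_on_H])
       (use z frontier_subset_D in \<open>auto intro!: continuous_intros\<close>)
  then show ?thesis
    by (rule continuous_on_eq) (use boundary_value_eq[OF _ z] in simp)
qed

lemma continuous_on_Lagr: "continuous_on (D \<times> regular) (\<lambda>x. Lagr (snd x) (fst x))"
proof -
  have "continuous_on (D \<times> regular) (\<lambda>x. boundary_value D H (snd x))"
    by (rule continuous_on_compose2[OF continuous_on_boundary_value]) (auto intro!: continuous_intros)
  then show ?thesis
    unfolding Lagr_def
    by (intro continuous_intros bounded_bilinear.continuous_on[OF bounded_bilinear_dp_dq]
        continuous_on_H continuous_on_X) simp_all
qed

lemma Lagr_bound:
  obtains B where "\<And>t z. t \<in> regular \<Longrightarrow> z \<in> D \<Longrightarrow> norm (Lagr t z) \<le> B"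
proof -
  obtain C where C: "C \<ge> 0" "\<And>t. t \<in> regular \<Longrightarrow> bounds_at C t"
    by (rule uniform_bounds) blast
  obtain R where R: "R \<ge> 0" "\<And>z. z \<in> D \<Longrightarrow> norm z \<le> R"
    using compact_norm_bound[OF compact_D continuous_on_id] by blast
  have "norm (Lagr t z) \<le> R * C + 2 * C" if t: "t \<in> regular" and z: "z \<in> D" for t z
  proof -
    obtain z' where z': "z' \<in> frontier D" using frontier_nonempty by blast
    have b: "\<bar>boundary_value D H t\<bar> \<le> C"
      using bounds_atD(1)[OF C(2)[OF t], of z'] z' frontier_subset_D boundary_value_eq[OF t z'] by auto
    have h: "\<bar>H z t\<bar> \<le> C" by (rule bounds_atD(1)[OF C(2)[OF t] z])
    have "\<bar>dp_dq z (X t z)\<bar> \<le> norm z * norm (X t z)" by (rule abs_dp_dq_le)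
    also have "\<dots> \<le> R * C"
      by (intro mult_mono R(2)[OF z] bounds_atD(2)[OF C(2)[OF t] z]) (use R(1) in auto)
    finally have "\<bar>dp_dq z (X t z)\<bar> \<le> R * C" .
    then show ?thesis using b h by (simp add: Lagr_def)
  qed
  then show ?thesis using that by blast
qed

text \<open>Continuity in time for one starting point, combined with a Lipschitz constant in the
  starting point that is uniform in time, gives joint continuity.\<close>

lemma continuous_on_flow: "continuous_on (D \<times> regular) (\<lambda>x. g (snd x) (fst x))"
proof -
  obtain M where M: "M \<ge> 0"
    "\<And>t z w. t \<in> {0..2 * pi} \<Longrightarrow> z \<in> D \<Longrightarrow> w \<in> D \<Longrightarrow> norm (g t w - g t z) \<le> M * norm (w - z)"
    by (rule flow_bilipschitz) blast
  show ?thesis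
    unfolding continuous_on_def
  proof
    fix x assume x: "x \<in> D \<times> regular"
    let ?z = "fst x" and ?t = "snd x"
    have z: "?z \<in> D" using x by auto
    have g: "((\<lambda>y. g (snd y) ?z) \<longlongrightarrow> g ?t ?z) (at x within D \<times> regular)"
      using flow_continuous[OF z]
      by (intro continuous_on_tendsto_compose[OF flow_continuous[OF z]] tendsto_intros) auto
    have "((\<lambda>y. M * norm (fst y - ?z) + norm (g (snd y) ?z - g ?t ?z)) \<longlongrightarrow> M * norm (?z - ?z) + norm (g ?t ?z - g ?t ?z)) (at x within D \<times> regular)"
      by (intro tendsto_intros g)
    then have lim: "((\<lambda>y. M * norm (fst y - ?z) + norm (g (snd y) ?z - g ?t ?z)) \<longlongrightarrow> 0) (at x within D \<times> regular)" by simp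
    have ev: "eventually (\<lambda>y. norm (g (snd y) (fst y) - g ?t ?z) \<le> M * norm (fst y - ?z) + norm (g (snd y) ?z - g ?t ?z)) (at x within D \<times> regular)"
      unfolding eventually_at_filter
    proof (rule always_eventually, intro allI impI)
      fix y assume y: "y \<in> D \<times> regular"
      have "snd y \<in> {0..2 * pi}" "fst y \<in> D" using y by (auto simp: regular_def)
      then have "norm (g (snd y) (fst y) - g (snd y) ?z) \<le> M * norm (fst y - ?z)" using M(2) z by blast
      then show "norm (g (snd y) (fst y) - g ?t ?z) \<le> M * norm (fst y - ?z) + norm (g (snd y) ?z - g ?t ?z)"
        using norm_triangle_ineq[of "g (snd y) (fst y) - g (snd y) ?z" "g (snd y) ?z - g ?t ?z"] by simp
    qed
    have "((\<lambda>y. g (snd y) (fst y) - g ?t ?z) \<longlongrightarrow> 0) (at x within D \<times> regular)"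
      by (rule Lim_null_comparison[OF ev lim])
    then show "((\<lambda>y. g (snd y) (fst y)) \<longlongrightarrow> g ?t ?z) (at x within D \<times> regular)"
      by (rule Lim_null[THEN iffD2])
  qed
qed

lemma continuous_on_Lagr_flow: "continuous_on (D \<times> regular) (\<lambda>x. Lagr (snd x) (g (snd x) (fst x)))"
proof -
  have c: "continuous_on (D \<times> regular) (\<lambda>x. (g (snd x) (fst x), snd x))"
    by (intro continuous_on_Pair continuous_on_flow continuous_on_snd continuous_on_id)
  have "(\<lambda>x. (g (snd x) (fst x), snd x)) ` (D \<times> regular) \<subseteq> D \<times> regular"
    by (intro image_subsetI SigmaI) (auto intro: flow_in)
  from continuous_on_compose2[OF continuous_on_Lagr c this] show ?thesis by simp
qed

lemma Lagr_flow_integrable: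
  assumes z: "z \<in> D"
  shows "(\<lambda>t. Lagr t (g t z)) absolutely_integrable_on regular"
    and "(\<lambda>t. Lagr t (g t z)) integrable_on {0..2 * pi}"
proof -
  obtain B where B: "\<And>t z. t \<in> regular \<Longrightarrow> z \<in> D \<Longrightarrow> norm (Lagr t z) \<le> B"
    by (rule Lagr_bound) blast
  have "continuous_on regular (\<lambda>t. (z, t))" by (intro continuous_intros)
  from continuous_on_compose2[OF continuous_on_Lagr_flow this]
  have c: "continuous_on regular (\<lambda>t. Lagr t (g t z))" using z by auto
  have bdd: "bounded regular" by (rule bounded_subset[OF bounded_closed_interval[of 0 "2 * pi"]]) (auto simp: regular_def)
  show ai: "(\<lambda>t. Lagr t (g t z)) absolutely_integrable_on regular"
    by (rule bounded_continuous_absolutely_integrable[OF _ bdd c, of B])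
       (use open_regular B flow_in[OF z] in auto)
  then have "(\<lambda>t. Lagr t (g t z)) integrable_on regular" by (rule set_lebesgue_integral_eq_integral(1))
  then show "(\<lambda>t. Lagr t (g t z)) integrable_on {0..2 * pi}"
    by (rule integrable_spike_set) (rule negligible_irregular)+
qed

text \<open>
  The endpoint terms depend on the time-\<open>2\<pi>\<close> map alone; this is the integrated form of
  \<open>dA = h\<^sup>*\<lambda> - \<lambda>\<close> for the action \<open>A\<close>, where \<open>\<lambda> = (p dq - q dp) / 2\<close>.
\<close>

lemma action_estimate:
  obtains K where
    "\<And>z w. z \<in> D \<Longrightarrow> w \<in> D \<Longrightarrow>
      \<bar>action w - action z - (dp_dq (g (2 * pi) z) (g (2 * pi) w) / 2 - dp_dq z w / 2)\<bar> \<le> K * (norm (w - z))\<^sup>2"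
proof -
  obtain C where C: "C \<ge> 0" "\<And>t. t \<in> regular \<Longrightarrow> bounds_at C t"
    by (rule uniform_bounds) blast
  obtain M where M: "M \<ge> 0"
    "\<And>t z w. t \<in> {0..2 * pi} \<Longrightarrow> z \<in> D \<Longrightarrow> w \<in> D \<Longrightarrow> norm (g t w - g t z) \<le> M * norm (w - z)"
    by (rule flow_bilipschitz) blast
  have "\<bar>action w - action z - (dp_dq (g (2 * pi) z) (g (2 * pi) w) / 2 - dp_dq z w / 2)\<bar>
      \<le> (2 * C * M\<^sup>2 * (2 * pi)) * (norm (w - z))\<^sup>2"
    if z: "z \<in> D" and w: "w \<in> D" for z w
  proof -
    \<comment> \<open>Derivative of the end point term \<open>dp_dq (g t z) (g t w) / 2\<close>. As
      \<open>dp_dq\<close> is alternating, that term is \<open>\<lambda>\<close> at the orbit of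
      \<open>z\<close> applied to the difference of the two orbits.\<close>
    let ?e = "\<lambda>t. (dp_dq (g t z) (X t (g t w)) + dp_dq (X t (g t z)) (g t w)) / 2"
    have e: "(?e has_integral dp_dq (g (2 * pi) z) (g (2 * pi) w) / 2 - dp_dq (g 0 z) (g 0 w) / 2) {0..2 * pi}"
    proof (rule fundamental_theorem_of_calculus_interior_strong[OF finite_jumps])
      show "continuous_on {0..2 * pi} (\<lambda>t. dp_dq (g t z) (g t w) / 2)"
        by (intro continuous_on_divide continuous_on_const bounded_bilinear.continuous_on[OF bounded_bilinear_dp_dq]
            continuous_on_subset[OF flow_continuous] z w) auto
      fix t assume t: "t \<in> {0<..<2 * pi} - jumps"
      show "((\<lambda>t. dp_dq (g t z) (g t w) / 2) has_vector_derivative ?e t) (at t)"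
        by (intro has_vector_derivative_divide bounded_bilinear.has_vector_derivative[OF bounded_bilinear_dp_dq]
            flow_derivative_regular(1)[OF _ t order_refl] z w)
    qed simp
    have d: "((\<lambda>t. Lagr t (g t w) - Lagr t (g t z) - ?e t) has_integral
        action w - action z - (dp_dq (g (2 * pi) z) (g (2 * pi) w) / 2 - dp_dq (g 0 z) (g 0 w) / 2)) {0..2 * pi}"
      unfolding action_def
      by (intro has_integral_diff integrable_integral Lagr_flow_integrable(2) z w e)
    have tri: "\<bar>a / 2 - b\<bar> \<le> \<bar>a\<bar> + \<bar>b\<bar>" for a b :: real by linarith
    let ?B = "2 * C * M\<^sup>2 * (norm (w - z))\<^sup>2"
    have "norm (action w - action z - (dp_dq (g (2 * pi) z) (g (2 * pi) w) / 2 - dp_dq (g 0 z) (g 0 w) / 2))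
        \<le> ?B * measure lborel {0..2 * pi}"
    proof (rule has_integral_bound_real[where S = "jumps \<union> {0, 2 * pi}", OF _ _ d])
      show "0 \<le> ?B" using C(1) by simp
      show "finite (jumps \<union> {0, 2 * pi})" using finite_jumps by simp
      fix t assume t: "t \<in> {0..2 * pi} - (jumps \<union> {0, 2 * pi})"
      then have tT: "t \<in> regular" "t \<in> {0..2 * pi}" by (auto simp: regular_def)
      let ?z = "g t z" and ?w = "g t w"
      let ?n = "norm (?w - ?z)"
      have zD: "?z \<in> D" "?w \<in> D" using flow_in z w by auto
      \<comment> \<open>All first-order terms cancel. What remains is quadratic: a product of two
        differences and the Taylor remainder of \<open>H\<close>.\<close>
      have eq: "Lagr t ?w - Lagr t ?z - ?e t
          = dp_dq (?w - ?z) (X t ?w - X t ?z) / 2 - (H ?w t - H ?z t - dp_dq (?w - ?z) (X t ?z))"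
        by (simp add: Lagr_def dp_dq_def field_simps)
      have "norm (Lagr t ?w - Lagr t ?z - ?e t)
          \<le> \<bar>dp_dq (?w - ?z) (X t ?w - X t ?z)\<bar> + \<bar>H ?w t - H ?z t - dp_dq (?w - ?z) (X t ?z)\<bar>"
        unfolding eq real_norm_def by (rule tri)
      also have "\<dots> \<le> C * ?n\<^sup>2 + C * ?n\<^sup>2"
      proof (rule add_mono)
        have "\<bar>dp_dq (?w - ?z) (X t ?w - X t ?z)\<bar> \<le> ?n * norm (X t ?w - X t ?z)" by (rule abs_dp_dq_le)
        also have "\<dots> \<le> ?n * (C * ?n)"
          by (rule mult_left_mono[OF bounds_atD(4)[OF C(2)[OF tT(1)] zD]]) simp
        finally show "\<bar>dp_dq (?w - ?z) (X t ?w - X t ?z)\<bar> \<le> C * ?n\<^sup>2" by (simp add: power2_eq_square mult_ac)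
        show "\<bar>H ?w t - H ?z t - dp_dq (?w - ?z) (X t ?z)\<bar> \<le> C * ?n\<^sup>2"
          by (rule bounds_atD(5)[OF C(2)[OF tT(1)] zD])
      qed
      also have "\<dots> = 2 * C * ?n\<^sup>2" by simp
      also have "\<dots> \<le> 2 * C * (M * norm (w - z))\<^sup>2"
        by (intro mult_left_mono power_mono M(2)[OF tT(2) z w]) (use C(1) in auto)
      finally show "norm (Lagr t ?w - Lagr t ?z - ?e t) \<le> ?B" by (simp add: power_mult_distrib)
    qed
    then show ?thesis by (simp add: flow_0 z w mult_ac)
  qed
  then show ?thesis using that by blast
qed

text \<open>\<open>dp_dq z (X t z)\<close> is the radial derivative of \<open>H\<close>, so half of
  it contributes minus the integral of the normalised Hamiltonian; the term subtracted in
  \<open>Lagr\<close> contributes the same amount again.\<close>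

lemma integral_Lagr:
  assumes t: "t \<in> regular"
  shows "integral D (Lagr t) = - 2 * integral D (\<lambda>z. H z t - boundary_value D H t)"
proof -
  obtain C where C: "C \<ge> 0" "\<And>t. t \<in> regular \<Longrightarrow> bounds_at C t"
    by (rule uniform_bounds) blast
  let ?f = "\<lambda>z. H z t - boundary_value D H t"
  have rad: "integral D (\<lambda>z. dp_dq z (X t z)) = - 2 * integral D ?f"
  proof (rule integral_radial_derivative[where f' = "\<lambda>z v. dp_dq v (X t z)", OF compact_D negligible_frontier _ C(1)])
    fix z w assume "z \<in> D" "w \<in> D"
    then show "\<bar>?f w - ?f z\<bar> \<le> C * norm (w - z)"
      using bounds_atD(3)[OF C(2)[OF t]] by simp
  next
    fix z assume "z \<in> frontier D"
    then show "?f z = 0" using boundary_value_eq[OF t] by simp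
  next
    fix z assume z: "z \<in> interior D"
    then have "((\<lambda>w. H w t) has_derivative (\<lambda>v. dp_dq v (X t z))) (at z)"
      using has_derivative_H[OF _ t, of z] interior_subset at_within_interior[OF z] by auto
    then have "(?f has_derivative (\<lambda>v. dp_dq v (X t z) - 0)) (at z)"
      by (intro has_derivative_diff has_derivative_const)
    then show "(?f has_derivative (\<lambda>v. dp_dq v (X t z))) (at z)" by simp
  qed
  have slice: "continuous_on D (\<lambda>z. (z, t))" by (intro continuous_intros)
  have cH: "continuous_on D (\<lambda>z. H z t)"
    using continuous_on_compose2[OF continuous_on_H slice] t by auto
  have cX: "continuous_on D (\<lambda>z. X t z)"
    using continuous_on_compose2[OF continuous_on_X slice] t by auto
  have int: "F integrable_on D" if F: "continuous_on D F" for F :: "plane \<Rightarrow> real"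
  proof -
    obtain B where B: "\<And>z. z \<in> D \<Longrightarrow> norm (F z) \<le> B" using compact_norm_bound[OF compact_D F] by blast
    then have "F absolutely_integrable_on D"
      by (intro bounded_continuous_absolutely_integrable[OF _ compact_imp_bounded[OF compact_D] F B])
         (use closed_D in auto)
    then show ?thesis by (rule set_lebesgue_integral_eq_integral(1))
  qed
  have "integral D (Lagr t) = integral D (\<lambda>z. dp_dq z (X t z) / 2 - ?f z)"
    by (simp add: Lagr_def[abs_def])
  also have "\<dots> = integral D (\<lambda>z. dp_dq z (X t z) / 2) - integral D ?f"
    by (intro integral_diff int continuous_intros bounded_bilinear.continuous_on[OF bounded_bilinear_dp_dq] cH cX) simp_all
  also have "integral D (\<lambda>z. dp_dq z (X t z) / 2) = integral D (\<lambda>z. dp_dq z (X t z)) / 2"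
    by (rule integral_divide)
  finally show ?thesis using rad by simp
qed

text \<open>Fubini's theorem exchanges the two integrals; at each fixed time area preservation
  removes the flow, and \<open>integral_Lagr\<close> evaluates the rest.\<close>

lemma action_integral:
  shows "action integrable_on D" and "integral D action = - 2 * helicity D H"
proof -
  let ?F = "\<lambda>z t. Lagr t (g t z)" and ?f = "\<lambda>t. - 2 * integral D (\<lambda>z. H z t - boundary_value D H t)"
  obtain B where B: "\<And>t z. t \<in> regular \<Longrightarrow> z \<in> D \<Longrightarrow> norm (Lagr t z) \<le> B"
    by (rule Lagr_bound) blast
  have bddT: "bounded regular" by (rule bounded_subset[OF bounded_closed_interval[of 0 "2 * pi"]]) (auto simp: regular_def)
  have bddD: "bounded D" by (rule compact_imp_bounded[OF compact_D])
  have borT: "regular \<in> sets borel" and borD: "D \<in> sets borel" using open_regular closed_D by auto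
  have bor: "D \<times> regular \<in> sets borel"
    using borel_Times[OF borD borT] .
  \<comment> \<open>Fubini's theorem needs joint integrability; on this bounded product the
    integrand is bounded and continuous.\<close>
  have "set_integrable lborel (D \<times> regular) (\<lambda>x. ?F (fst x) (snd x))"
    by (rule bounded_continuous_set_integrable[OF bor bounded_Times[OF bddD bddT] continuous_on_Lagr_flow, of B])
       (auto intro!: B[unfolded real_norm_def] flow_in)
  then have intI: "integrable (lborel \<Otimes>\<^sub>M lborel) (\<lambda>(z, t). indicator (D \<times> regular) (z, t) *\<^sub>R ?F z t)"
    by (simp add: set_integrable_def lborel_prod case_prod_unfold)
  have prod: "indicator (D \<times> regular) (z, t) *\<^sub>R ?F z t = indicator D z *\<^sub>R (indicator regular t *\<^sub>R ?F z t)" for z t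
    by (simp add: indicator_def)
  have inner_t: "(\<integral>t. indicator (D \<times> regular) (z, t) *\<^sub>R ?F z t \<partial>lborel) = indicator D z *\<^sub>R action z" for z
  proof (cases "z \<in> D")
    case True
    have "continuous_on regular (\<lambda>t. (z, t))" by (intro continuous_intros)
    from continuous_on_compose2[OF continuous_on_Lagr_flow this]
    have c: "continuous_on regular (?F z)" using True by auto
    have "set_integrable lborel regular (?F z)"
      by (rule bounded_continuous_set_integrable[OF borT bddT c, of B]) (use B flow_in True in auto)
    from set_borel_integral_eq_integral(2)[OF this]
    have "(\<integral>t. indicator regular t *\<^sub>R ?F z t \<partial>lborel) = action z"
      by (simp add: set_lebesgue_integral_def action_def integral_regular)
    then show ?thesis unfolding prod using True by simp
  next
    case False
    then show ?thesis by (simp add: indicator_def)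
  qed
  have inner_z: "(\<integral>z. indicator (D \<times> regular) (z, t) *\<^sub>R ?F z t \<partial>lborel)
      = indicator regular t *\<^sub>R ?f t" for t
  proof (cases "t \<in> regular")
    case True
    have t2: "t \<in> {0..2 * pi}" using True by (auto simp: regular_def)
    have slice: "continuous_on D (\<lambda>z. (z, t))" by (intro continuous_intros)
    from continuous_on_compose2[OF continuous_on_Lagr_flow slice]
    have c: "continuous_on D (\<lambda>z. ?F z t)" using True by auto
    from continuous_on_compose2[OF continuous_on_Lagr slice]
    have cL: "continuous_on D (Lagr t)" using True by auto
    have "set_integrable lborel D (\<lambda>z. ?F z t)"
      by (rule bounded_continuous_set_integrable[OF borD bddD c, of B]) (use B flow_in True in auto)
    from set_borel_integral_eq_integral(2)[OF this]
    have "(\<integral>z. indicator D z *\<^sub>R ?F z t \<partial>lborel) = integral D (\<lambda>z. Lagr t (g t z))"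
      by (simp add: set_lebesgue_integral_def)
    also have "\<dots> = integral D (Lagr t)" by (rule flow_preserves_integral[OF t2 cL])
    also have "\<dots> = ?f t" by (rule integral_Lagr[OF True])
    finally show ?thesis unfolding prod using True by simp
  next
    case False
    then show ?thesis by (simp add: indicator_def)
  qed
  have setD: "set_integrable lborel D action"
    using lborel_pair.integrable_fst'[OF intI] by (simp only: inner_t set_integrable_def prod.case)
  show "action integrable_on D" by (rule set_borel_integral_eq_integral(1)[OF setD])
  have setT: "set_integrable lborel regular ?f"
    using lborel_pair.integrable_snd[OF intI] by (simp only: inner_z set_integrable_def)
  have "integral D action = (\<integral>z. indicator D z *\<^sub>R action z \<partial>lborel)"
    using set_borel_integral_eq_integral(2)[OF setD] by (simp add: set_lebesgue_integral_def)
  also have "\<dots> = (\<integral>z. (\<integral>t. indicator (D \<times> regular) (z, t) *\<^sub>R ?F z t \<partial>lborel) \<partial>lborel)"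
    by (simp only: inner_t)
  also have "\<dots> = (\<integral>t. (\<integral>z. indicator (D \<times> regular) (z, t) *\<^sub>R ?F z t \<partial>lborel) \<partial>lborel)"
    by (rule lborel_pair.Fubini_integral[OF intI, symmetric])
  also have "\<dots> = (\<integral>t. indicator regular t *\<^sub>R ?f t \<partial>lborel)"
    by (simp only: inner_z)
  also have "\<dots> = integral regular ?f"
    using set_borel_integral_eq_integral(2)[OF setT] by (simp only: set_lebesgue_integral_def)
  also have "\<dots> = - 2 * helicity D H"
    unfolding helicity_def integral_regular by (rule integral_mult_right)
  finally show "integral D action = - 2 * helicity D H" .
qed

text \<open>Orbits that start on the frontier remain there, where the normalised Hamiltonian
  vanishes, so only \<open>\<lambda>\<close> survives.\<close>

lemma action_frontier:
  assumes z: "z \<in> frontier D"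
  shows "action z = integral {0..2 * pi} (\<lambda>t. dp_dq (g t z) (X t (g t z)) / 2)"
  unfolding action_def integral_regular
proof (rule integral_cong)
  fix t assume t: "t \<in> regular"
  then have "t \<in> {0..2 * pi}" by (auto simp: regular_def)
  then have "g t z \<in> frontier D" using flow_frontier z by blast
  then show "Lagr t (g t z) = dp_dq (g t z) (X t (g t z)) / 2"
    using boundary_value_eq[OF t] by (simp add: Lagr_def)
qed

end


section \<open>Comparison of two Hamiltonians with the same period map\<close>

theorem theorem2p1:
  fixes D :: "(real \<times> real) set"
    and h :: "real \<times> real \<Rightarrow> real \<times> real"
    and H\<^sub>1 H\<^sub>2 :: "real \<times> real \<Rightarrow> real \<Rightarrow> real"
    and J\<^sub>1 J\<^sub>2 :: "real set"
    and g\<^sub>1 g\<^sub>2 :: "real \<Rightarrow> real \<times> real \<Rightarrow> real \<times> real"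
  assumes "smooth_closed_disk D" and "symp_area D > 0"
    and "symplectic_diffeo D h" and "h ` frontier D = frontier D"
    and "is_hamiltonian D J\<^sub>1 H\<^sub>1" and "is_hamiltonian D J\<^sub>2 H\<^sub>2"
    and "is_ham_flow D J\<^sub>1 H\<^sub>1 g\<^sub>1" and "is_ham_flow D J\<^sub>2 H\<^sub>2 g\<^sub>2"
    and "\<And>t. g\<^sub>1 t ` D = D" and "\<And>t. g\<^sub>2 t ` D = D"
    and "\<And>z. z \<in> D \<Longrightarrow> g\<^sub>1 (2 * pi) z = h z" and "\<And>z. z \<in> D \<Longrightarrow> g\<^sub>2 (2 * pi) z = h z"
  shows "\<exists>n::int. helicity D H\<^sub>1 - helicity D H\<^sub>2 = real_of_int n * (symp_area D)\<^sup>2 / 2"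
proof -
  obtain U V \<Phi> \<Psi> where disk: "plane_disk D U V \<Phi> \<Psi>"
    by (rule smooth_closed_disk_imp_plane_disk[OF assms(1)])
  interpret plane_disk D U V \<Phi> \<Psi> by (rule disk)
  interpret s1: disk_system D U V \<Phi> \<Psi> J\<^sub>1 H\<^sub>1 g\<^sub>1
    by unfold_locales (rule assms)+
  interpret s2: disk_system D U V \<Phi> \<Psi> J\<^sub>2 H\<^sub>2 g\<^sub>2
    by unfold_locales (rule assms)+
  obtain K1 where K1: "\<And>z w. z \<in> D \<Longrightarrow> w \<in> D \<Longrightarrow>
      \<bar>s1.action w - s1.action z - (dp_dq (g\<^sub>1 (2 * pi) z) (g\<^sub>1 (2 * pi) w) / 2 - dp_dq z w / 2)\<bar> \<le> K1 * (norm (w - z))\<^sup>2"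
    by (rule s1.action_estimate) blast
  obtain K2 where K2: "\<And>z w. z \<in> D \<Longrightarrow> w \<in> D \<Longrightarrow>
      \<bar>s2.action w - s2.action z - (dp_dq (g\<^sub>2 (2 * pi) z) (g\<^sub>2 (2 * pi) w) / 2 - dp_dq z w / 2)\<bar> \<le> K2 * (norm (w - z))\<^sup>2"
    by (rule s2.action_estimate) blast
  \<comment> \<open>Both flows equal \<open>h\<close> on \<open>D\<close> at time
    \<open>2 * pi\<close>, so the end point terms of the two estimates cancel and only a quadratic
    error is left.\<close>
  obtain c where c: "\<And>z. z \<in> D \<Longrightarrow> s1.action z - s2.action z = c"
  proof (rule quadratic_estimate_imp_constant[of "\<lambda>z. s1.action z - s2.action z" "K1 + K2"])
    fix z w assume zw: "z \<in> D" "w \<in> D"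
    have "g\<^sub>1 (2 * pi) z = g\<^sub>2 (2 * pi) z" "g\<^sub>1 (2 * pi) w = g\<^sub>2 (2 * pi) w" using assms(11,12) zw by simp_all
    then show "\<bar>s1.action w - s2.action w - (s1.action z - s2.action z)\<bar> \<le> (K1 + K2) * (norm (w - z))\<^sup>2"
      using K1[OF zw] K2[OF zw] by (simp add: distrib_right abs_le_iff)
  qed blast
  have "integral D (\<lambda>z. s1.action z - s2.action z) = integral D (\<lambda>z. c)"
    by (rule integral_cong) (rule c)
  moreover have "integral D (\<lambda>z. c) = c * symp_area D"
    unfolding symp_area_def using integral_mult_right[of D c "\<lambda>z. 1"] by simp
  moreover have "integral D (\<lambda>z. s1.action z - s2.action z) = - 2 * helicity D H\<^sub>1 - (- 2 * helicity D H\<^sub>2)"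
    using integral_diff[OF s1.action_integral(1) s2.action_integral(1)]
    by (simp add: s1.action_integral(2) s2.action_integral(2))
  ultimately have hel: "helicity D H\<^sub>1 - helicity D H\<^sub>2 = - c * symp_area D / 2" by simp
  \<comment> \<open>Since the difference of the actions is constant, one boundary orbit of each flow
    determines it.\<close>
  obtain z where z: "z \<in> frontier D" using frontier_nonempty by blast
  then have zD: "z \<in> D" using frontier_subset_D by blast
  obtain n :: int where n: "s1.action z - s2.action z = of_int n * boundary_period"
    unfolding s1.action_frontier[OF z] s2.action_frontier[OF z]
  proof (rule boundary_actions_difference[of "2 * pi" "s1.jumps \<union> s2.jumps" "\<lambda>t. g\<^sub>1 t z" "\<lambda>t. g\<^sub>2 t z"
        "\<lambda>t. s1.X t (g\<^sub>1 t z)" "\<lambda>t. s2.X t (g\<^sub>2 t z)"])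
    \<comment> \<open>The two Hamiltonians may jump at different times, hence the union.\<close>
    show "finite (s1.jumps \<union> s2.jumps)" using s1.finite_jumps s2.finite_jumps by simp
    show "continuous_on {0..2 * pi} (\<lambda>t. g\<^sub>1 t z)" "continuous_on {0..2 * pi} (\<lambda>t. g\<^sub>2 t z)"
      by (rule continuous_on_subset[OF s1.flow_continuous[OF zD]], simp)
         (rule continuous_on_subset[OF s2.flow_continuous[OF zD]], simp)
    show "g\<^sub>1 t z \<in> frontier D" if "t \<in> {0..2 * pi}" for t using s1.flow_frontier[OF that] z by blast
    show "g\<^sub>2 t z \<in> frontier D" if "t \<in> {0..2 * pi}" for t using s2.flow_frontier[OF that] z by blast
    show "((\<lambda>t. g\<^sub>1 t z) has_vector_derivative s1.X t (g\<^sub>1 t z)) (at t)"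
      if "t \<in> {0<..<2 * pi} - (s1.jumps \<union> s2.jumps)" for t
      by (rule s1.flow_derivative_regular(1)[OF zD _ order_refl]) (use that in auto)
    show "((\<lambda>t. g\<^sub>2 t z) has_vector_derivative s2.X t (g\<^sub>2 t z)) (at t)"
      if "t \<in> {0<..<2 * pi} - (s1.jumps \<union> s2.jumps)" for t
      by (rule s2.flow_derivative_regular(1)[OF zD _ order_refl]) (use that in auto)
    show "g\<^sub>1 0 z = g\<^sub>2 0 z" by (simp add: s1.flow_0[OF zD] s2.flow_0[OF zD])
    show "g\<^sub>1 (2 * pi) z = g\<^sub>2 (2 * pi) z" using assms(11,12) zD by simp
  qed (simp, blast)
  then have "c = of_int n * boundary_period" using c[OF zD] by simp
  moreover have "boundary_period = symp_area D \<or> boundary_period = - symp_area D"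
    by (rule boundary_period_eq_area)
  \<comment> \<open>The orientation of the chart affects only the sign, which the integer
    absorbs.\<close>
  ultimately have "c = of_int n * symp_area D \<or> c = of_int (- n) * symp_area D" by auto
  then obtain m :: int where "c = of_int m * symp_area D" by blast
  \<comment> \<open>The witness is negated because of the minus sign in \<open>hel\<close>.\<close>
  then have "helicity D H\<^sub>1 - helicity D H\<^sub>2 = real_of_int (- m) * (symp_area D)\<^sup>2 / 2"
    using hel by (simp add: power2_eq_square)
  then show ?thesis by blast
qed

end
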